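(* Let $R:\mathbb{R}^2\to\mathbb{R}^2$ be the linear involution $R(u,v)=(u,-v)$. Let $X$ be a real-analytic planar vector field defined in a neighbourhood of $(0,0)\in\mathbb{R}^2$, with $X(0,0)=(0,0)$ and $d:=\det DX(0,0)\neq 0$, and suppose that $X$ is reversible with respect to $R$. Then there is a real-analytic function $G$ defined in a neighbourhood of $0\in\mathbb{R}$ with $G(0)>0$ such that, setting $$F(t)=\frac12\int_0^t G(s)\,ds$$ and $$H(x,y)=\begin{cases}F(x^2+y^2), & \text{if } d>0 \ (\text{center case}),\\[4pt] -F(x^2-y^2), & \text{if } d<0\ (\text{saddle case}),\end{cases}$$ the vector field $X$ is analytically conjugate, in a neighbourhood of $(0,0)$, to the Hamiltonian vector field $$X_H(x,y)=\bigl(\partial_y H(x,y),\,-\partial_x H(x,y)\bigr).$$ Moreover, the conjugacy can be chosen equivariant with respect to $R$: there exists a local real-analytic diffeomorphism $h$ at the origin such that, for all $(u,v)$ in a neighbourhood of $(0,0)$, $$Dh(u,v)\,X(u,v)=X_H\bigl(h(u,v)\bigr)\quad\text{and}\quad h(R(u,v))=R(h(u,v)).$$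
   Context: A vector field $X$ is reversible with respect to the linear involution $R$ if $DR(q)\,X(q)=-X(R(q))$ for all $q$ in its domain (here: for all $q$ in a neighbourhood of $(0,0)$); since $R$ is linear this reads $R\,X(q)=-X(R(q))$. Two real-analytic planar vector fields $X_1,X_2$ vanishing at the origin are analytically conjugate in a neighbourhood of $(0,0)$ if there is a real-analytic diffeomorphism $h$ between open neighbourhoods of $(0,0)$, with $h(0,0)=(0,0)$, such that $Dh(q)\,X_1(q)=X_2(h(q))$ for all $q$ near $(0,0)$; a local analytic diffeomorphism at the origin is understood in the same sense (in particular it fixes the origin). *)

theory Defs
  imports "HOL-Analysis.Analysis"
begin

(* HOL-Analysis has "analytic_on" for complex functions only, so real analyticity in one and in
   two variables is defined here: near each point the function is the sum of a (multivariate)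
   Taylor series. The double series is an unordered sum, i.e. absolutely convergent. *)

definition real_analytic1_on :: "(real \<Rightarrow> real) \<Rightarrow> real set \<Rightarrow> bool" where
  "real_analytic1_on f S \<longleftrightarrow>
     (\<forall>p\<in>S. \<exists>c :: nat \<Rightarrow> real. \<exists>r>0. \<forall>t\<in>ball p r. (\<lambda>n. c n * (t - p) ^ n) sums f t)"

definition real_analytic2_on :: "(real^2 \<Rightarrow> real^2) \<Rightarrow> (real^2) set \<Rightarrow> bool" where
  "real_analytic2_on f S \<longleftrightarrow>
     (\<forall>p\<in>S. \<exists>c :: nat \<Rightarrow> nat \<Rightarrow> real^2. \<exists>r>0. \<forall>q\<in>ball p r.
        ((\<lambda>(i, j). ((q$1 - p$1) ^ i * (q$2 - p$2) ^ j) *\<^sub>R c i j) has_sum f q) UNIV)"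

(* Vector fields and maps "defined near the origin" are total functions of which only the germ
   at 0 matters; "for all q near the origin" is "eventually in nhds 0". *)

definition R :: "real^2 \<Rightarrow> real^2" where
  "R q = vector [q$1, - q$2]"

definition reversible_near_0 :: "(real^2 \<Rightarrow> real^2) \<Rightarrow> (real^2 \<Rightarrow> real^2) \<Rightarrow> bool" where
  "reversible_near_0 S X \<longleftrightarrow>
     (\<forall>\<^sub>F q in nhds 0. frechet_derivative S (at q) (X q) = - X (S q))"

definition local_analytic_diffeo :: "(real^2 \<Rightarrow> real^2) \<Rightarrow> bool" where
  "local_analytic_diffeo h \<longleftrightarrow> h 0 = 0 \<and>
     (\<exists>U V. open U \<and> open V \<and> 0 \<in> U \<and> 0 \<in> V \<and> bij_betw h U V \<and>
        real_analytic2_on h U \<and> real_analytic2_on (inv_into U h) V)"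

definition conjugates_near_0 ::
  "(real^2 \<Rightarrow> real^2) \<Rightarrow> (real^2 \<Rightarrow> real^2) \<Rightarrow> (real^2 \<Rightarrow> real^2) \<Rightarrow> bool" where
  "conjugates_near_0 h X\<^sub>1 X\<^sub>2 \<longleftrightarrow>
     (\<forall>\<^sub>F q in nhds 0. frechet_derivative h (at q) (X\<^sub>1 q) = X\<^sub>2 (h q))"

definition analytically_conjugate :: "(real^2 \<Rightarrow> real^2) \<Rightarrow> (real^2 \<Rightarrow> real^2) \<Rightarrow> bool" where
  "analytically_conjugate X\<^sub>1 X\<^sub>2 \<longleftrightarrow>
     (\<exists>h. local_analytic_diffeo h \<and> conjugates_near_0 h X\<^sub>1 X\<^sub>2)"

definition hamiltonian_vf :: "(real \<Rightarrow> real \<Rightarrow> real) \<Rightarrow> real^2 \<Rightarrow> real^2" where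
  "hamiltonian_vf H q =
     vector [deriv (\<lambda>y. H (q$1) y) (q$2), - deriv (\<lambda>x. H x (q$2)) (q$1)]"

(* The interval integral is oriented, so for t < 0 this is minus the integral over [t, 0];
   negative t occur in the saddle case. *)
definition half_primitive :: "(real \<Rightarrow> real) \<Rightarrow> real \<Rightarrow> real" where
  "half_primitive G t = 1/2 * (LBINT s=0..t. G s)"

definition normal_form_H :: "real \<Rightarrow> (real \<Rightarrow> real) \<Rightarrow> real \<Rightarrow> real \<Rightarrow> real" where
  "normal_form_H d F x y = (if d > 0 then F (x\<^sup>2 + y\<^sup>2) else - F (x\<^sup>2 - y\<^sup>2))"

end

theory Submission
  imports Defs
begin

text \<open>
  Write a point of the plane as z = u + j v, w = u - j v, where j is a square root of -1 in the
  centre case and of 1 in the saddle case, that is, j * j = - \<epsilon> with \<epsilon> the sign of d.  The involution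
  exchanges z and w, so a reversible field is determined by one function:
  z' = - \<epsilon> j F(z, w) and w' = \<epsilon> j F(w, z).  In both cases F has real coefficients
  (\<open>cplx_field\<close>), which is why centre and saddle are treated together.  The Hamiltonian
  field of the statement is the one with F(\<xi>, \<eta>) = G(\<xi> \<eta>) \<xi>.

  A change of variables of the form (\<xi>, \<eta>) \<mapsto> (x(\<xi>, \<eta>), x(\<eta>, \<xi>)) commutes with the involution.  It
  carries the normal form to the given field as soon as the single scalar equation
  G(\<xi> \<eta>) (\<xi> \<partial>/\<partial>\<xi> - \<eta> \<partial>/\<partial>\<eta>) x(\<xi>, \<eta>) = F(x(\<xi>, \<eta>), x(\<eta>, \<xi>)) holds, because the equation for the second
  component is the mirror image of the first.  This is where reversibility enters: for a general field
  the two components would ask for two different functions G.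

  The operator \<xi> \<partial>/\<partial>\<xi> - \<eta> \<partial>/\<partial>\<eta> multiplies the monomial with exponents (m, n) by m - n.  With leading terms
  removed, the equation for x therefore has the divisors m - n - 1.  They vanish exactly on the
  resonant monomials \<xi> (\<xi> \<eta>)^n, and those are absorbed by G; all others have absolute value at least 1.  The
  derivative that occurs in the equation costs nothing either, since (m - n) / (m - n - 1) stays bounded.
  So x and G are found together as the fixed point of a contraction of the Banach algebra of double
  power series with absolutely summable coefficients (\<open>normal_form_series\<close>), and convergence is
  built in.

  The analysis is reduced to algebra by one construction: substituting two elements of norm at most 1
  of a commutative Banach algebra into such a series is a contractive algebra homomorphism
  (\<open>contractive_hom_subst\<close>), and homomorphisms commute with substitution
  (\<open>hom_subst\<close>).  With the real or complex numbers as the target this is evaluation; with the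
  algebra of series itself it is composition and re-expansion at another point, hence analyticity on a
  neighbourhood (\<open>real_analytic2_on_ev2\<close>).  The conjugacy h is the inverse of the change of
  variables above; its analyticity comes from a second contraction (\<open>local_inverse_ev2\<close>).
\<close>

section \<open>The Banach algebra of absolutely summable double power series\<close>

definition abs_conv :: "'a::real_normed_field fps fps \<Rightarrow> bool" where
  "abs_conv f \<longleftrightarrow> (\<lambda>(i, j). norm (fps_nth (fps_nth f i) j)) summable_on UNIV"

text \<open>
  Nested formal power series supply the ring axioms, so only summability and the norm have to be added
  to obtain a commutative Banach algebra.
\<close>

typedef (overloaded) 'a l1ps = "{f :: 'a::{real_normed_field, banach} fps fps. abs_conv f}"
proof
  show "0 \<in> {f :: 'a fps fps. abs_conv f}"
    by (simp add: abs_conv_def case_prod_unfold)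
qed

definition coef :: "'a::{real_normed_field, banach} l1ps \<Rightarrow> nat \<Rightarrow> nat \<Rightarrow> 'a" where
  "coef c i j = fps_nth (fps_nth (Rep_l1ps c) i) j"

definition l1_summable :: "(nat \<Rightarrow> nat \<Rightarrow> 'a::real_normed_vector) \<Rightarrow> bool" where
  "l1_summable f \<longleftrightarrow> (\<lambda>(i, j). norm (f i j)) summable_on UNIV"

text \<open>
  Meaningful for absolutely summable families only; every use is accompanied by a proof of summability.
\<close>

definition of_coeffs :: "(nat \<Rightarrow> nat \<Rightarrow> 'a::{real_normed_field, banach}) \<Rightarrow> 'a l1ps" where
  "of_coeffs f = Abs_l1ps (Abs_fps (\<lambda>i. Abs_fps (\<lambda>j. f i j)))"

lemma l1_summable_coef: "l1_summable (coef c)"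
  using Rep_l1ps[of c] by (simp add: l1_summable_def abs_conv_def coef_def)

lemma coef_of_coeffs: "l1_summable f \<Longrightarrow> coef (of_coeffs f) = f"
  by (simp add: fun_eq_iff coef_def of_coeffs_def l1_summable_def abs_conv_def Abs_l1ps_inverse)

lemma l1ps_eqI: "(\<And>i j. coef a i j = coef b i j) \<Longrightarrow> a = b"
  by (simp add: coef_def Rep_l1ps_inject[symmetric] fps_eq_iff)

lemma l1_summable_comparison:
  assumes "l1_summable f" "\<And>i j. norm (g i j) \<le> norm (f i j)"
  shows "l1_summable g"
  unfolding l1_summable_def
  by (rule summable_on_comparison_test[OF assms(1)[unfolded l1_summable_def]]) (auto simp: assms(2))

lemma l1_summable_add:
  assumes "l1_summable f" "l1_summable g" shows "l1_summable (\<lambda>i j. f i j + g i j)"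
proof -
  have "(\<lambda>(i,j). norm (f i j) + norm (g i j)) summable_on UNIV"
    using summable_on_add[OF assms[unfolded l1_summable_def]] by (simp add: case_prod_unfold)
  then have "l1_summable (\<lambda>i j. norm (f i j) + norm (g i j))"
    by (simp add: l1_summable_def case_prod_unfold)
  then show ?thesis by (rule l1_summable_comparison) (simp add: norm_triangle_ineq)
qed

lemma l1_summable_mult:
  assumes "l1_summable f" "\<And>i j. norm (g i j) \<le> K * norm (f i j)"
  shows "l1_summable g"
  unfolding l1_summable_def
  by (rule summable_on_comparison_test[OF summable_on_cmult_right[OF assms(1)[unfolded l1_summable_def], of K]])
    (auto simp: assms(2))

lemma l1_summable_finite: "finite {(i,j). f i j \<noteq> 0} \<Longrightarrow> l1_summable f"
  unfolding l1_summable_def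
  by (rule finite_nonzero_values_imp_summable_on) (simp add: case_prod_unfold)

text \<open>
  The Cauchy product for double series: the product family over pairs of exponents is absolutely
  summable, and grouping it by the sum of the exponents gives the convolution.  Applied to the norms of
  the coefficients it makes the norm submultiplicative, applied to the terms of two series it makes
  evaluation multiplicative.
\<close>

lemma cauchy_double:
  fixes f g :: "nat \<times> nat \<Rightarrow> 'b::{banach, real_normed_algebra}"
  assumes f: "(\<lambda>x. norm (f x)) summable_on UNIV" and g: "(\<lambda>x. norm (g x)) summable_on UNIV"
  shows "((\<lambda>(n,m). \<Sum>i=0..n. \<Sum>j=0..m. f (i,j) * g (n-i, m-j)) has_sum (infsum f UNIV * infsum g UNIV)) UNIV"
proof -
  define h where "h = (\<lambda>(x,y). f x * g y)"
  define k where "k = (\<lambda>(x,y). norm (f x) * norm (g y))"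
  have "(\<lambda>x. norm (k x)) summable_on UNIV \<times> UNIV"
  proof (rule iffD2[OF Infinite_Sum.abs_summable_on_Sigma_iff], intro conjI ballI)
    fix x show "(\<lambda>y. norm (k (x, y))) summable_on UNIV"
      using g by (simp add: k_def abs_mult summable_on_cmult_right)
    have "(\<Sum>\<^sub>\<infinity>y. norm (k (x, y))) = norm (f x) * (\<Sum>\<^sub>\<infinity>y. norm (g y))" for x
      using g by (simp add: k_def abs_mult infsum_cmult_right)
    then show "(\<lambda>x. norm (\<Sum>\<^sub>\<infinity>y. norm (k (x, y)))) summable_on UNIV"
      using f by (simp add: abs_mult infsum_nonneg summable_on_cmult_left)
  qed
  then have "(\<lambda>x. norm (h x)) summable_on UNIV \<times> UNIV"
    by (rule summable_on_comparison_test) (auto simp: h_def k_def abs_mult norm_mult_ineq)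
  then have hsum: "h summable_on UNIV \<times> UNIV"
    by (rule abs_summable_summable)
  have tot: "(h has_sum (infsum f UNIV * infsum g UNIV)) (UNIV \<times> UNIV)"
  proof (rule has_sum_SigmaI[where g = "\<lambda>x. f x * infsum g UNIV"])
    fix x show "((\<lambda>y. h (x,y)) has_sum f x * infsum g UNIV) UNIV"
      unfolding h_def prod.case
      by (rule has_sum_cmult_right[OF has_sum_infsum[OF abs_summable_summable[OF g]]])
  next
    show "((\<lambda>x. f x * infsum g UNIV) has_sum infsum f UNIV * infsum g UNIV) UNIV"
      by (rule has_sum_cmult_left[OF has_sum_infsum[OF abs_summable_summable[OF f]]])
  qed (rule hsum)
  \<comment> \<open>Group the pairs of exponents by their sum nm; ij is the exponent of the first factor.\<close>
  let ?S = "SIGMA nm:UNIV::(nat\<times>nat) set. {0..fst nm} \<times> {0..snd nm}"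
  let ?k = "\<lambda>(nm,ij). ((fst ij, snd ij), (fst nm - fst ij, snd nm - snd ij))"
  have "((\<lambda>x. h (?k x)) has_sum (infsum f UNIV * infsum g UNIV)) ?S \<longleftrightarrow>
        (h has_sum (infsum f UNIV * infsum g UNIV)) (UNIV \<times> UNIV)"
    by (rule has_sum_reindex_bij_witness[where i="\<lambda>((i,j),(k,l)). ((i+k,j+l),(i,j))" and j="?k"]) auto
  with tot have "((\<lambda>x. h (?k x)) has_sum (infsum f UNIV * infsum g UNIV)) ?S" by simp
  then have "((\<lambda>nm. \<Sum>ij\<in>{0..fst nm} \<times> {0..snd nm}. h (?k (nm,ij))) has_sum (infsum f UNIV * infsum g UNIV)) UNIV"
    by (rule has_sum_SigmaD) (auto intro: has_sum_finite)
  then show ?thesis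
    by (simp add: h_def case_prod_unfold sum.cartesian_product)
qed

lemma Rep_coef: "fps_nth (fps_nth (Rep_l1ps c) i) j = coef c i j"
  by (simp add: coef_def)

lemma abs_conv_iff: "abs_conv f \<longleftrightarrow> l1_summable (\<lambda>i j. fps_nth (fps_nth f i) j)"
  by (simp add: abs_conv_def l1_summable_def)

lemma abs_convI:
  "l1_summable g \<Longrightarrow> (\<And>i j. fps_nth (fps_nth f i) j = g i j) \<Longrightarrow> abs_conv f"
  by (simp add: abs_conv_iff)

lemma mult_nth2: "fps_nth (fps_nth (f * g) n) m =
    (\<Sum>i=0..n. \<Sum>j=0..m. fps_nth (fps_nth f i) j * fps_nth (fps_nth g (n-i)) (m-j))"
  by (simp add: fps_mult_nth fps_sum_nth)

lemma conv_summable: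
  fixes f g :: "nat \<Rightarrow> nat \<Rightarrow> 'a::{real_normed_field}"
  assumes "l1_summable f" "l1_summable g"
  defines "h \<equiv> (\<lambda>n m. \<Sum>i=0..n. \<Sum>j=0..m. f i j * g (n-i) (m-j))"
  shows "l1_summable h"
    and "(\<Sum>\<^sub>\<infinity>(i,j). norm (h i j)) \<le> (\<Sum>\<^sub>\<infinity>(i,j). norm (f i j)) * (\<Sum>\<^sub>\<infinity>(i,j). norm (g i j))"
proof -
  let ?f = "\<lambda>(i,j). norm (f i j)" and ?g = "\<lambda>(i,j). norm (g i j)"
  let ?H = "\<lambda>(n,m). \<Sum>i=0..n. \<Sum>j=0..m. ?f (i,j) * ?g (n-i, m-j)"
  have H: "(?H has_sum (infsum ?f UNIV * infsum ?g UNIV)) UNIV"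
    by (rule cauchy_double) (use assms in \<open>auto simp: l1_summable_def case_prod_unfold\<close>)
  have le: "norm (h n m) \<le> ?H (n,m)" for n m
    unfolding h_def prod.case
    by (intro order_trans[OF norm_sum] sum_mono order_trans[OF norm_sum]) (simp add: norm_mult)
  have "l1_summable (\<lambda>n m. ?H (n,m))"
    using has_sum_imp_summable[OF H] summable_on_iff_abs_summable_on_real[of ?H UNIV]
    by (simp add: l1_summable_def case_prod_unfold)
  then show *: "l1_summable h"
  proof (rule l1_summable_comparison)
    fix i j show "norm (h i j) \<le> norm (?H (i,j))" using le[of i j] order_trans[OF le[of i j] abs_ge_self] by simp
  qed
  have "(\<Sum>\<^sub>\<infinity>(i,j). norm (h i j)) \<le> infsum ?H UNIV"
    by (rule infsum_mono) (use * le has_sum_imp_summable[OF H] in \<open>auto simp: l1_summable_def\<close>)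
  also have "\<dots> = infsum ?f UNIV * infsum ?g UNIV" using H by (rule infsumI)
  finally show "(\<Sum>\<^sub>\<infinity>(i,j). norm (h i j)) \<le> (\<Sum>\<^sub>\<infinity>(i,j). norm (f i j)) * (\<Sum>\<^sub>\<infinity>(i,j). norm (g i j))" .
qed

instantiation l1ps :: ("{real_normed_field, banach}") comm_ring_1
begin

definition "0 = Abs_l1ps 0"
definition "1 = Abs_l1ps 1"
definition "a + b = Abs_l1ps (Rep_l1ps a + Rep_l1ps b)"
definition "a - b = Abs_l1ps (Rep_l1ps a - Rep_l1ps b)"
definition "- a = Abs_l1ps (- Rep_l1ps a)"
definition "a * b = Abs_l1ps (Rep_l1ps a * Rep_l1ps b)"

lemma Rep_zero: "Rep_l1ps (0::'a l1ps) = 0"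
  unfolding zero_l1ps_def
  by (rule Abs_l1ps_inverse) (simp add: abs_conv_def case_prod_unfold)

lemma Rep_one: "Rep_l1ps (1::'a l1ps) = 1"
proof -
  have "finite {(i,j). fps_nth (fps_nth (1::'a fps fps) i) j \<noteq> 0}"
    by (rule finite_subset[of _ "{(0,0)}"]) (auto simp: fps_one_nth split: if_splits)
  then have "abs_conv (1::'a fps fps)" unfolding abs_conv_iff by (rule l1_summable_finite)
  then show ?thesis unfolding one_l1ps_def by (intro Abs_l1ps_inverse) simp
qed

lemma Rep_uminus: "Rep_l1ps (- a :: 'a l1ps) = - Rep_l1ps a"
  unfolding uminus_l1ps_def
  by (rule Abs_l1ps_inverse, rule CollectI, rule abs_convI[OF l1_summable_comparison[OF l1_summable_coef[of a]]])
    (auto simp: Rep_coef)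

lemma Rep_plus: "Rep_l1ps (a + b :: 'a l1ps) = Rep_l1ps a + Rep_l1ps b"
  unfolding plus_l1ps_def
  by (rule Abs_l1ps_inverse, rule CollectI, rule abs_convI[OF l1_summable_add[OF l1_summable_coef[of a] l1_summable_coef[of b]]])
    (simp add: Rep_coef)

lemma Rep_minus: "Rep_l1ps (a - b :: 'a l1ps) = Rep_l1ps a - Rep_l1ps b"
  using Rep_plus[of a "-b"] unfolding Rep_uminus
  by (simp add: plus_l1ps_def minus_l1ps_def Rep_uminus)

lemma Rep_times: "Rep_l1ps (a * b :: 'a l1ps) = Rep_l1ps a * Rep_l1ps b"
  unfolding times_l1ps_def
  by (rule Abs_l1ps_inverse, rule CollectI, rule abs_convI[OF conv_summable(1)[OF l1_summable_coef[of a] l1_summable_coef[of b]]])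
    (simp add: Rep_coef mult_nth2)

instance
  by standard (simp_all add: Rep_l1ps_inject[symmetric] Rep_zero Rep_one Rep_plus Rep_minus Rep_times
      Rep_uminus algebra_simps)

end

lemma coef_zero [simp]: "coef 0 i j = 0"
  by (simp add: coef_def Rep_zero)

lemma coef_one: "coef 1 i j = (if i = 0 \<and> j = 0 then 1 else 0)"
  by (simp add: coef_def Rep_one fps_one_nth)

lemma coef_add [simp]: "coef (a + b) i j = coef a i j + coef b i j"
  by (simp add: coef_def Rep_plus)

lemma coef_minus [simp]: "coef (a - b) i j = coef a i j - coef b i j"
  by (simp add: coef_def Rep_minus)

lemma coef_uminus [simp]: "coef (- a) i j = - coef a i j"
  by (simp add: coef_def Rep_uminus)

lemma coef_mult: "coef (a * b) n m = (\<Sum>i=0..n. \<Sum>j=0..m. coef a i j * coef b (n-i) (m-j))"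
  by (simp add: coef_def Rep_times mult_nth2)

instantiation l1ps :: ("{real_normed_field, banach}") real_normed_algebra_1
begin

definition "r *\<^sub>R a = of_coeffs (\<lambda>i j. r *\<^sub>R coef a i j)"
definition "norm a = (\<Sum>\<^sub>\<infinity>(i,j). norm (coef a i j))"
definition "dist (a::'a l1ps) b = norm (a - b)"
definition "sgn (a::'a l1ps) = inverse (norm a) *\<^sub>R a"
definition [code del]: "(uniformity :: ('a l1ps \<times> 'a l1ps) filter) = (INF e\<in>{0<..}. principal {(x, y). dist x y < e})"
definition [code del]: "open (S :: 'a l1ps set) \<longleftrightarrow> (\<forall>x\<in>S. \<forall>\<^sub>F (x', y) in uniformity. x' = x \<longrightarrow> y \<in> S)"

lemma coef_scaleR [simp]: "coef (r *\<^sub>R a :: 'a l1ps) i j = r *\<^sub>R coef a i j"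
proof -
  have "l1_summable (\<lambda>i j. r *\<^sub>R coef a i j)"
    by (rule l1_summable_mult[OF l1_summable_coef[of a], of _ "\<bar>r\<bar>"]) simp
  then show ?thesis by (simp add: scaleR_l1ps_def coef_of_coeffs)
qed

lemma summable_norm_coef: "(\<lambda>(i,j). norm (coef (a::'a l1ps) i j)) summable_on UNIV"
  using l1_summable_coef[of a] by (simp add: l1_summable_def)

lemma norm_coef_le: "norm (coef (a::'a l1ps) i j) \<le> norm a"
  using finite_sum_le_infsum[OF summable_norm_coef[of a], of "{(i,j)}"]
  by (auto simp: norm_l1ps_def)

instance
proof
  fix a b :: "'a l1ps" and r s :: real
  show "dist a b = norm (a - b)" by (simp add: dist_l1ps_def)
  show "sgn a = inverse (norm a) *\<^sub>R a" by (simp add: sgn_l1ps_def)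
  show "r *\<^sub>R (a + b) = r *\<^sub>R a + r *\<^sub>R b" "(r + s) *\<^sub>R a = r *\<^sub>R a + s *\<^sub>R a"
    "r *\<^sub>R s *\<^sub>R a = (r * s) *\<^sub>R a" "1 *\<^sub>R a = a"
    by (rule l1ps_eqI, simp add: algebra_simps)+
  show "(r *\<^sub>R a) * b = r *\<^sub>R (a * b)" "a * (r *\<^sub>R b) = r *\<^sub>R (a * b)"
    by (rule l1ps_eqI, simp add: coef_mult scaleR_sum_right)+
  show "(norm a = 0) = (a = 0)"
  proof
    assume "norm a = 0"
    with norm_coef_le[of a] show "a = 0" by (intro l1ps_eqI) simp
  qed (simp add: norm_l1ps_def case_prod_unfold)
  show "norm (a + b) \<le> norm a + norm b"
  proof -
    have s: "(\<lambda>x. (case x of (i,j) \<Rightarrow> norm (coef a i j)) + (case x of (i,j) \<Rightarrow> norm (coef b i j))) summable_on UNIV"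
      by (intro summable_on_add summable_norm_coef)
    have "norm (a + b) \<le> (\<Sum>\<^sub>\<infinity>x. (case x of (i,j) \<Rightarrow> norm (coef a i j)) + (case x of (i,j) \<Rightarrow> norm (coef b i j)))"
      unfolding norm_l1ps_def
      by (rule infsum_mono[OF summable_norm_coef s]) (auto simp: norm_triangle_ineq)
    also have "\<dots> = norm a + norm b"
      unfolding norm_l1ps_def by (intro infsum_add summable_norm_coef)
    finally show ?thesis .
  qed
  show "norm (r *\<^sub>R a) = \<bar>r\<bar> * norm a"
    unfolding norm_l1ps_def
    by (subst infsum_cmult_right[symmetric]) (auto simp: summable_norm_coef intro!: infsum_cong)
  show "norm (a * b) \<le> norm a * norm b"
    using conv_summable(2)[OF l1_summable_coef[of a] l1_summable_coef[of b]]
    by (simp add: norm_l1ps_def coef_mult)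
  show "norm (1::'a l1ps) = 1"
  proof -
    have "norm (1::'a l1ps) = (\<Sum>\<^sub>\<infinity>x\<in>{(0,0)}. norm (coef (1::'a l1ps) (fst x) (snd x)))"
      unfolding norm_l1ps_def
      by (rule infsum_cong_neutral) (auto simp: coef_one split: if_splits)
    also have "\<dots> = 1" by (simp add: coef_one)
    finally show ?thesis .
  qed
qed (rule uniformity_l1ps_def open_l1ps_def)+

end

lemma finite_sum_coef_le_norm:
  assumes "finite S" shows "(\<Sum>(i,j)\<in>S. norm (coef a i j)) \<le> norm a"
  unfolding norm_l1ps_def
  by (rule finite_sum_le_infsum[OF summable_norm_coef assms]) auto

text \<open>
  Coefficients converge one by one.  A bound on the finite partial sums of the distances passes to the
  limit, which gives both the summability of the limit and the convergence in norm.
\<close>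

instance l1ps :: ("{real_normed_field, banach}") banach
proof
  fix X :: "nat \<Rightarrow> 'a l1ps"
  assume X: "Cauchy X"
  have "Cauchy (\<lambda>n. coef (X n) i j)" for i j
  proof (rule CauchyI)
    fix e :: real assume "e > 0"
    from CauchyD[OF X this] obtain M where M: "\<forall>m\<ge>M. \<forall>n\<ge>M. norm (X m - X n) < e" by auto
    have "norm (coef (X m) i j - coef (X n) i j) \<le> norm (X m - X n)" for m n
      using norm_coef_le[of "X m - X n" i j] by simp
    then show "\<exists>M. \<forall>m\<ge>M. \<forall>n\<ge>M. norm (coef (X m) i j - coef (X n) i j) < e" using M order_le_less_trans by blast
  qed
  then have "\<exists>l. (\<lambda>n. coef (X n) i j) \<longlonglongrightarrow> l" for i j
    using Cauchy_convergent convergentD by blast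
  then obtain l where l: "\<And>i j. (\<lambda>n. coef (X n) i j) \<longlonglongrightarrow> l i j" by metis
  have bd: "\<exists>M. \<forall>m\<ge>M. \<forall>S. finite S \<longrightarrow> (\<Sum>(i,j)\<in>S. norm (coef (X m) i j - l i j)) \<le> e" if e: "e > 0" for e
  proof -
    from CauchyD[OF X e] obtain M where M: "\<forall>m\<ge>M. \<forall>n\<ge>M. norm (X m - X n) < e" by auto
    have "(\<Sum>(i,j)\<in>S. norm (coef (X m) i j - l i j)) \<le> e" if "m \<ge> M" "finite S" for m S
    proof (rule LIMSEQ_le_const2)
      show "(\<lambda>n. \<Sum>(i,j)\<in>S. norm (coef (X m) i j - coef (X n) i j)) \<longlonglongrightarrow> (\<Sum>(i,j)\<in>S. norm (coef (X m) i j - l i j))"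
        unfolding case_prod_unfold by (intro tendsto_intros l)
      have "(\<Sum>(i,j)\<in>S. norm (coef (X m) i j - coef (X n) i j)) \<le> e" if "n \<ge> M" for n
        using finite_sum_coef_le_norm[OF \<open>finite S\<close>, of "X m - X n"] M \<open>m \<ge> M\<close> that by force
      then show "\<exists>N. \<forall>n\<ge>N. (\<Sum>(i,j)\<in>S. norm (coef (X m) i j - coef (X n) i j)) \<le> e" by blast
    qed
    then show ?thesis by blast
  qed
  have sm: "l1_summable (\<lambda>i j. coef (X m) i j - l i j)"
    if "\<And>S. finite S \<Longrightarrow> (\<Sum>(i,j)\<in>S. norm (coef (X m) i j - l i j)) \<le> e" for m e
    unfolding l1_summable_def
    by (rule nonneg_bdd_above_summable_on) (auto intro!: bdd_aboveI2[of _ _ e] that)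
  obtain M where M: "\<forall>S. finite S \<longrightarrow> (\<Sum>(i,j)\<in>S. norm (coef (X M) i j - l i j)) \<le> 1"
    using bd[of 1] by auto
  have "l1_summable (\<lambda>i j. coef (X M) i j - (coef (X M) i j - l i j))"
    using l1_summable_add[OF l1_summable_coef[of "X M"], of "\<lambda>i j. - (coef (X M) i j - l i j)"] sm[of M 1] M
    by (simp add: l1_summable_def norm_minus_commute)
  then have cl: "coef (of_coeffs l) = l" by (intro coef_of_coeffs) simp
  have "X \<longlonglongrightarrow> of_coeffs l"
  proof (rule LIMSEQ_I)
    fix e :: real assume e: "e > 0"
    obtain M where M: "\<And>m S. m \<ge> M \<Longrightarrow> finite S \<Longrightarrow> (\<Sum>(i,j)\<in>S. norm (coef (X m) i j - l i j)) \<le> e/2"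
      using bd[of "e/2"] e by auto
    have "norm (X m - of_coeffs l) < e" if m: "m \<ge> M" for m
    proof -
      have "norm (X m - of_coeffs l) \<le> e/2"
        unfolding norm_l1ps_def
        by (rule infsum_le_finite_sums[OF summable_norm_coef]) (use M[OF m] in \<open>simp add: cl\<close>)
      then show ?thesis using e by simp
    qed
    then show "\<exists>no. \<forall>n\<ge>no. norm (X n - of_coeffs l) < e" by blast
  qed
  then show "convergent X" by (rule convergentI)
qed

section \<open>Substitution into double power series\<close>

text \<open>
  Homomorphisms of norm at most 1.  The class is closed under substitution, which turns evaluations,
  compositions, complex conjugation and coefficient embeddings into instances of one notion.
\<close>

definition contractive_hom ::
    "('a::{real_normed_algebra_1, comm_ring_1} \<Rightarrow> 'b::{real_normed_algebra_1, comm_ring_1}) \<Rightarrow> bool" where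
  "contractive_hom f \<longleftrightarrow> (\<forall>x y. f (x + y) = f x + f y) \<and> (\<forall>x y. f (x * y) = f x * f y) \<and> f 1 = 1 \<and>
     (\<forall>r x. f (r *\<^sub>R x) = r *\<^sub>R f x) \<and> (\<forall>x. norm (f x) \<le> norm x)"

lemma contractive_homD:
  assumes "contractive_hom f"
  shows "f (x + y) = f x + f y" "f (x * y) = f x * f y" "f 1 = 1" "f (r *\<^sub>R x) = r *\<^sub>R f x"
    "norm (f x) \<le> norm x" "f 0 = 0" "f (- x) = - f x" "f (x - y) = f x - f y" "f (x ^ n) = f x ^ n"
proof -
  note * = assms[unfolded contractive_hom_def]
  show add: "f (x + y) = f x + f y" and mult: "f (x * y) = f x * f y" and one: "f 1 = 1" and sc: "f (r *\<^sub>R x) = r *\<^sub>R f x"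
    and "norm (f x) \<le> norm x" for x y r using * by auto
  show "f 0 = 0" using sc[of 0 0] by simp
  show m: "f (- x) = - f x" for x using sc[of "-1" x] by simp
  show "f (x - y) = f x - f y" using add[of x "-y"] m by simp
  show "f (x ^ n) = f x ^ n" by (induction n) (simp_all add: one mult)
qed

lemma bounded_linear_contractive_hom: "contractive_hom f \<Longrightarrow> bounded_linear f"
  by (rule bounded_linear_intro[of f 1]) (auto simp: contractive_homD)

lemma contractive_hom_id: "contractive_hom (\<lambda>x. x)"
  by (simp add: contractive_hom_def)

lemma contractive_hom_of_real: "contractive_hom of_real"
  by (simp add: contractive_hom_def scaleR_conv_of_real)

lemma contractive_hom_cnj: "contractive_hom cnj"
  by (simp add: contractive_hom_def scaleR_conv_of_real)

lemma contractive_hom_comp_of_real: "contractive_hom f \<Longrightarrow> f (of_real r) = of_real r"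
  using contractive_homD(4)[of f r 1] by (simp add: contractive_homD(3) scaleR_conv_of_real)

text \<open>
  The map \<open>\<iota>\<close> embeds the coefficients into the target algebra: it is the inclusion of
  the reals into any algebra for real series, and the identity for evaluating a complex series at complex
  numbers.
\<close>

definition subst :: "('a::{real_normed_field, banach} \<Rightarrow> 'b::{banach, real_normed_algebra_1, comm_ring_1})
    \<Rightarrow> 'b \<Rightarrow> 'b \<Rightarrow> 'a l1ps \<Rightarrow> 'b" where
  "subst \<iota> a b c = (\<Sum>\<^sub>\<infinity>(i,j). \<iota> (coef c i j) * (a ^ i * b ^ j))"

lemma norm_monomial_le:
  fixes a b :: "'b::{real_normed_algebra_1}"
  assumes "norm a \<le> \<rho>" "norm b \<le> \<rho>"
  shows "norm (a ^ i * b ^ j) \<le> \<rho> ^ (i + j)"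
proof -
  have "0 \<le> \<rho>" using assms(1) norm_ge_zero order_trans by blast
  have "norm (a ^ i * b ^ j) \<le> norm a ^ i * norm b ^ j"
    by (intro order_trans[OF norm_mult_ineq] mult_mono norm_power_ineq) auto
  also have "\<dots> \<le> \<rho> ^ i * \<rho> ^ j"
    using assms \<open>0 \<le> \<rho>\<close> by (intro mult_mono power_mono) auto
  finally show ?thesis by (simp add: power_add)
qed

lemma subst_term_le:
  assumes "contractive_hom \<iota>" "norm a \<le> 1" "norm b \<le> 1"
  shows "norm (\<iota> x * (a ^ i * b ^ j)) \<le> norm x"
proof -
  have "norm (\<iota> x * (a ^ i * b ^ j)) \<le> norm x * 1"
    using norm_monomial_le[OF assms(2,3), of i j] contractive_homD(5)[OF assms(1), of x]
    by (intro order_trans[OF norm_mult_ineq mult_mono]) auto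
  then show ?thesis by simp
qed

lemma summable_subst:
  assumes "contractive_hom \<iota>" "norm a \<le> 1" "norm b \<le> 1"
  shows "(\<lambda>x. norm (case x of (i,j) \<Rightarrow> \<iota> (coef c i j) * (a ^ i * b ^ j))) summable_on UNIV"
  by (rule summable_on_comparison_test[OF summable_norm_coef[of c]])
    (auto simp: subst_term_le[OF assms])

lemma has_sum_subst:
  assumes "contractive_hom \<iota>" "norm a \<le> 1" "norm b \<le> 1"
  shows "((\<lambda>(i,j). \<iota> (coef c i j) * (a ^ i * b ^ j)) has_sum subst \<iota> a b c) UNIV"
  unfolding subst_def
  by (rule has_sum_infsum[OF abs_summable_summable[OF summable_subst[OF assms]]])

lemma subst_eqI:
  assumes "((\<lambda>(i,j). \<iota> (coef c i j) * (a ^ i * b ^ j)) has_sum s) UNIV"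
  shows "subst \<iota> a b c = s"
  unfolding subst_def using assms by (rule infsumI)

lemma norm_subst_le:
  assumes "contractive_hom \<iota>" "norm a \<le> 1" "norm b \<le> 1"
  shows "norm (subst \<iota> a b c) \<le> norm c"
proof -
  have "norm (subst \<iota> a b c) \<le> (\<Sum>\<^sub>\<infinity>x. norm (case x of (i,j) \<Rightarrow> \<iota> (coef c i j) * (a ^ i * b ^ j)))"
    unfolding subst_def by (rule norm_infsum_bound) (rule summable_subst[OF assms])
  also have "\<dots> \<le> norm c"
    unfolding norm_l1ps_def
    by (rule infsum_mono[OF summable_subst[OF assms] summable_norm_coef])
      (auto simp: subst_term_le[OF assms])
  finally show ?thesis .
qed

definition mon :: "'a::{real_normed_field, banach} \<Rightarrow> nat \<Rightarrow> nat \<Rightarrow> 'a l1ps" where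
  "mon r m n = of_coeffs (\<lambda>i j. if i = m \<and> j = n then r else 0)"

lemma coef_mon: "coef (mon r m n) i j = (if i = m \<and> j = n then r else 0)"
proof -
  have "l1_summable (\<lambda>i j. if i = m \<and> j = n then r else 0)"
    by (rule l1_summable_finite, rule finite_subset[of _ "{(m,n)}"]) auto
  then show ?thesis unfolding mon_def by (simp add: coef_of_coeffs)
qed

lemma norm_mon: "norm (mon r m n) = norm r"
proof -
  have "norm (mon r m n) = (\<Sum>\<^sub>\<infinity>x\<in>{(m,n)}. norm (coef (mon r m n) (fst x) (snd x)))"
    unfolding norm_l1ps_def
    by (rule infsum_cong_neutral) (auto simp: coef_mon split: if_splits)
  then show ?thesis by (simp add: coef_mon)
qed

lemma subst_mon:
  assumes "contractive_hom \<iota>"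
  shows "subst \<iota> a b (mon r m n) = \<iota> r * (a ^ m * b ^ n)"
proof -
  have "subst \<iota> a b (mon r m n) =
     (\<Sum>\<^sub>\<infinity>x\<in>{(m,n)}. \<iota> (coef (mon r m n) (fst x) (snd x)) * (a ^ fst x * b ^ snd x))"
    unfolding subst_def
    by (rule infsum_cong_neutral) (auto simp: coef_mon contractive_homD[OF assms] split: if_splits)
  then show ?thesis by (simp add: coef_mon)
qed

lemma mon_0_0_1: "mon 1 0 0 = 1"
  by (rule l1ps_eqI) (simp add: coef_mon coef_one)

lemma scaleR_mon: "r *\<^sub>R mon s m n = mon (r *\<^sub>R s) m n"
  by (rule l1ps_eqI) (simp add: coef_mon)

abbreviation "T1 \<equiv> mon 1 (Suc 0) 0"
abbreviation "T2 \<equiv> mon 1 0 (Suc 0)"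

lemma contractive_hom_subst:
  assumes "contractive_hom \<iota>" "norm a \<le> 1" "norm b \<le> 1"
  shows "contractive_hom (subst \<iota> a b)"
  unfolding contractive_hom_def
proof (intro conjI allI)
  fix x y :: "'a l1ps" and r :: real
  note hs = has_sum_subst[OF assms]
  note h = contractive_homD[OF assms(1)]
  show "subst \<iota> a b (x + y) = subst \<iota> a b x + subst \<iota> a b y"
    by (rule subst_eqI) (use has_sum_add[OF hs[of x] hs[of y]] in \<open>simp add: case_prod_unfold h distrib_right\<close>)
  show "subst \<iota> a b (r *\<^sub>R x) = r *\<^sub>R subst \<iota> a b x"
    by (rule subst_eqI) (use has_sum_scaleR[OF hs[of x], of r] in \<open>simp add: case_prod_unfold h\<close>)
  show "norm (subst \<iota> a b x) \<le> norm x" by (rule norm_subst_le[OF assms])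
  show "subst \<iota> a b 1 = 1" using subst_mon[OF assms(1), of a b 1 0 0] by (simp add: mon_0_0_1 h)
  show "subst \<iota> a b (x * y) = subst \<iota> a b x * subst \<iota> a b y"
  proof (rule subst_eqI)
    have eq: "\<iota> (coef (x * y) n m) * (a ^ n * b ^ m) =
      (\<Sum>i=0..n. \<Sum>j=0..m. \<iota> (coef x i j) * (a ^ i * b ^ j) * (\<iota> (coef y (n-i) (m-j)) * (a ^ (n-i) * b ^ (m-j))))" for n m
    proof -
      have hsum: "\<iota> (sum f S) = (\<Sum>s\<in>S. \<iota> (f s))" for f and S :: "nat set"
        by (induction S rule: infinite_finite_induct) (simp_all add: h)
      have pw: "a ^ n = a ^ i * a ^ (n - i)" if "i \<in> {0..n}" for i
        using that by (simp flip: power_add)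
      have pw': "b ^ m = b ^ i * b ^ (m - i)" if "i \<in> {0..m}" for i
        using that by (simp flip: power_add)
      have "\<iota> (coef (x * y) n m) * (a ^ n * b ^ m) =
        (\<Sum>i=0..n. \<Sum>j=0..m. \<iota> (coef x i j) * \<iota> (coef y (n-i) (m-j)) * (a ^ n * b ^ m))"
        by (simp add: coef_mult hsum h sum_distrib_right)
      also have "\<dots> = (\<Sum>i=0..n. \<Sum>j=0..m. \<iota> (coef x i j) * (a ^ i * b ^ j) * (\<iota> (coef y (n-i) (m-j)) * (a ^ (n-i) * b ^ (m-j))))"
        by (intro sum.cong refl, subst (1) pw, assumption, subst (1) pw', assumption) (simp add: mult_ac)
      finally show ?thesis .
    qed
    show "((\<lambda>(i,j). \<iota> (coef (x * y) i j) * (a ^ i * b ^ j)) has_sum subst \<iota> a b x * subst \<iota> a b y) UNIV"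
      using cauchy_double[OF summable_subst[OF assms, of x] summable_subst[OF assms, of y]]
      unfolding eq subst_def prod.case .
  qed
qed

text \<open>
  Both sides are sums of the same family, since a continuous homomorphism may be applied term by term.
  Composition of series, evaluation of a composed series and conjugation of values are all
  special cases.
\<close>

lemma hom_subst:
  assumes "contractive_hom \<iota>" "norm a \<le> 1" "norm b \<le> 1" "contractive_hom \<phi>"
  shows "\<phi> (subst \<iota> a b c) = subst (\<lambda>x. \<phi> (\<iota> x)) (\<phi> a) (\<phi> b) c"
proof -
  have "((\<lambda>x. \<phi> (case x of (i,j) \<Rightarrow> \<iota> (coef c i j) * (a ^ i * b ^ j))) has_sum \<phi> (subst \<iota> a b c)) UNIV"
    by (rule has_sum_bounded_linear[OF bounded_linear_contractive_hom[OF assms(4)] has_sum_subst[OF assms(1-3)]])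
  then show ?thesis
    by (intro subst_eqI[symmetric]) (simp add: case_prod_unfold contractive_homD[OF assms(4)])
qed

lemma bounded_linear_coef: "bounded_linear (\<lambda>c. coef c i j)"
  by (rule bounded_linear_intro[of _ 1]) (auto simp: norm_coef_le)

lemma contractive_hom_coef_0_0: "contractive_hom (\<lambda>c. coef c 0 0)"
  by (auto simp: contractive_hom_def coef_one coef_mult norm_coef_le)

text \<open>
  Vanishing of order at least two at the origin.  Such a series is small and has a small
  Lipschitz constant near the origin, which drives both contraction arguments.
\<close>

definition ord2 :: "'a::{real_normed_field, banach} l1ps \<Rightarrow> bool" where
  "ord2 c \<longleftrightarrow> coef c 0 0 = 0 \<and> coef c 1 0 = 0 \<and> coef c 0 1 = 0"

lemma ord2D: "ord2 c \<Longrightarrow> i + j < 2 \<Longrightarrow> coef c i j = 0"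
proof -
  assume "ord2 c" "i + j < 2"
  moreover from this have "(i = 0 \<and> j = 0) \<or> (i = 1 \<and> j = 0) \<or> (i = 0 \<and> j = 1)" by arith
  ultimately show ?thesis by (auto simp: ord2_def)
qed

lemma norm_power_diff_le:
  fixes a b :: "'b::{real_normed_algebra_1, comm_ring_1}"
  assumes "norm a \<le> \<rho>" "norm b \<le> \<rho>"
  shows "norm (a ^ n - b ^ n) \<le> n * \<rho> ^ (n - 1) * norm (a - b)"
proof (induction n)
  case (Suc n)
  have \<rho>: "0 \<le> \<rho>" using assms(1) norm_ge_zero order_trans by blast
  have "norm (a ^ Suc n - b ^ Suc n) = norm (a ^ n * (a - b) + b * (a ^ n - b ^ n))"
    by (simp add: algebra_simps)
  also have "\<dots> \<le> norm (a ^ n) * norm (a - b) + norm b * norm (a ^ n - b ^ n)"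
    by (intro order_trans[OF norm_triangle_ineq] add_mono norm_mult_ineq)
  also have "\<dots> \<le> \<rho> ^ n * norm (a - b) + \<rho> * (n * \<rho> ^ (n - 1) * norm (a - b))"
    using assms Suc \<rho> norm_monomial_le[OF assms(1) assms(1), of n 0]
    by (intro add_mono mult_mono) auto
  also have "\<dots> = Suc n * \<rho> ^ (Suc n - 1) * norm (a - b)"
    by (cases n) (simp_all add: algebra_simps)
  finally show ?case .
qed simp

lemma monomial_diff_le:
  fixes a b :: "'b::{real_normed_algebra_1, comm_ring_1}"
  assumes "norm a \<le> \<rho>" "norm b \<le> \<rho>" "norm a' \<le> \<rho>" "norm b' \<le> \<rho>" "\<rho> \<le> 1/2" "2 \<le> i + j"
  shows "norm (a ^ i * b ^ j - a' ^ i * b' ^ j) \<le> 2 * \<rho> * (norm (a - a') + norm (b - b'))"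
proof -
  have \<rho>: "0 \<le> \<rho>" using assms(1) norm_ge_zero order_trans by blast
  have "norm (a ^ i * b ^ j - a' ^ i * b' ^ j) = norm ((a ^ i - a' ^ i) * b ^ j + a' ^ i * (b ^ j - b' ^ j))"
    by (simp add: algebra_simps)
  also have "\<dots> \<le> norm (a ^ i - a' ^ i) * norm (b ^ j) + norm (a' ^ i) * norm (b ^ j - b' ^ j)"
    by (intro order_trans[OF norm_triangle_ineq] add_mono norm_mult_ineq)
  also have "\<dots> \<le> (i * \<rho> ^ (i - 1) * norm (a - a')) * \<rho> ^ j + \<rho> ^ i * (j * \<rho> ^ (j - 1) * norm (b - b'))"
    using assms \<rho> norm_monomial_le[OF assms(2) assms(2), of j 0] norm_monomial_le[OF assms(3) assms(3), of i 0]
    by (intro add_mono mult_mono norm_power_diff_le) auto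
  also have "\<dots> = (i * \<rho> ^ (i + j - 1)) * norm (a - a') + (j * \<rho> ^ (i + j - 1)) * norm (b - b')"
    by (cases i; cases j) (simp_all add: algebra_simps power_add)
  also have "\<dots> \<le> (real (i + j) * \<rho> ^ (i + j - 1)) * norm (a - a') + (real (i + j) * \<rho> ^ (i + j - 1)) * norm (b - b')"
    using \<rho> by (intro add_mono mult_right_mono) auto
  also have "\<dots> = (real (i + j) * \<rho> ^ (i + j - 1)) * (norm (a - a') + norm (b - b'))"
    by (simp add: algebra_simps)
  also have "\<dots> \<le> 2 * \<rho> * (norm (a - a') + norm (b - b'))"
  proof (intro mult_right_mono)
    obtain k where k: "i + j = k + 2" using assms(6) by (metis add.commute le_Suc_ex)
    have "k + 2 \<le> 2 * 2 ^ k" by (induction k) auto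
    then have "real (k + 2) \<le> real (2 * 2 ^ k)" by (simp only: of_nat_le_iff)
    then have "real (k + 2) \<le> 2 * 2 ^ k" by simp
    then have le2: "real (k + 2) * (1/2) ^ k \<le> 2"
      by (simp add: power_one_over field_simps)
    have "real (k + 2) * \<rho> ^ (k + 1) = (real (k + 2) * \<rho> ^ k) * \<rho>" by simp
    also have "\<dots> \<le> (real (k + 2) * (1/2) ^ k) * \<rho>"
      using assms(5) \<rho> by (intro mult_right_mono mult_left_mono power_mono) auto
    also have "\<dots> \<le> 2 * \<rho>" using le2 \<rho> by (intro mult_right_mono) auto
    finally show "real (i + j) * \<rho> ^ (i + j - 1) \<le> 2 * \<rho>" by (simp add: k)
  qed auto
  finally show ?thesis .
qed

text \<open>
  Term by term: a monomial of total degree n at least 2 has Lipschitz constant at most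
  n * \<rho> ^ (n - 1) on the ball of radius \<rho>, which is at most 2 * \<rho> as long as \<rho> is at most 1/2.
\<close>

lemma subst_ord2_lipschitz:
  assumes \<iota>: "contractive_hom \<iota>" and "norm a \<le> \<rho>" "norm b \<le> \<rho>" "norm a' \<le> \<rho>" "norm b' \<le> \<rho>" "\<rho> \<le> 1/2" "ord2 c"
  shows "norm (subst \<iota> a b c - subst \<iota> a' b' c) \<le> 2 * \<rho> * norm c * (norm (a - a') + norm (b - b'))"
proof -
  have \<rho>: "0 \<le> \<rho>" using assms(2) norm_ge_zero order_trans by blast
  let ?D = "2 * \<rho> * (norm (a - a') + norm (b - b'))"
  let ?f = "\<lambda>x. (case x of (i,j) \<Rightarrow> \<iota> (coef c i j) * (a ^ i * b ^ j)) - (case x of (i,j) \<Rightarrow> \<iota> (coef c i j) * (a' ^ i * b' ^ j))"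
  have 1: "(?f has_sum (subst \<iota> a b c - subst \<iota> a' b' c)) UNIV"
    using has_sum_add[OF has_sum_subst[OF \<iota>, of a b c] has_sum_uminusI[OF has_sum_subst[OF \<iota>, of a' b' c]]] assms
    by (simp add: has_sum_uminus)
  have 2: "norm (?f x) \<le> ?D * (case x of (i,j) \<Rightarrow> norm (coef c i j))" for x
  proof -
    obtain i j where x: "x = (i,j)" by fastforce
    show ?thesis
    proof (cases "i + j < 2")
      case True
      then show ?thesis using ord2D[OF assms(7), of i j] by (simp add: x contractive_homD[OF \<iota>])
    next
      case False
      have "norm (?f x) = norm (\<iota> (coef c i j) * (a ^ i * b ^ j - a' ^ i * b' ^ j))"
        by (simp add: x algebra_simps)
      also have "\<dots> \<le> norm (coef c i j) * ?D"
        using monomial_diff_le[OF assms(2-6), of i j] False contractive_homD(5)[OF \<iota>]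
        by (intro order_trans[OF norm_mult_ineq] mult_mono) auto
      finally show ?thesis by (simp add: x mult.commute)
    qed
  qed
  have s: "(\<lambda>x. ?D * (case x of (i,j) \<Rightarrow> norm (coef c i j))) summable_on UNIV"
    by (intro summable_on_cmult_right summable_norm_coef)
  have s': "(\<lambda>x. norm (?f x)) summable_on UNIV"
    by (rule summable_on_comparison_test[OF s]) (use 2 in auto)
  have "norm (subst \<iota> a b c - subst \<iota> a' b' c) \<le> (\<Sum>\<^sub>\<infinity>x. norm (?f x))"
    using norm_infsum_bound[OF s'] infsumI[OF 1] by simp
  also have "\<dots> \<le> (\<Sum>\<^sub>\<infinity>x. ?D * (case x of (i,j) \<Rightarrow> norm (coef c i j)))"
    by (rule infsum_mono[OF s' s]) (rule 2)
  also have "\<dots> = ?D * norm c"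
    unfolding norm_l1ps_def by (rule infsum_cmult_right) (rule summable_norm_coef)
  finally show ?thesis by (simp add: mult_ac)
qed

lemma subst_zero:
  assumes "contractive_hom \<iota>" shows "subst \<iota> 0 0 c = \<iota> (coef c 0 0)"
proof -
  have "subst \<iota> 0 0 c = (\<Sum>\<^sub>\<infinity>x\<in>{(0,0)}. \<iota> (coef c (fst x) (snd x)))"
    unfolding subst_def
    by (rule infsum_cong_neutral) (auto simp: contractive_homD[OF assms] power_0_left split: if_splits)
  then show ?thesis by simp
qed

lemma subst_ord2_le:
  assumes "contractive_hom \<iota>" "norm a \<le> \<rho>" "norm b \<le> \<rho>" "\<rho> \<le> 1/2" "ord2 c"
  shows "norm (subst \<iota> a b c) \<le> 4 * \<rho>\<^sup>2 * norm c"
proof -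
  have \<rho>: "0 \<le> \<rho>" using assms(2) norm_ge_zero order_trans by blast
  have "norm (subst \<iota> a b c) \<le> 2 * \<rho> * norm c * (norm a + norm b)"
    using subst_ord2_lipschitz[OF assms(1-3), of 0 0 c] assms \<rho> ord2D[OF assms(5), of 0 0]
    by (simp add: subst_zero contractive_homD)
  also have "\<dots> \<le> 2 * \<rho> * norm c * (\<rho> + \<rho>)"
    using assms \<rho> by (intro mult_left_mono add_mono) auto
  finally show ?thesis by (simp add: power2_eq_square algebra_simps)
qed

text \<open>
  The Taylor remainder after the linear part.
\<close>

definition rem2 :: "'a::{real_normed_field, banach} l1ps \<Rightarrow> 'a l1ps" where
  "rem2 c = c - mon (coef c 0 0) 0 0 - mon (coef c 1 0) 1 0 - mon (coef c 0 1) 0 1"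

lemma ord2_rem2: "ord2 (rem2 c)"
  by (simp add: ord2_def rem2_def coef_mon)

lemma subst_taylor1:
  assumes "contractive_hom \<iota>" "norm a \<le> 1" "norm b \<le> 1"
  shows "subst \<iota> a b c = \<iota> (coef c 0 0) + \<iota> (coef c 1 0) * a + \<iota> (coef c 0 1) * b + subst \<iota> a b (rem2 c)"
  using contractive_homD(8)[OF contractive_hom_subst[OF assms]]
  by (simp add: rem2_def subst_mon[OF assms(1)])

lemma coef_mult_0_0: "coef (a * b) 0 0 = coef a 0 0 * coef b 0 0"
  and coef_mult_1_0: "coef (a * b) (Suc 0) 0 = coef a 0 0 * coef b (Suc 0) 0 + coef a (Suc 0) 0 * coef b 0 0"
  and coef_mult_0_1: "coef (a * b) 0 (Suc 0) = coef a 0 0 * coef b 0 (Suc 0) + coef a 0 (Suc 0) * coef b 0 0"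
  by (simp_all add: coef_mult)

lemma coef_power_0_0: "coef (a ^ n) 0 0 = coef a 0 0 ^ n"
  by (induction n) (simp_all add: coef_mult_0_0 coef_one)

lemma coef_power_1_0: "coef (a ^ n) (Suc 0) 0 = of_nat n * coef a 0 0 ^ (n - 1) * coef a (Suc 0) 0"
proof (induction n)
  case (Suc n)
  then show ?case by (cases n) (simp_all add: coef_mult_1_0 coef_mult_0_0 coef_power_0_0 algebra_simps coef_one)
qed (simp add: coef_one)

lemma coef_power_0_1: "coef (a ^ n) 0 (Suc 0) = of_nat n * coef a 0 0 ^ (n - 1) * coef a 0 (Suc 0)"
proof (induction n)
  case (Suc n)
  then show ?case by (cases n) (simp_all add: coef_mult_0_1 coef_mult_0_0 coef_power_0_0 algebra_simps coef_one)
qed (simp add: coef_one)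

text \<open>
  If both arguments vanish at the origin, a monomial of degree at least 2 in them has neither a constant
  nor a linear term; the coefficient functionals are continuous, so this survives the summation.
\<close>

lemma ord2_subst:
  fixes \<iota> :: "'a::{real_normed_field, banach} \<Rightarrow> 'b::{real_normed_field, banach} l1ps"
  assumes \<iota>: "contractive_hom \<iota>" "norm a \<le> 1" "norm b \<le> 1" and "coef a 0 0 = 0" "coef b 0 0 = 0" "ord2 c"
  shows "ord2 (subst \<iota> a b c)"
proof -
  have "coef (subst \<iota> a b c) k l = 0" if z: "\<And>i j. 2 \<le> i + j \<Longrightarrow> coef (\<iota> (coef c i j) * (a ^ i * b ^ j)) k l = 0" for k l
  proof -
    have "((\<lambda>x. coef (case x of (i,j) \<Rightarrow> \<iota> (coef c i j) * (a ^ i * b ^ j)) k l) has_sum coef (subst \<iota> a b c) k l) UNIV"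
      by (rule has_sum_bounded_linear[OF bounded_linear_coef has_sum_subst[OF assms(1-3)]])
    moreover have "coef (case x of (i,j) \<Rightarrow> \<iota> (coef c i j) * (a ^ i * b ^ j)) k l = 0" for x
    proof (cases x)
      case (Pair i j)
      then show ?thesis using z[of i j] ord2D[OF assms(6), of i j]
        by (cases "2 \<le> i + j") (auto simp: contractive_homD[OF \<iota>(1)])
    qed
    ultimately show ?thesis using infsumI by fastforce
  qed
  moreover have "coef (\<iota> (coef c i j) * (a ^ i * b ^ j)) k l = 0" if "2 \<le> i + j" "k + l \<le> 1" for i j k l
  proof -
    have "(k = 0 \<and> l = 0) \<or> (k = Suc 0 \<and> l = 0) \<or> (k = 0 \<and> l = Suc 0)" using that by arith
    then show ?thesis using that assms(4,5)
      by (auto simp: coef_mult_0_0 coef_mult_1_0 coef_mult_0_1 coef_power_0_0 coef_power_1_0 coef_power_0_1 power_0_left)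
  qed
  ultimately show ?thesis unfolding ord2_def by simp
qed

lemma ord2_diff: "ord2 a \<Longrightarrow> ord2 b \<Longrightarrow> ord2 (a - b)"
  and ord2_scaleR: "ord2 a \<Longrightarrow> ord2 (r *\<^sub>R a)"
  and ord2_mult: "ord2 a \<Longrightarrow> ord2 (b * a)"
  and ord2_mult': "coef a 0 0 = 0 \<Longrightarrow> coef b 0 0 = 0 \<Longrightarrow> ord2 (a * b)"
  by (simp_all add: ord2_def coef_mult_0_0 coef_mult_1_0 coef_mult_0_1)

section \<open>The conjugacy equation for series\<close>

text \<open>
  Diagonal operators on monomials.  For bounded factors these are bounded operators, and the differential
  operator \<xi> \<partial>/\<partial>\<xi> - \<eta> \<partial>/\<partial>\<eta> and its partial inverse enter the proof only through them.
\<close>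

definition multiplier :: "(nat \<Rightarrow> nat \<Rightarrow> real) \<Rightarrow> 'a::{real_normed_field, banach} l1ps \<Rightarrow> 'a l1ps" where
  "multiplier m c = of_coeffs (\<lambda>i j. m i j *\<^sub>R coef c i j)"

lemma coef_multiplier:
  assumes "\<And>i j. \<bar>m i j\<bar> \<le> K"
  shows "coef (multiplier m c) i j = m i j *\<^sub>R coef c i j"
proof -
  have "l1_summable (\<lambda>i j. m i j *\<^sub>R coef c i j)"
    by (rule l1_summable_mult[OF l1_summable_coef[of c], of _ K]) (auto intro: mult_right_mono assms)
  then show ?thesis by (simp add: multiplier_def coef_of_coeffs)
qed

lemma norm_multiplier_le:
  assumes "\<And>i j. \<bar>m i j\<bar> \<le> K"
  shows "norm (multiplier m c) \<le> K * norm c"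
proof -
  have "norm (multiplier m c) \<le> (\<Sum>\<^sub>\<infinity>x. K * (case x of (i,j) \<Rightarrow> norm (coef c i j)))"
    unfolding norm_l1ps_def
    by (rule infsum_mono[OF summable_norm_coef summable_on_cmult_right[OF summable_norm_coef]])
      (auto simp: coef_multiplier[OF assms] intro: mult_right_mono assms)
  also have "\<dots> = K * norm c" unfolding norm_l1ps_def by (rule infsum_cmult_right[OF summable_norm_coef])
  finally show ?thesis .
qed

lemma multiplier_diff:
  assumes "\<And>i j. \<bar>m i j\<bar> \<le> K"
  shows "multiplier m a - multiplier m b = multiplier m (a - b)"
  by (rule l1ps_eqI) (simp add: coef_multiplier[OF assms] scaleR_diff_right)

text \<open>
  Picks a subfamily of the coefficients and renames its exponents; injectivity of the renaming keeps the
  norm from growing.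
\<close>

definition reindex :: "(nat \<times> nat) set \<Rightarrow> (nat \<times> nat \<Rightarrow> nat \<times> nat) \<Rightarrow> 'a::{real_normed_field, banach} l1ps \<Rightarrow> 'a l1ps" where
  "reindex D p c = of_coeffs (\<lambda>i j. if (i,j) \<in> D then coef c (fst (p (i,j))) (snd (p (i,j))) else 0)"

lemma
  assumes "inj_on p D"
  shows coef_reindex: "coef (reindex D p c) i j = (if (i,j) \<in> D then coef c (fst (p (i,j))) (snd (p (i,j))) else 0)"
    and norm_reindex_le: "norm (reindex D p c) \<le> norm c"
proof -
  let ?n = "\<lambda>(i,j). norm (coef c i j)"
  let ?g = "\<lambda>i j. if (i,j) \<in> D then coef c (fst (p (i,j))) (snd (p (i,j))) else 0"
  have sm: "?n summable_on (p ` D)"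
    by (rule summable_on_subset[OF summable_norm_coef]) auto
  then have "(?n \<circ> p) summable_on D" by (simp add: summable_on_reindex assms)
  also have "?this \<longleftrightarrow> (\<lambda>(i,j). norm (?g i j)) summable_on UNIV"
    by (rule summable_on_cong_neutral) (auto simp: case_prod_unfold split: if_splits)
  finally have s: "l1_summable ?g" by (simp add: l1_summable_def)
  show coef: "coef (reindex D p c) i j = ?g i j" for i j
    unfolding reindex_def coef_of_coeffs[OF s] ..
  have "norm (reindex D p c) = infsum (?n \<circ> p) D"
    unfolding norm_l1ps_def coef
    by (rule infsum_cong_neutral) (auto simp: case_prod_unfold split: if_splits)
  also have "\<dots> = infsum ?n (p ` D)" by (simp add: infsum_reindex assms)
  also have "\<dots> \<le> norm c"
    unfolding norm_l1ps_def
    by (rule infsum_mono_neutral[OF sm summable_norm_coef]) auto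
  finally show "norm (reindex D p c) \<le> norm c" .
qed

lemma reindex_diff:
  assumes "inj_on p D"
  shows "reindex D p a - reindex D p b = reindex D p (a - b)"
  by (rule l1ps_eqI) (simp add: coef_reindex[OF assms])

definition swap :: "real l1ps \<Rightarrow> real l1ps" where
  "swap = subst of_real T2 T1"

lemma contractive_hom_swap: "contractive_hom swap"
  unfolding swap_def by (intro contractive_hom_subst contractive_hom_of_real) (simp_all add: norm_mon)

lemma hom_subst_of_real:
  assumes "norm a \<le> 1" "norm b \<le> 1" "contractive_hom \<phi>"
  shows "\<phi> (subst of_real a b c) = subst of_real (\<phi> a) (\<phi> b) c"
  using hom_subst[OF contractive_hom_of_real assms] by (simp add: contractive_hom_comp_of_real[OF assms(3)])

lemma coef_swap_0_0: "coef (swap c) 0 0 = coef c 0 0"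
  using hom_subst_of_real[OF _ _ contractive_hom_coef_0_0, of "T2 :: real l1ps" T1 c]
  subst_zero[OF contractive_hom_of_real, of c, where ?'b = real]
  by (simp add: swap_def norm_mon coef_mon)

text \<open>
  The resonant monomials are \<xi> (\<xi> \<eta>)^n.  This is the resonant part of a series divided by \<xi>, so it
  is a series in the product \<xi> \<eta>.
\<close>

definition resonant :: "real l1ps \<Rightarrow> real l1ps" where
  "resonant c = reindex {(i,j). i = j} (\<lambda>(i,j). (Suc i, j)) c"

lemma inj_resonant: "inj_on (\<lambda>(i,j). (Suc i, j)) D"
  by (auto simp: inj_on_def)

lemma coef_resonant: "coef (resonant c) i j = (if i = j then coef c (Suc i) i else 0)"
  unfolding resonant_def coef_reindex[OF inj_resonant] by simp

lemma coef_T1_mult: "coef (T1 * c) i j = (if i = 0 then 0 else coef c (i - 1) j)"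
proof -
  have "coef (T1 * c) i j = (\<Sum>x=0..i. \<Sum>y=0..j. if x = 1 then if y = 0 then coef c (i - x) (j - y) else 0 else 0)"
    unfolding coef_mult coef_mon by (intro sum.cong) auto
  also have "\<dots> = (\<Sum>x=0..i. if x = 1 then coef c (i - x) j else 0)"
    by (intro sum.cong refl) simp
  finally show ?thesis by auto
qed

lemma coef_T1_resonant: "coef (T1 * resonant c) i j = (if i = Suc j then coef c i j else 0)"
  by (cases i) (auto simp: coef_T1_mult coef_resonant)

text \<open>
  Multiplying by a series in the product \<xi> \<eta> does not change the difference of the two exponents, so it
  cannot create resonant terms.
\<close>

lemma coef_diagonal_mult:
  assumes "\<And>i j. i \<noteq> j \<Longrightarrow> coef s i j = 0" "\<And>n. coef c (Suc n) n = 0"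
  shows "coef (s * c) (Suc n) n = 0"
proof -
  have "coef s i j * coef c (Suc n - i) (n - j) = 0" if "j \<le> n" for i j
    using assms that by (cases "i = j") (auto simp: Suc_diff_le)
  then show ?thesis unfolding coef_mult by (intro sum.neutral ballI) auto
qed

text \<open>
  The heart of the proof.  With x = \<kappa> \<xi> + L \<psi>, where L divides by m - n - 1 off the resonant monomials, the
  equation becomes \<psi> = g - \<xi> r - r (M \<psi>) / \<kappa>, where g is f substituted at x and its mirror image, \<xi> r is the
  resonant part of g, and M has the factors (m - n) / (m - n - 1).  The resonant part of g is
  compensated by s = r / \<kappa>.  All operators are bounded and g is of second order in x, so
  the right-hand side is a contraction of a small ball of second-order series once \<kappa> is small.  The
  leading coefficient \<kappa> plays the role of a scaling of the variables, which spares an actual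
  rescaling of f.
\<close>

lemma normal_form_series:
  fixes f :: "real l1ps"
  assumes f: "ord2 f"
  obtains \<kappa> x y s where
    "0 < \<kappa>" "norm x \<le> 1/2" "coef x 0 0 = 0" "coef x 1 0 = \<kappa>" "coef x 0 1 = 0"
    "\<And>i j. coef y i j = (real i - real j) * coef x i j"
    "\<And>i j. i \<noteq> j \<Longrightarrow> coef s i j = 0" "coef s 0 0 = 0"
    "(1 + s) * y = x + subst of_real x (swap x) f"
proof -
  define C where "C = norm f"
  \<comment> \<open>The factor 128 leaves room for the contraction constant 1/2.\<close>
  define \<kappa> where "\<kappa> = 1 / (128 * (C + 1))"
  have C: "0 \<le> C" by (simp add: C_def)
  have \<kappa>: "0 < \<kappa>" "\<kappa> \<le> 1/128" "\<kappa> * C \<le> 1/128"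
    using C by (simp_all add: \<kappa>_def field_simps)
  \<comment> \<open>At the resonant exponents, where the divisor is 0, both multipliers are set to 0.\<close>
  define l where "l = (\<lambda>i j. if i = Suc j then 0 else 1 / (real i - real j - 1))"
  define m where "m = (\<lambda>i j. if i = Suc j then 0 else (real i - real j) / (real i - real j - 1))"
  have int: "1 \<le> \<bar>real i - real j - 1\<bar>" if "i \<noteq> Suc j" for i j
    using that by linarith
  have l: "\<bar>l i j\<bar> \<le> 1" for i j
    using int[of i j] by (auto simp: l_def divide_simps)
  have abs_bd: "1 \<le> \<bar>r - 1\<bar> \<Longrightarrow> \<bar>r\<bar> \<le> 2 * \<bar>r - 1\<bar>" for r :: real
    by (auto simp: abs_if split: if_splits)
  have m: "\<bar>m i j\<bar> \<le> 2" for i j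
  proof (cases "i = Suc j")
    case False
    have "\<bar>real i - real j\<bar> \<le> 2 * \<bar>real i - real j - 1\<bar>" using abs_bd[of "real i - real j"] int[OF False] by blast
    then show ?thesis using int[OF False] False by (auto simp: m_def divide_simps)
  qed (simp add: m_def)
  let ?L = "multiplier l :: real l1ps \<Rightarrow> real l1ps"
  let ?M = "multiplier m :: real l1ps \<Rightarrow> real l1ps"
  note cfL = coef_multiplier[OF l, where ?'a=real] and cfM = coef_multiplier[OF m, where ?'a=real]
  have nL: "norm (?L c) \<le> norm c" for c using norm_multiplier_le[of l 1 c, OF l] by simp
  have nM: "norm (?M c) \<le> 2 * norm c" for c using norm_multiplier_le[of m 2 c, OF m] by simp
  have nR: "norm (resonant c) \<le> norm c" for c
    unfolding resonant_def by (rule norm_reindex_le[OF inj_resonant])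
  have nT: "norm (T1 * c) \<le> norm c" for c :: "real l1ps"
    using norm_mult_ineq[of T1 c] by (simp add: norm_mon)
  have nS: "norm (swap c) \<le> norm c" for c by (rule contractive_homD(5)[OF contractive_hom_swap])
  define X where "X = (\<lambda>\<psi>. mon \<kappa> 1 0 + ?L \<psi>)"
  define g where "g = (\<lambda>\<psi>. subst of_real (X \<psi>) (swap (X \<psi>)) f)"
  define \<Phi> where "\<Phi> = (\<lambda>\<psi>. g \<psi> - T1 * resonant (g \<psi>) - (1/\<kappa>) *\<^sub>R (resonant (g \<psi>) * ?M \<psi>))"
  define A where "A = {\<psi> :: real l1ps. norm \<psi> \<le> \<kappa> \<and> ord2 \<psi>}"
  have nX: "norm (X \<psi>) \<le> 2 * \<kappa>" if "\<psi> \<in> A" for \<psi>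
  proof -
    have "norm (X \<psi>) \<le> norm (mon \<kappa> 1 0) + norm (?L \<psi>)" unfolding X_def by (rule norm_triangle_ineq)
    also have "\<dots> \<le> \<kappa> + \<kappa>"
      using that nL[of \<psi>] \<kappa> by (intro add_mono) (auto simp: norm_mon A_def)
    finally show ?thesis by simp
  qed
  have ng: "norm (g \<psi>) \<le> \<kappa> / 8" if "\<psi> \<in> A" for \<psi>
  proof -
    have "norm (g \<psi>) \<le> 4 * (2 * \<kappa>)\<^sup>2 * norm f"
      unfolding g_def
      by (rule subst_ord2_le[OF contractive_hom_of_real _ _ _ f])
        (use nX[OF that] nS[of "X \<psi>"] \<kappa> in auto)
    also have "\<dots> = 16 * \<kappa> * (\<kappa> * C)" by (simp add: power2_eq_square C_def)
    also have "\<dots> \<le> 16 * \<kappa> * (1/128)" using \<kappa> by (intro mult_left_mono) auto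
    finally show ?thesis by simp
  qed
  have gL: "norm (g \<psi> - g \<psi>') \<le> norm (\<psi> - \<psi>') / 16" if "\<psi> \<in> A" "\<psi>' \<in> A" for \<psi> \<psi>'
  proof -
    have "norm (g \<psi> - g \<psi>') \<le> 2 * (2 * \<kappa>) * norm f * (norm (X \<psi> - X \<psi>') + norm (swap (X \<psi>) - swap (X \<psi>')))"
      unfolding g_def
      by (rule subst_ord2_lipschitz[OF contractive_hom_of_real _ _ _ _ _ f])
        (use nX that order_trans[OF nS nX] \<kappa> in auto)
    also have "\<dots> \<le> 2 * (2 * \<kappa>) * norm f * (norm (\<psi> - \<psi>') + norm (\<psi> - \<psi>'))"
    proof -
      have "norm (X \<psi> - X \<psi>') \<le> norm (\<psi> - \<psi>')"
        using nL[of "\<psi> - \<psi>'"] by (simp add: X_def multiplier_diff[OF l])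
      moreover have "norm (swap (X \<psi>) - swap (X \<psi>')) \<le> norm (X \<psi> - X \<psi>')"
        using nS[of "X \<psi> - X \<psi>'"] by (simp add: contractive_homD(8)[OF contractive_hom_swap])
      ultimately show ?thesis using \<kappa> by (intro mult_left_mono add_mono) auto
    qed
    also have "\<dots> = 8 * norm (\<psi> - \<psi>') * (\<kappa> * C)" by (simp add: C_def)
    also have "\<dots> \<le> 8 * norm (\<psi> - \<psi>') * (1/128)" using \<kappa> by (intro mult_left_mono) auto
    finally show ?thesis by simp
  qed
  have ordL: "ord2 (?L \<psi>)" and ordM: "ord2 (?M \<psi>)" if "ord2 \<psi>" for \<psi>
    using that by (simp_all add: ord2_def cfL cfM)
  have cfX: "coef (X \<psi>) 0 0 = 0" "coef (X \<psi>) 1 0 = \<kappa>" "coef (X \<psi>) 0 1 = 0" if "ord2 \<psi>" for \<psi>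
    using ordL[OF that] by (simp_all add: X_def coef_mon ord2_def)
  have ordg: "ord2 (g \<psi>)" if "\<psi> \<in> A" for \<psi>
    unfolding g_def
    by (rule ord2_subst[OF contractive_hom_of_real _ _ _ _ f])
      (use that nX[OF that] nS[of "X \<psi>"] \<kappa> in \<open>auto simp: A_def cfX coef_swap_0_0\<close>)
  have ordR: "ord2 (T1 * resonant c)" if "ord2 c" for c
    using that by (simp add: ord2_def coef_T1_resonant)
  have "\<exists>!\<psi>. \<psi> \<in> A \<and> \<Phi> \<psi> = \<psi>"
  proof (rule Banach_fix[where c = "1/2"])
    have "closed {\<psi> :: real l1ps. norm \<psi> \<le> \<kappa>}"
      by (intro closed_Collect_le continuous_intros)
    moreover have "closed {\<psi> :: real l1ps. coef \<psi> i j = 0}" for i j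
      by (intro closed_Collect_eq linear_continuous_on bounded_linear_coef continuous_intros)
    moreover have "A = {\<psi>. norm \<psi> \<le> \<kappa>} \<inter> {\<psi>. coef \<psi> 0 0 = 0} \<inter> {\<psi>. coef \<psi> 1 0 = 0} \<inter> {\<psi>. coef \<psi> 0 1 = 0}"
      by (auto simp: A_def ord2_def)
    ultimately show "complete A" by (simp add: complete_eq_closed closed_Int)
    have "0 \<in> A" using \<kappa> by (simp add: A_def ord2_def)
    then show "A \<noteq> {}" by auto
    show "\<Phi> ` A \<subseteq> A"
    proof
      fix z assume "z \<in> \<Phi> ` A"
      then obtain \<psi> where z: "z = \<Phi> \<psi>" and \<psi>: "\<psi> \<in> A" by auto
      have "norm z \<le> norm (g \<psi>) + norm (T1 * resonant (g \<psi>)) + norm ((1/\<kappa>) *\<^sub>R (resonant (g \<psi>) * ?M \<psi>))"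
        unfolding z \<Phi>_def by (intro order_trans[OF norm_triangle_ineq4] add_mono order_refl)
      also have "\<dots> \<le> \<kappa>/8 + \<kappa>/8 + (1/\<kappa>) * ((\<kappa>/8) * (2 * \<kappa>))"
      proof (intro add_mono)
        show "norm (g \<psi>) \<le> \<kappa>/8" by (rule ng[OF \<psi>])
        show "norm (T1 * resonant (g \<psi>)) \<le> \<kappa>/8"
          using ng[OF \<psi>] nT[of "resonant (g \<psi>)"] nR[of "g \<psi>"] by linarith
        have "norm (resonant (g \<psi>) * ?M \<psi>) \<le> (\<kappa>/8) * (2 * \<kappa>)"
          using ng[OF \<psi>] nR[of "g \<psi>"] nM[of \<psi>] \<psi> \<kappa>
          by (intro order_trans[OF norm_mult_ineq mult_mono]) (auto simp: A_def)
        then show "norm ((1/\<kappa>) *\<^sub>R (resonant (g \<psi>) * ?M \<psi>)) \<le> (1/\<kappa>) * ((\<kappa>/8) * (2 * \<kappa>))"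
          using \<kappa> unfolding norm_scaleR by (intro mult_mono) auto
      qed
      also have "\<dots> \<le> \<kappa>" using \<kappa> by simp
      finally have "norm z \<le> \<kappa>" .
      moreover have "ord2 z"
        unfolding z \<Phi>_def
        using \<psi> by (intro ord2_diff ord2_scaleR ord2_mult ordR ordg ordM) (auto simp: A_def)
      ultimately show "z \<in> A" by (simp add: A_def)
    qed
    show "dist (\<Phi> \<psi>) (\<Phi> \<psi>') \<le> 1/2 * dist \<psi> \<psi>'" if "\<psi> \<in> A" "\<psi>' \<in> A" for \<psi> \<psi>'
    proof -
      let ?D = "norm (\<psi> - \<psi>')"
      have Rd: "norm (resonant (g \<psi>) - resonant (g \<psi>')) \<le> ?D / 16"
        using nR[of "g \<psi> - g \<psi>'"] gL[OF that] by (simp add: resonant_def reindex_diff[OF inj_resonant])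
      have "\<Phi> \<psi> - \<Phi> \<psi>' = (g \<psi> - g \<psi>') - T1 * (resonant (g \<psi>) - resonant (g \<psi>')) -
         (1/\<kappa>) *\<^sub>R ((resonant (g \<psi>) - resonant (g \<psi>')) * ?M \<psi> + resonant (g \<psi>') * ?M (\<psi> - \<psi>'))"
        by (simp add: \<Phi>_def algebra_simps flip: multiplier_diff[OF m])
      also have "norm \<dots> \<le> norm (g \<psi> - g \<psi>') + norm (T1 * (resonant (g \<psi>) - resonant (g \<psi>'))) +
         norm ((1/\<kappa>) *\<^sub>R ((resonant (g \<psi>) - resonant (g \<psi>')) * ?M \<psi> + resonant (g \<psi>') * ?M (\<psi> - \<psi>')))"
        by (intro order_trans[OF norm_triangle_ineq4] add_mono order_refl)
      also have "\<dots> \<le> ?D/16 + ?D/16 + (1/\<kappa>) * ((?D/16) * (2 * \<kappa>) + (\<kappa>/8) * (2 * ?D))"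
      proof (intro add_mono)
        show "norm (g \<psi> - g \<psi>') \<le> ?D/16" by (rule gL[OF that])
        show "norm (T1 * (resonant (g \<psi>) - resonant (g \<psi>'))) \<le> ?D/16"
          using Rd nT order_trans by blast
        have 1: "norm ((resonant (g \<psi>) - resonant (g \<psi>')) * ?M \<psi>) \<le> (?D/16) * (2 * \<kappa>)"
          using Rd nM[of \<psi>] that by (intro order_trans[OF norm_mult_ineq mult_mono]) (auto simp: A_def)
        have 2: "norm (resonant (g \<psi>') * ?M (\<psi> - \<psi>')) \<le> (\<kappa>/8) * (2 * ?D)"
          using ng[OF that(2)] nR[of "g \<psi>'"] nM[of "\<psi> - \<psi>'"] \<kappa>
          by (intro order_trans[OF norm_mult_ineq mult_mono]) auto
        have "norm ((resonant (g \<psi>) - resonant (g \<psi>')) * ?M \<psi> + resonant (g \<psi>') * ?M (\<psi> - \<psi>'))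
           \<le> (?D/16) * (2 * \<kappa>) + (\<kappa>/8) * (2 * ?D)"
          by (rule order_trans[OF norm_triangle_ineq add_mono[OF 1 2]])
        then show "norm ((1/\<kappa>) *\<^sub>R ((resonant (g \<psi>) - resonant (g \<psi>')) * ?M \<psi> + resonant (g \<psi>') * ?M (\<psi> - \<psi>')))
           \<le> (1/\<kappa>) * ((?D/16) * (2 * \<kappa>) + (\<kappa>/8) * (2 * ?D))"
          using \<kappa> unfolding norm_scaleR by (intro mult_mono) auto
      qed
      also have "\<dots> = 1/2 * ?D" using \<kappa> by (simp add: field_simps)
      finally show ?thesis by (simp add: dist_norm)
    qed
  qed auto
  then obtain \<psi> where \<psi>: "\<psi> \<in> A" and fp: "\<Phi> \<psi> = \<psi>" by blast
  have ord\<psi>: "ord2 \<psi>" using \<psi> by (simp add: A_def)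
  define s where "s = (1/\<kappa>) *\<^sub>R resonant (g \<psi>)"
  define y where "y = mon \<kappa> 1 0 + ?M \<psi>"
  have s: "coef s i j = 0" if "i \<noteq> j" for i j
    using that by (simp add: s_def coef_resonant)
  \<comment> \<open>The fixed point has no resonant part, although this was not imposed: each term of the
    equation is free of resonant monomials or is the resonant part that gets subtracted.\<close>
  have res0: "coef \<psi> (Suc n) n = 0" for n
  proof -
    have "\<psi> = g \<psi> - T1 * resonant (g \<psi>) - s * ?M \<psi>" using fp by (simp add: \<Phi>_def s_def)
    then have "coef \<psi> (Suc n) n = coef (g \<psi> - T1 * resonant (g \<psi>) - s * ?M \<psi>) (Suc n) n" by (rule arg_cong)
    also have "coef (s * ?M \<psi>) (Suc n) n = 0"
      by (rule coef_diagonal_mult[OF s]) (simp_all add: cfM, simp add: m_def)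
    then have "coef (g \<psi> - T1 * resonant (g \<psi>) - s * ?M \<psi>) (Suc n) n = 0"
      by (simp add: coef_T1_resonant)
    finally show ?thesis .
  qed
  \<comment> \<open>Off the resonance, (m - n) / (m - n - 1) = 1 + 1 / (m - n - 1).\<close>
  have split: "?M \<psi> = \<psi> + ?L \<psi>"
  proof (rule l1ps_eqI)
    fix i j show "coef (?M \<psi>) i j = coef (\<psi> + ?L \<psi>) i j"
    proof (cases "i = Suc j")
      case False
      have "real i - real j - 1 \<noteq> 0" using int[OF False] by linarith
      then show ?thesis using False unfolding coef_add cfL cfM by (simp add: l_def m_def field_simps)
    qed (simp add: res0 cfL cfM l_def[THEN fun_cong, THEN fun_cong] m_def[THEN fun_cong, THEN fun_cong])
  qed
  show thesis
  proof (rule that[of \<kappa> "X \<psi>" y s])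
    show "0 < \<kappa>" by fact
    show "norm (X \<psi>) \<le> 1/2" using nX[OF \<psi>] \<kappa> by linarith
    show "coef (X \<psi>) 0 0 = 0" "coef (X \<psi>) 1 0 = \<kappa>" "coef (X \<psi>) 0 1 = 0" by (rule cfX[OF ord\<psi>])+
    show "coef y i j = (real i - real j) * coef (X \<psi>) i j" for i j
      unfolding y_def X_def coef_add cfL cfM by (simp add: coef_mon l_def m_def)
    show "coef s i j = 0" if "i \<noteq> j" for i j using s[OF that] .
    show "coef s 0 0 = 0" using ordg[OF \<psi>] by (simp add: s_def coef_resonant ord2_def)
    have "(1 + s) * y = (1 + s) * mon \<kappa> 1 0 + ?M \<psi> + s * ?M \<psi>" by (simp add: y_def algebra_simps)
    also have "s * mon \<kappa> 1 0 = T1 * resonant (g \<psi>)"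
    proof -
      have "mon \<kappa> 1 0 = \<kappa> *\<^sub>R T1" by (simp add: scaleR_mon)
      then show ?thesis using \<kappa> by (simp add: s_def mult.commute)
    qed
    then have "(1 + s) * mon \<kappa> 1 0 = mon \<kappa> 1 0 + T1 * resonant (g \<psi>)" by (simp add: algebra_simps)
    also have "s * ?M \<psi> = g \<psi> - T1 * resonant (g \<psi>) - \<psi>" using fp by (simp add: \<Phi>_def s_def algebra_simps)
    finally show "(1 + s) * y = X \<psi> + subst of_real (X \<psi>) (swap (X \<psi>)) f"
      by (simp add: split X_def g_def algebra_simps)
  qed
qed

section \<open>Real-analytic maps of the plane\<close>

text \<open>
  There are three evaluations: \<open>ev\<close> for real series at real points, \<open>evz\<close> for
  real series at complex points, and \<open>evc\<close> for complex series at real points.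
\<close>

definition ev :: "real l1ps \<Rightarrow> real \<Rightarrow> real \<Rightarrow> real" where
  "ev c s t = subst of_real s t c"

lemma contractive_hom_ev: "\<bar>s\<bar> \<le> 1 \<Longrightarrow> \<bar>t\<bar> \<le> 1 \<Longrightarrow> contractive_hom (\<lambda>c. ev c s t)"
  unfolding ev_def by (intro contractive_hom_subst contractive_hom_of_real) auto

lemma ev_mon: "ev (mon r i j) s t = r * (s ^ i * t ^ j)"
  using subst_mon[OF contractive_hom_of_real, of s t r i j] by (simp add: ev_def)

lemma ev_subst:
  assumes "norm a \<le> 1" "norm b \<le> 1" "\<bar>s\<bar> \<le> 1" "\<bar>t\<bar> \<le> 1"
  shows "ev (subst of_real a b c) s t = ev c (ev a s t) (ev b s t)"
  using hom_subst_of_real[OF assms(1,2) contractive_hom_ev[OF assms(3,4)], of c] by (simp add: ev_def)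

lemma has_sum_ev:
  assumes "\<bar>s\<bar> \<le> 1" "\<bar>t\<bar> \<le> 1"
  shows "((\<lambda>(i,j). coef c i j * (s ^ i * t ^ j)) has_sum ev c s t) UNIV"
  using has_sum_subst[OF contractive_hom_of_real, of s t c] assms by (simp add: ev_def)

lemma ev_eqI:
  assumes "((\<lambda>(i,j). coef c i j * (s ^ i * t ^ j)) has_sum u) UNIV"
  shows "ev c s t = u"
  using subst_eqI[of of_real c s t u] assms by (simp add: ev_def)

text \<open>
  Re-expansion at another point is substitution of affine series.
\<close>

lemma ev_translate:
  fixes p q :: real
  assumes "\<bar>p\<bar> + \<bar>\<sigma>\<bar> \<le> 1" "\<bar>q\<bar> + \<bar>\<tau>\<bar> \<le> 1"
  shows "\<exists>c'. \<forall>s t. \<bar>s\<bar> \<le> 1 \<longrightarrow> \<bar>t\<bar> \<le> 1 \<longrightarrow> ev c' s t = ev c (p + \<sigma> * s) (q + \<tau> * t)"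
proof (intro exI allI impI)
  fix s t :: real assume st: "\<bar>s\<bar> \<le> 1" "\<bar>t\<bar> \<le> 1"
  let ?a = "mon p 0 0 + mon \<sigma> 1 0" and ?b = "mon q 0 0 + mon \<tau> 0 1"
  have "norm ?a \<le> 1" "norm ?b \<le> 1"
    using norm_triangle_ineq[of "mon p 0 0" "mon \<sigma> 1 0"] norm_triangle_ineq[of "mon q 0 0" "mon \<tau> 0 1"] assms
    by (simp_all add: norm_mon)
  then show "ev (subst of_real ?a ?b c) s t = ev c (p + \<sigma> * s) (q + \<tau> * t)"
    by (simp add: ev_subst st contractive_homD(1)[OF contractive_hom_ev[OF st]] ev_mon)
qed

definition ev2 :: "real l1ps \<Rightarrow> real l1ps \<Rightarrow> real^2 \<Rightarrow> real^2" where
  "ev2 A B q = vector [ev A (q$1) (q$2), ev B (q$1) (q$2)]"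

lemma ev2_nth [simp]: "ev2 A B q $ 1 = ev A (q$1) (q$2)" "ev2 A B q $ 2 = ev B (q$1) (q$2)"
  by (simp_all add: ev2_def vector_2)

lemma vec2_eqI: "(p::real^2) $ 1 = q $ 1 \<Longrightarrow> p $ 2 = q $ 2 \<Longrightarrow> p = q"
  by (simp add: vec_eq_iff forall_2)

lemma vector2_expand: "vector [a, b] = a *\<^sub>R (vector [1, 0] :: real^2) + b *\<^sub>R vector [0, 1]"
  by (rule vec2_eqI) (simp_all add: vector_2)

definition box2 :: "real \<Rightarrow> (real^2) set" where
  "box2 r = {q. \<bar>q$1\<bar> < r \<and> \<bar>q$2\<bar> < r}"

lemma open_box2: "open (box2 r)"
proof -
  have "box2 r = {q. \<bar>q$1\<bar> < r} \<inter> {q. \<bar>q$2\<bar> < r}" by (auto simp: box2_def)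
  moreover have "open {q :: real^2. \<bar>q$i\<bar> < r}" for i
    by (intro open_Collect_less continuous_intros)
  ultimately show ?thesis by auto
qed

lemma real_analytic2_onI:
  assumes "\<And>p. p \<in> S \<Longrightarrow> \<exists>\<sigma>>0. \<exists>A B. \<forall>q. q - p \<in> box2 \<sigma> \<longrightarrow> f q = ev2 A B ((1/\<sigma>) *\<^sub>R (q - p))"
  shows "real_analytic2_on f S"
  unfolding real_analytic2_on_def
proof
  fix p assume "p \<in> S"
  from assms[OF this] obtain \<sigma> A B where \<sigma>: "\<sigma> > 0" and
    f: "\<And>q. q - p \<in> box2 \<sigma> \<Longrightarrow> f q = ev2 A B ((1/\<sigma>) *\<^sub>R (q - p))" by auto
  let ?c = "\<lambda>i j. vector [coef A i j / \<sigma> ^ (i + j), coef B i j / \<sigma> ^ (i + j)] :: real^2"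
  have "((\<lambda>(i,j). ((q$1 - p$1) ^ i * (q$2 - p$2) ^ j) *\<^sub>R ?c i j) has_sum f q) UNIV" if q: "q \<in> ball p \<sigma>" for q
  proof -
    let ?s = "(q$1 - p$1) / \<sigma>" and ?t = "(q$2 - p$2) / \<sigma>"
    have n: "\<bar>q$1 - p$1\<bar> < \<sigma>" "\<bar>q$2 - p$2\<bar> < \<sigma>"
      using q component_le_norm_cart[of "q - p" 1] component_le_norm_cart[of "q - p" 2]
      by (auto simp: dist_norm norm_minus_commute)
    then have b: "\<bar>?s\<bar> \<le> 1" "\<bar>?t\<bar> \<le> 1" using \<sigma> by simp_all
    have fq: "f q = vector [ev A ?s ?t, ev B ?s ?t]"
      using f[of q] n by (simp add: box2_def ev2_def)
    have lin: "((\<lambda>x. (case x of (i,j) \<Rightarrow> coef C i j * (?s ^ i * ?t ^ j)) *\<^sub>R v) has_sum ev C ?s ?t *\<^sub>R v) UNIV"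
      for C and v :: "real^2"
      using has_sum_bounded_linear[OF bounded_linear_scaleR_left[of v] has_sum_ev[OF b, of C]] .
    have "((\<lambda>x. (case x of (i,j) \<Rightarrow> coef A i j * (?s ^ i * ?t ^ j)) *\<^sub>R (vector [1, 0] :: real^2) +
       (case x of (i,j) \<Rightarrow> coef B i j * (?s ^ i * ?t ^ j)) *\<^sub>R vector [0, 1]) has_sum
       (ev A ?s ?t *\<^sub>R vector [1, 0] + ev B ?s ?t *\<^sub>R vector [0, 1])) UNIV"
      by (rule has_sum_add[OF lin lin])
    also have "(\<lambda>x. (case x of (i,j) \<Rightarrow> coef A i j * (?s ^ i * ?t ^ j)) *\<^sub>R (vector [1, 0] :: real^2) +
       (case x of (i,j) \<Rightarrow> coef B i j * (?s ^ i * ?t ^ j)) *\<^sub>R vector [0, 1]) =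
       (\<lambda>(i,j). ((q$1 - p$1) ^ i * (q$2 - p$2) ^ j) *\<^sub>R ?c i j)"
      by (auto simp: fun_eq_iff power_divide power_add vector_2 intro!: vec2_eqI)
    finally show ?thesis by (simp only: fq vector2_expand[symmetric])
  qed
  with \<sigma> show "\<exists>c r. 0 < r \<and> (\<forall>q\<in>ball p r. ((\<lambda>(i,j). ((q$1 - p$1) ^ i * (q$2 - p$2) ^ j) *\<^sub>R c i j) has_sum f q) UNIV)"
    by (intro exI[of _ ?c] exI[of _ \<sigma>]) auto
qed

text \<open>
  Summability of the expansion at the corner of a small square, together with the fact that unordered
  sums of reals converge absolutely, puts the rescaled coefficients into the Banach algebra.
\<close>

lemma real_analytic2_onD:
  assumes "real_analytic2_on f S" "p \<in> S"
  obtains \<sigma> A B where "\<sigma> > 0" "\<And>q. \<bar>q$1 - p$1\<bar> \<le> \<sigma> \<Longrightarrow> \<bar>q$2 - p$2\<bar> \<le> \<sigma> \<Longrightarrow> f q = ev2 A B ((1/\<sigma>) *\<^sub>R (q - p))"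
proof -
  from assms obtain c r where r: "r > 0" and hs:
    "\<And>q. q \<in> ball p r \<Longrightarrow> ((\<lambda>(i,j). ((q$1 - p$1) ^ i * (q$2 - p$2) ^ j) *\<^sub>R c i j) has_sum f q) UNIV"
    unfolding real_analytic2_on_def by blast
  define \<sigma> where "\<sigma> = r / 3"
  have \<sigma>: "\<sigma> > 0" using r by (simp add: \<sigma>_def)
  have ball: "q \<in> ball p r" if "\<bar>q$1 - p$1\<bar> \<le> \<sigma>" "\<bar>q$2 - p$2\<bar> \<le> \<sigma>" for q
  proof -
    have "norm (q - p) \<le> \<bar>q$1 - p$1\<bar> + \<bar>q$2 - p$2\<bar>"
      using norm_le_l1_cart[of "q - p"] by (simp add: sum_2)
    then show ?thesis using that r by (simp add: dist_norm norm_minus_commute \<sigma>_def)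
  qed
  have comp: "((\<lambda>(i,j). ((q$1 - p$1) ^ i * (q$2 - p$2) ^ j) * (c i j $ k)) has_sum f q $ k) UNIV"
    if "\<bar>q$1 - p$1\<bar> \<le> \<sigma>" "\<bar>q$2 - p$2\<bar> \<le> \<sigma>" for q k
    using has_sum_bounded_linear[OF bounded_linear_vec_nth[of k] hs[OF ball[OF that]]]
    by (simp add: case_prod_unfold)
  have l1: "l1_summable (\<lambda>i j. \<sigma> ^ i * \<sigma> ^ j * (c i j $ k))" for k
  proof -
    have "(\<lambda>(i,j). \<sigma> ^ i * \<sigma> ^ j * (c i j $ k)) summable_on UNIV"
      using has_sum_imp_summable[OF comp[of "p + vector [\<sigma>, \<sigma>]" k]] \<sigma> by (simp add: vector_2)
    then show ?thesis
      unfolding l1_summable_def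
      by (subst (asm) summable_on_iff_abs_summable_on_real) (simp add: case_prod_unfold)
  qed
  define A where "A = (\<lambda>k. of_coeffs (\<lambda>i j. \<sigma> ^ i * \<sigma> ^ j * (c i j $ k)))"
  have "ev (A k) ((q$1 - p$1) / \<sigma>) ((q$2 - p$2) / \<sigma>) = f q $ k"
    if "\<bar>q$1 - p$1\<bar> \<le> \<sigma>" "\<bar>q$2 - p$2\<bar> \<le> \<sigma>" for q k
  proof (rule ev_eqI)
    have "(\<lambda>(i,j). coef (A k) i j * (((q$1 - p$1) / \<sigma>) ^ i * ((q$2 - p$2) / \<sigma>) ^ j)) =
       (\<lambda>(i,j). ((q$1 - p$1) ^ i * (q$2 - p$2) ^ j) * (c i j $ k))"
      using \<sigma> by (auto simp: fun_eq_iff A_def coef_of_coeffs[OF l1] power_divide)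
    then show "((\<lambda>(i,j). coef (A k) i j * (((q$1 - p$1) / \<sigma>) ^ i * ((q$2 - p$2) / \<sigma>) ^ j)) has_sum f q $ k) UNIV"
      using comp[OF that, of k] by simp
  qed
  then show thesis
    by (intro that[of \<sigma> "A 1" "A 2"] \<sigma> vec2_eqI) auto
qed

lemma real_analytic2_on_ev2:
  assumes "0 < r"
  shows "real_analytic2_on (\<lambda>q. ev2 A B ((1/r) *\<^sub>R q)) (box2 r)"
proof (rule real_analytic2_onI)
  fix p assume "p \<in> box2 r"
  then have p: "\<bar>p$1\<bar> < r" "\<bar>p$2\<bar> < r" by (auto simp: box2_def)
  define \<sigma> where "\<sigma> = min (r - \<bar>p$1\<bar>) (r - \<bar>p$2\<bar>)"
  have \<sigma>: "\<sigma> > 0" using p by (simp add: \<sigma>_def)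
  have "\<bar>p$k / r\<bar> + \<bar>\<sigma> / r\<bar> \<le> 1" if "k = 1 \<or> k = 2" for k
    using that p assms \<sigma> by (auto simp: \<sigma>_def field_simps)
  then have "\<exists>c'. \<forall>s t. \<bar>s\<bar> \<le> 1 \<longrightarrow> \<bar>t\<bar> \<le> 1 \<longrightarrow> ev c' s t = ev c (p$1 / r + \<sigma> / r * s) (p$2 / r + \<sigma> / r * t)" for c
    by (intro ev_translate) auto
  then obtain A' B' where
    A': "\<And>s t. \<bar>s\<bar> \<le> 1 \<Longrightarrow> \<bar>t\<bar> \<le> 1 \<Longrightarrow> ev A' s t = ev A (p$1 / r + \<sigma> / r * s) (p$2 / r + \<sigma> / r * t)" and
    B': "\<And>s t. \<bar>s\<bar> \<le> 1 \<Longrightarrow> \<bar>t\<bar> \<le> 1 \<Longrightarrow> ev B' s t = ev B (p$1 / r + \<sigma> / r * s) (p$2 / r + \<sigma> / r * t)"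
    by metis
  have "ev2 A B ((1/r) *\<^sub>R q) = ev2 A' B' ((1/\<sigma>) *\<^sub>R (q - p))" if "q - p \<in> box2 \<sigma>" for q
  proof -
    have *: "p$k / r + \<sigma> / r * ((q$k - p$k) / \<sigma>) = q$k / r" for k
      using \<sigma> assms by (simp add: field_simps)
    have "\<bar>(q$1 - p$1) / \<sigma>\<bar> \<le> 1" "\<bar>(q$2 - p$2) / \<sigma>\<bar> \<le> 1" using that \<sigma> by (simp_all add: box2_def)
    from A'[OF this] B'[OF this] show ?thesis unfolding * by (intro vec2_eqI) auto
  qed
  with \<sigma> show "\<exists>\<sigma>>0. \<exists>A' B'. \<forall>q. q - p \<in> box2 \<sigma> \<longrightarrow> ev2 A B ((1/r) *\<^sub>R q) = ev2 A' B' ((1/\<sigma>) *\<^sub>R (q - p))"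
    by blast
qed

lemma real_analytic2_on_cong:
  assumes "open S" "\<And>q. q \<in> S \<Longrightarrow> f q = g q" "real_analytic2_on f S"
  shows "real_analytic2_on g S"
  unfolding real_analytic2_on_def
proof
  fix p assume p: "p \<in> S"
  from assms(3) p obtain c r where r: "r > 0" and hs:
    "\<And>q. q \<in> ball p r \<Longrightarrow> ((\<lambda>(i,j). ((q$1 - p$1) ^ i * (q$2 - p$2) ^ j) *\<^sub>R c i j) has_sum f q) UNIV"
    unfolding real_analytic2_on_def by blast
  from assms(1) p obtain e where e: "e > 0" "ball p e \<subseteq> S" by (meson open_contains_ball)
  have "((\<lambda>(i,j). ((q$1 - p$1) ^ i * (q$2 - p$2) ^ j) *\<^sub>R c i j) has_sum g q) UNIV" if "q \<in> ball p (min r e)" for q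
    using hs[of q] that assms(2)[of q] e by auto
  then show "\<exists>c r. 0 < r \<and> (\<forall>q\<in>ball p r. ((\<lambda>(i,j). ((q$1 - p$1) ^ i * (q$2 - p$2) ^ j) *\<^sub>R c i j) has_sum g q) UNIV)"
    using r e by (intro exI[of _ c] exI[of _ "min r e"]) auto
qed

lemma real_analytic2_on_subset: "real_analytic2_on f S \<Longrightarrow> T \<subseteq> S \<Longrightarrow> real_analytic2_on f T"
  unfolding real_analytic2_on_def by blast

lemma has_derivative_ev:
  "((\<lambda>q::real^2. ev c (q$1) (q$2)) has_derivative (\<lambda>v. coef c 1 0 * v$1 + coef c 0 1 * v$2)) (at 0)"
proof (rule has_derivativeI_sandwich[of "1/2" _ _ _ _ "\<lambda>q. 4 * norm (rem2 c) * norm q"])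
  show "bounded_linear (\<lambda>v::real^2. coef c 1 0 * v$1 + coef c 0 1 * v$2)"
    by (intro bounded_linear_add bounded_linear_const_mult bounded_linear_vec_nth)
  show "norm (ev c (q$1) (q$2) - ev c ((0::real^2)$1) (0$2) - (coef c 1 0 * (q - 0)$1 + coef c 0 1 * (q - 0)$2)) / norm (q - 0)
     \<le> 4 * norm (rem2 c) * norm q" if "q \<noteq> 0" "dist q 0 < 1/2" for q :: "real^2"
  proof -
    have n: "\<bar>q$1\<bar> \<le> norm q" "\<bar>q$2\<bar> \<le> norm q" "norm q \<le> 1/2"
      using component_le_norm_cart[of q 1] component_le_norm_cart[of q 2] that by auto
    have "ev c (q$1) (q$2) - ev c 0 0 - (coef c 1 0 * q$1 + coef c 0 1 * q$2) = subst of_real (q$1) (q$2) (rem2 c)"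
      using subst_taylor1[OF contractive_hom_of_real, of "q$1" "q$2" c] n subst_zero[OF contractive_hom_of_real, of c, where ?'b=real]
      by (simp add: ev_def)
    moreover have "norm (subst of_real (q$1) (q$2) (rem2 c)) \<le> 4 * (norm q)\<^sup>2 * norm (rem2 c)"
      using n by (intro subst_ord2_le contractive_hom_of_real ord2_rem2) auto
    ultimately show ?thesis using that by (simp add: power2_eq_square divide_simps mult_ac)
  qed
  show "((\<lambda>q::real^2. 4 * norm (rem2 c) * norm q) \<longlongrightarrow> 0) (at 0)"
    by (auto intro!: tendsto_eq_intros)
qed simp

lemma has_derivative_ev2:
  "(ev2 A B has_derivative (\<lambda>v. vector [coef A 1 0 * v$1 + coef A 0 1 * v$2, coef B 1 0 * v$1 + coef B 0 1 * v$2])) (at 0)"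
  unfolding ev2_def[abs_def] vector2_expand[of "ev _ _ _"] vector2_expand[of "_ * _ + _"]
  by (intro has_derivative_add has_derivative_scaleR_left has_derivative_ev)

lemma has_derivative_scaled_ev2:
  assumes "\<sigma> > 0" "\<And>q. q - p \<in> box2 \<sigma> \<Longrightarrow> f q = ev2 A B ((1/\<sigma>) *\<^sub>R (q - p))"
  shows "(f has_derivative (\<lambda>v. vector [(coef A 1 0 * v$1 + coef A 0 1 * v$2) / \<sigma>, (coef B 1 0 * v$1 + coef B 0 1 * v$2) / \<sigma>])) (at p)"
proof -
  have "((\<lambda>q. ev2 A B ((1/\<sigma>) *\<^sub>R (q - p))) has_derivative (\<lambda>v. vector [coef A 1 0 * ((1/\<sigma>) *\<^sub>R v)$1 + coef A 0 1 * ((1/\<sigma>) *\<^sub>R v)$2,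
      coef B 1 0 * ((1/\<sigma>) *\<^sub>R v)$1 + coef B 0 1 * ((1/\<sigma>) *\<^sub>R v)$2])) (at p)"
    by (rule has_derivative_compose[where g = "ev2 A B" and f = "\<lambda>q. (1/\<sigma>) *\<^sub>R (q - p)"])
      (use has_derivative_ev2[of A B] in \<open>auto intro!: derivative_eq_intros\<close>)
  then have "((\<lambda>q. ev2 A B ((1/\<sigma>) *\<^sub>R (q - p))) has_derivative (\<lambda>v. vector [(coef A 1 0 * v$1 + coef A 0 1 * v$2) / \<sigma>, (coef B 1 0 * v$1 + coef B 0 1 * v$2) / \<sigma>])) (at p)"
    by (simp add: add_divide_distrib)
  moreover have "open {q. q - p \<in> box2 \<sigma>}"
  proof -
    have "{q. q - p \<in> box2 \<sigma>} = (\<lambda>q. q - p) -` box2 \<sigma>" by auto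
    then show ?thesis using open_box2[of \<sigma>] by (simp add: open_vimage continuous_intros)
  qed
  ultimately show ?thesis
    by (rule has_derivative_transform_within_open) (use assms in \<open>auto simp: box2_def\<close>)
qed

lemma real_analytic2_on_differentiable:
  assumes "real_analytic2_on f S" "p \<in> S"
  shows "f differentiable (at p)"
proof -
  obtain \<sigma> A B where *: "\<sigma> > 0" "\<And>q. \<bar>q$1 - p$1\<bar> \<le> \<sigma> \<Longrightarrow> \<bar>q$2 - p$2\<bar> \<le> \<sigma> \<Longrightarrow> f q = ev2 A B ((1/\<sigma>) *\<^sub>R (q - p))"
    using real_analytic2_onD[OF assms] by blast
  show ?thesis
    using has_derivative_scaled_ev2[of \<sigma> p f A B] * unfolding differentiable_def box2_def by fastforce
qed

lemma real_analytic1_on_ev: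
  assumes "0 < r"
  shows "real_analytic1_on (\<lambda>t. ev c (t / r) 1) (ball 0 r)"
  unfolding real_analytic1_on_def
proof
  fix p :: real assume "p \<in> ball 0 r"
  then have p: "\<bar>p\<bar> < r" by simp
  define \<sigma> where "\<sigma> = r - \<bar>p\<bar>"
  have \<sigma>: "\<sigma> > 0" using p by (simp add: \<sigma>_def)
  obtain c' where c': "\<And>s t. \<bar>s\<bar> \<le> 1 \<Longrightarrow> \<bar>t\<bar> \<le> 1 \<Longrightarrow> ev c' s t = ev c (p / r + \<sigma> / r * s) (1 + 0 * t)"
    using ev_translate[of "p/r" "\<sigma>/r" 1 0 c] p \<sigma> assms by (auto simp: \<sigma>_def field_simps)
  have "(\<lambda>n. (coef c' n 0 / \<sigma> ^ n) * (t - p) ^ n) sums ev c (t / r) 1" if t: "t \<in> ball p \<sigma>" for t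
  proof -
    let ?s = "(t - p) / \<sigma>"
    have s: "\<bar>?s\<bar> \<le> 1" using t \<sigma> by (simp add: dist_real_def)
    have "((\<lambda>(i,j). coef c' i j * (?s ^ i * 0 ^ j)) has_sum ev c' ?s 0) UNIV"
      by (rule has_sum_ev) (use s in auto)
    also have "?this \<longleftrightarrow> ((\<lambda>(i,j). coef c' i j * (?s ^ i * 0 ^ j)) has_sum ev c' ?s 0) (range (\<lambda>n. (n, 0)))"
      by (rule has_sum_cong_neutral) (auto simp: power_0_left)
    also have "\<dots> \<longleftrightarrow> ((\<lambda>n. coef c' n 0 * ?s ^ n) has_sum ev c' ?s 0) UNIV"
      by (subst has_sum_reindex) (auto simp: inj_on_def o_def)
    finally have "(\<lambda>n. coef c' n 0 * ?s ^ n) sums ev c' ?s 0" by (rule has_sum_imp_sums)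
    moreover have "ev c' ?s 0 = ev c (t / r) 1"
      using c'[of ?s 0] s \<sigma> assms by (simp add: field_simps)
    ultimately show ?thesis by (simp add: power_divide)
  qed
  with \<sigma> show "\<exists>c'' s. 0 < s \<and> (\<forall>t\<in>ball p s. (\<lambda>n. c'' n * (t - p) ^ n) sums ev c (t / r) 1)"
    by (intro exI[of _ "\<lambda>n. coef c' n 0 / \<sigma> ^ n"] exI[of _ \<sigma>]) auto
qed

section \<open>Local analytic inverses\<close>

lemma real_analytic2_on_continuous_on:
  assumes "real_analytic2_on f S" shows "continuous_on S f"
  by (intro continuous_at_imp_continuous_on ballI differentiable_imp_continuous_within
      real_analytic2_on_differentiable[OF assms])

text \<open>
  Two maps that are inverse to each other only as germs become mutually inverse bijections after
  shrinking both domains to the points whose images stay in the good neighbourhoods.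
\<close>

lemma local_analytic_diffeoI:
  assumes S: "open S" "0 \<in> S" "real_analytic2_on h S" and T: "open T" "0 \<in> T" "real_analytic2_on k T"
    and "h 0 = 0" "k 0 = 0" "\<forall>\<^sub>F q in nhds 0. h (k q) = q" "\<forall>\<^sub>F q in nhds 0. k (h q) = q"
  shows "local_analytic_diffeo h"
proof -
  from assms(10) obtain S0 where S0: "open S0" "0 \<in> S0" "\<And>q. q \<in> S0 \<Longrightarrow> k (h q) = q"
    unfolding eventually_nhds by auto
  from assms(9) obtain T0 where T0: "open T0" "0 \<in> T0" "\<And>q. q \<in> T0 \<Longrightarrow> h (k q) = q"
    unfolding eventually_nhds by auto
  define U where "U = (S \<inter> S0) \<inter> h -` (T \<inter> T0)"
  define V where "V = (T \<inter> T0) \<inter> k -` (S \<inter> S0)"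
  have "open U"
    unfolding U_def using S S0 T T0
    by (intro continuous_open_preimage continuous_on_subset[OF real_analytic2_on_continuous_on[OF S(3)]]) auto
  moreover have "open V"
    unfolding V_def using S S0 T T0
    by (intro continuous_open_preimage continuous_on_subset[OF real_analytic2_on_continuous_on[OF T(3)]]) auto
  moreover have bij: "bij_betw h U V"
    by (rule bij_betw_byWitness[where f' = k]) (use S0(3) T0(3) in \<open>auto simp: U_def V_def\<close>)
  moreover have "0 \<in> U" "0 \<in> V" using S T S0 T0 assms(7,8) by (auto simp: U_def V_def)
  moreover have "real_analytic2_on h U" by (rule real_analytic2_on_subset[OF S(3)]) (auto simp: U_def)
  moreover have "real_analytic2_on (inv_into U h) V"
  proof (rule real_analytic2_on_cong[of _ k])
    show "open V" by fact
    show "real_analytic2_on k V" by (rule real_analytic2_on_subset[OF T(3)]) (auto simp: V_def)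
    fix p assume p: "p \<in> V"
    have "k p \<in> U" "h (k p) = p" using p T0(3) by (auto simp: U_def V_def)
    then show "k p = inv_into U h p"
      using bij inv_into_f_eq[of h U "k p" p] by (auto simp: bij_betw_def)
  qed
  ultimately show ?thesis using assms(7) unfolding local_analytic_diffeo_def by blast
qed

text \<open>
  Solves A(a, b) = \<tau> T1, B(a, b) = \<tau> T2 by iterating a = (\<tau> T1 - A2(a, b)) / \<alpha> and likewise for b, where A2 and B2 are
  the parts of order at least two and \<alpha>, \<beta> the leading coefficients.  Working with multiples
  \<tau> of the coordinates keeps the solution in a small ball.  The solution has a diagonal invertible
  linear part again, so that the lemma can be applied to it.
\<close>

lemma right_inverse_series:
  fixes A B :: "real l1ps"
  assumes A: "coef A 0 0 = 0" "coef A 1 0 \<noteq> 0" "coef A 0 1 = 0" and B: "coef B 0 0 = 0" "coef B 1 0 = 0" "coef B 0 1 \<noteq> 0"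
  obtains \<tau> and a b :: "real l1ps" where "0 < \<tau>" "norm a \<le> 1" "norm b \<le> 1"
    "subst of_real a b A = mon \<tau> 1 0" "subst of_real a b B = mon \<tau> 0 1"
    "coef a 0 0 = 0" "coef a 1 0 \<noteq> 0" "coef a 0 1 = 0" "coef b 0 0 = 0" "coef b 1 0 = 0" "coef b 0 1 \<noteq> 0"
proof -
  define \<alpha> \<beta> where "\<alpha> = coef A 1 0" and "\<beta> = coef B 0 1"
  have nz: "\<alpha> \<noteq> 0" "\<beta> \<noteq> 0" using A B by (auto simp: \<alpha>_def \<beta>_def)
  define A2 B2 where "A2 = rem2 A" and "B2 = rem2 B"
  have o2: "ord2 A2" "ord2 B2" by (simp_all add: A2_def B2_def ord2_rem2)
  define K where "K = norm A2 / \<bar>\<alpha>\<bar> + norm B2 / \<bar>\<beta>\<bar>"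
  \<comment> \<open>Each of the two components then contracts by 1/4, hence the pair by 1/2.\<close>
  define \<rho> where "\<rho> = 1 / (16 * (K + 1))"
  define \<tau> where "\<tau> = \<rho> / 2 * min \<bar>\<alpha>\<bar> \<bar>\<beta>\<bar>"
  have K: "0 \<le> K" "norm A2 / \<bar>\<alpha>\<bar> \<le> K" "norm B2 / \<bar>\<beta>\<bar> \<le> K" by (simp_all add: K_def)
  have \<rho>: "0 < \<rho>" "\<rho> \<le> 1/16" "\<rho> * K \<le> 1/16" using K by (simp_all add: \<rho>_def field_simps)
  have \<tau>: "0 < \<tau>" "\<tau> / \<bar>\<alpha>\<bar> \<le> \<rho> / 2" "\<tau> / \<bar>\<beta>\<bar> \<le> \<rho> / 2"
    using \<rho> nz by (auto simp: \<tau>_def min_def field_simps)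
  define step where "step = (\<lambda>\<gamma> C t (x :: real l1ps \<times> real l1ps). (1/\<gamma>) *\<^sub>R (t - subst of_real (fst x) (snd x) C :: real l1ps))"
  define \<Psi> where "\<Psi> = (\<lambda>x. (step \<alpha> A2 (mon \<tau> 1 0) x, step \<beta> B2 (mon \<tau> 0 1) x))"
  define D where "D = {a :: real l1ps. norm a \<le> \<rho> \<and> coef a 0 0 = 0}"
  have clD: "closed D"
  proof -
    have "D = {a. norm a \<le> \<rho>} \<inter> {a. coef a 0 0 = 0}" by (auto simp: D_def)
    moreover have "closed {a :: real l1ps. norm a \<le> \<rho>}" by (intro closed_Collect_le continuous_intros)
    moreover have "closed {a :: real l1ps. coef a 0 0 = 0}"
      by (intro closed_Collect_eq linear_continuous_on bounded_linear_coef continuous_intros)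
    ultimately show ?thesis by auto
  qed
  have ord_comp: "ord2 (subst of_real (fst x) (snd x) C)" if "x \<in> D \<times> D" "ord2 C" for x C
    using that \<rho> by (intro ord2_subst contractive_hom_of_real) (auto simp: D_def)
  have stepD: "step \<gamma> C (mon \<tau> i j) x \<in> D"
    if "x \<in> D \<times> D" "ord2 C" "\<tau> / \<bar>\<gamma>\<bar> \<le> \<rho> / 2" "norm C / \<bar>\<gamma>\<bar> \<le> K" "i \<noteq> 0 \<or> j \<noteq> 0" for x \<gamma> C i j
  proof -
    let ?s = "subst of_real (fst x) (snd x) C"
    have "norm ?s \<le> 4 * \<rho>\<^sup>2 * norm C"
      using that \<rho> by (intro subst_ord2_le contractive_hom_of_real) (auto simp: D_def)
    then have "norm ?s / \<bar>\<gamma>\<bar> \<le> (4 * \<rho>\<^sup>2 * norm C) / \<bar>\<gamma>\<bar>" by (rule divide_right_mono) simp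
    also have "\<dots> = 4 * \<rho>\<^sup>2 * (norm C / \<bar>\<gamma>\<bar>)" by simp
    also have "\<dots> \<le> 4 * \<rho>\<^sup>2 * K" by (intro mult_left_mono that) simp
    also have "\<dots> = 4 * \<rho> * (\<rho> * K)" by (simp add: power2_eq_square)
    also have "\<dots> \<le> 4 * \<rho> * (1/16)" using \<rho> by (intro mult_left_mono) auto
    finally have "norm ?s / \<bar>\<gamma>\<bar> \<le> \<rho> / 4" by simp
    then have s: "norm ?s / \<bar>\<gamma>\<bar> \<le> \<rho> / 2" using \<rho> by linarith
    have "norm (step \<gamma> C (mon \<tau> i j) x) = norm (mon \<tau> i j - ?s) / \<bar>\<gamma>\<bar>"
      by (simp add: step_def)
    also have "\<dots> \<le> (norm (mon \<tau> i j) + norm ?s) / \<bar>\<gamma>\<bar>"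
      by (intro divide_right_mono norm_triangle_ineq4) simp
    also have "\<dots> \<le> \<rho>" using s that(3) \<tau>(1) unfolding norm_mon add_divide_distrib by (simp only: real_norm_def abs_of_pos)
    finally have "norm (step \<gamma> C (mon \<tau> i j) x) \<le> \<rho>" .
    moreover have "coef (step \<gamma> C (mon \<tau> i j) x) 0 0 = 0"
      using ord_comp[OF that(1,2)] that(5) by (auto simp: step_def ord2_def coef_mon)
    ultimately show ?thesis by (simp add: D_def)
  qed
  have stepL: "norm (step \<gamma> C t x - step \<gamma> C t x') \<le> 1/4 * dist x x'"
    if "x \<in> D \<times> D" "x' \<in> D \<times> D" "ord2 C" "norm C / \<bar>\<gamma>\<bar> \<le> K" for x x' \<gamma> C t
  proof -
    have d: "norm (fst x - fst x') \<le> dist x x'" "norm (snd x - snd x') \<le> dist x x'"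
      using dist_fst_le[of x x'] dist_snd_le[of x x'] by (simp_all add: dist_norm)
    have "step \<gamma> C t x - step \<gamma> C t x' = - ((1/\<gamma>) *\<^sub>R (subst of_real (fst x) (snd x) C - subst of_real (fst x') (snd x') C))"
      by (simp add: step_def algebra_simps)
    then have "norm (step \<gamma> C t x - step \<gamma> C t x') = norm (subst of_real (fst x) (snd x) C - subst of_real (fst x') (snd x') C) / \<bar>\<gamma>\<bar>"
      by simp
    also have "\<dots> \<le> (2 * \<rho> * norm C * (norm (fst x - fst x') + norm (snd x - snd x'))) / \<bar>\<gamma>\<bar>"
      using that \<rho> by (intro divide_right_mono subst_ord2_lipschitz contractive_hom_of_real) (auto simp: D_def)
    also have "\<dots> = 2 * \<rho> * (norm C / \<bar>\<gamma>\<bar>) * (norm (fst x - fst x') + norm (snd x - snd x'))"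
      by simp
    also have "\<dots> \<le> 2 * \<rho> * K * (dist x x' + dist x x')"
      using that \<rho> K d by (intro mult_mono add_mono) auto
    also have "\<dots> = 4 * (\<rho> * K) * dist x x'" by simp
    also have "\<dots> \<le> 4 * (1/16) * dist x x'" using \<rho> by (intro mult_right_mono mult_left_mono) auto
    finally show ?thesis by simp
  qed
  have "\<exists>!x. x \<in> D \<times> D \<and> \<Psi> x = x"
  proof (rule Banach_fix[where c = "1/2"])
    show "complete (D \<times> D)" using clD by (simp add: complete_eq_closed closed_Times)
    show "D \<times> D \<noteq> {}" using \<rho> by (auto simp: D_def intro!: exI[of _ 0])
    show "\<Psi> ` (D \<times> D) \<subseteq> D \<times> D"
    proof
      fix z assume "z \<in> \<Psi> ` (D \<times> D)"
      then obtain x where x: "x \<in> D \<times> D" and z: "z = \<Psi> x" by blast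
      show "z \<in> D \<times> D" unfolding z \<Psi>_def
        by (intro SigmaI stepD x o2 \<tau> K) auto
    qed
    show "dist (\<Psi> x) (\<Psi> x') \<le> 1/2 * dist x x'" if "x \<in> D \<times> D" "x' \<in> D \<times> D" for x x'
    proof -
      have "dist (\<Psi> x) (\<Psi> x') \<le> dist (fst (\<Psi> x)) (fst (\<Psi> x')) + dist (snd (\<Psi> x)) (snd (\<Psi> x'))"
        unfolding dist_prod_def by (rule sqrt_sum_squares_le_sum) auto
      also have "\<dots> \<le> 1/4 * dist x x' + 1/4 * dist x x'"
        unfolding dist_norm \<Psi>_def fst_conv snd_conv
        unfolding dist_norm[symmetric]
        by (intro add_mono order_trans[OF eq_refl[OF dist_norm]] stepL that o2 K)
      finally show ?thesis by simp
    qed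
  qed auto
  then obtain a b where ab: "(a, b) \<in> D \<times> D" and fp: "\<Psi> (a, b) = (a, b)" by auto
  have n: "norm a \<le> 1" "norm b \<le> 1" "coef a 0 0 = 0" "coef b 0 0 = 0" using ab \<rho> by (auto simp: D_def)
  have a: "a = (1/\<alpha>) *\<^sub>R (mon \<tau> 1 0 - subst of_real a b A2)" and b: "b = (1/\<beta>) *\<^sub>R (mon \<tau> 0 1 - subst of_real a b B2)"
    using fp by (simp_all add: \<Psi>_def step_def)
  have scal: "c *\<^sub>R u = t - v" if "u = (1/c) *\<^sub>R (t - v)" "c \<noteq> 0" for c and u t v :: "real l1ps"
    using that by simp
  have a': "\<alpha> *\<^sub>R a = mon \<tau> 1 0 - subst of_real a b A2" and b': "\<beta> *\<^sub>R b = mon \<tau> 0 1 - subst of_real a b B2"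
    by (rule scal[OF a nz(1)], rule scal[OF b nz(2)])
  have oab: "ord2 (subst of_real a b A2)" "ord2 (subst of_real a b B2)"
    using ord_comp[OF ab o2(1)] ord_comp[OF ab o2(2)] by auto
  show thesis
  proof (rule that)
    show "0 < \<tau>" "norm a \<le> 1" "norm b \<le> 1" "coef a 0 0 = 0" "coef b 0 0 = 0" by (fact \<tau> n)+
    show "subst of_real a b A = mon \<tau> 1 0"
      using subst_taylor1[OF contractive_hom_of_real n(1,2), of A] A a'
      by (simp add: A2_def[symmetric] \<alpha>_def scaleR_conv_of_real)
    show "subst of_real a b B = mon \<tau> 0 1"
      using subst_taylor1[OF contractive_hom_of_real n(1,2), of B] B b'
      by (simp add: B2_def[symmetric] \<beta>_def scaleR_conv_of_real)
    have "coef (\<alpha> *\<^sub>R a) 1 0 = \<tau>" "coef (\<alpha> *\<^sub>R a) 0 1 = 0" "coef (\<beta> *\<^sub>R b) 1 0 = 0" "coef (\<beta> *\<^sub>R b) 0 1 = \<tau>"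
      unfolding a' b' using oab by (simp_all add: coef_mon ord2_def)
    then show "coef a 1 0 \<noteq> 0" "coef a 0 1 = 0" "coef b 1 0 = 0" "coef b 0 1 \<noteq> 0" using \<tau> nz by auto
  qed
qed

lemma right_inverse_ev2:
  assumes "norm a \<le> 1" "norm b \<le> 1" "subst of_real a b A = mon \<tau> 1 0" "subst of_real a b B = mon \<tau> 0 1"
    "0 < \<tau>" "q \<in> box2 \<tau>"
  shows "ev2 A B (ev2 a b ((1/\<tau>) *\<^sub>R q)) = q"
proof -
  have "\<bar>q$1 / \<tau>\<bar> \<le> 1" "\<bar>q$2 / \<tau>\<bar> \<le> 1" using assms by (auto simp: box2_def)
  from ev_subst[OF assms(1,2) this, of A] ev_subst[OF assms(1,2) this, of B]
  show ?thesis using assms(5) by (intro vec2_eqI) (simp_all add: assms(3,4) ev_mon)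
qed

lemma ev2_0: "coef A 0 0 = 0 \<Longrightarrow> coef B 0 0 = 0 \<Longrightarrow> ev2 A B 0 = 0"
  using subst_zero[OF contractive_hom_of_real, of A, where ?'b = real] subst_zero[OF contractive_hom_of_real, of B, where ?'b = real]
  by (intro vec2_eqI) (simp_all add: ev_def)

lemma eventually_box2: "0 < r \<Longrightarrow> \<forall>\<^sub>F q in nhds 0. q \<in> box2 r"
  using open_box2[of r] by (intro eventually_nhds_in_open) (auto simp: box2_def)

lemma isCont_scaled_ev2: "0 < r \<Longrightarrow> isCont (\<lambda>q. ev2 A B ((1/r) *\<^sub>R q)) 0"
  using real_analytic2_on_continuous_on[OF real_analytic2_on_ev2[of r A B]]
  unfolding continuous_on_eq_continuous_at[OF open_box2] by (auto simp: box2_def)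

text \<open>
  The right inverse h of the given map has in turn a right inverse k'.  Wherever everything is
  defined the given map equals its composition with h and k', which is k'; hence h is a two-sided
  inverse.
\<close>

lemma local_inverse_ev2:
  assumes A: "coef A 0 0 = 0" "coef A 1 0 \<noteq> 0" "coef A 0 1 = 0" and B: "coef B 0 0 = 0" "coef B 1 0 = 0" "coef B 0 1 \<noteq> 0"
  obtains h where "local_analytic_diffeo h" "\<forall>\<^sub>F q in nhds 0. h (ev2 A B q) = q" "\<forall>\<^sub>F q in nhds 0. ev2 A B (h q) = q"
proof -
  obtain \<tau> and a b :: "real l1ps" where \<tau>: "0 < \<tau>" and ab: "norm a \<le> 1" "norm b \<le> 1"
    "subst of_real a b A = mon \<tau> 1 0" "subst of_real a b B = mon \<tau> 0 1" and
    c: "coef a 0 0 = 0" "coef a 1 0 \<noteq> 0" "coef a 0 1 = 0" "coef b 0 0 = 0" "coef b 1 0 = 0" "coef b 0 1 \<noteq> 0"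
    using right_inverse_series[OF A B] .
  obtain \<sigma> and a' b' :: "real l1ps" where \<sigma>: "0 < \<sigma>" and ab': "norm a' \<le> 1" "norm b' \<le> 1"
    "subst of_real a' b' a = mon \<sigma> 1 0" "subst of_real a' b' b = mon \<sigma> 0 1" and
    c': "coef a' 0 0 = 0" "coef b' 0 0 = 0"
    using right_inverse_series[OF c] .
  define h where "h = (\<lambda>q. ev2 a b ((1/\<tau>) *\<^sub>R q))"
  \<comment> \<open>Near the origin h (k' q) = q, and the given map after h is the identity at k' q once k' q lies
    in the smaller box; continuity of k' ensures this.\<close>
  define k' where "k' = (\<lambda>q. \<tau> *\<^sub>R ev2 a' b' ((1/\<sigma>) *\<^sub>R q))"
  have kh: "ev2 A B (h q) = q" if "q \<in> box2 \<tau>" for q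
    unfolding h_def by (rule right_inverse_ev2[OF ab \<tau> that])
  have hk': "h (k' q) = q" if "q \<in> box2 \<sigma>" for q
    using right_inverse_ev2[OF ab' \<sigma> that] \<tau> by (simp add: h_def k'_def)
  have "isCont k' 0" unfolding k'_def by (intro continuous_intros isCont_scaled_ev2 \<sigma>)
  moreover have "k' 0 = 0" using ev2_0[OF c'] by (simp add: k'_def)
  ultimately have "filterlim k' (nhds 0) (nhds 0)" using tendsto_at_iff_tendsto_nhds[of k' 0] by (simp add: isCont_def)
  then have "\<forall>\<^sub>F q in nhds 0. k' q \<in> box2 \<tau>"
    using eventually_box2[OF \<tau>] unfolding filterlim_iff by blast
  then have hk: "\<forall>\<^sub>F q in nhds 0. h (ev2 A B q) = q"
    using eventually_box2[OF \<sigma>]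
  proof eventually_elim
    case (elim q)
    from kh[OF elim(1)] hk'[OF elim(2)] have "ev2 A B q = k' q" by simp
    then show ?case using hk'[OF elim(2)] by simp
  qed
  have kh': "\<forall>\<^sub>F q in nhds 0. ev2 A B (h q) = q"
    using eventually_box2[OF \<tau>] by eventually_elim (rule kh)
  have "local_analytic_diffeo h"
  proof (rule local_analytic_diffeoI[of "box2 \<tau>" h "box2 1" "ev2 A B"])
    show "real_analytic2_on h (box2 \<tau>)" unfolding h_def by (rule real_analytic2_on_ev2[OF \<tau>])
    show "real_analytic2_on (ev2 A B) (box2 1)" using real_analytic2_on_ev2[of 1 A B] by simp
    show "h 0 = 0" "ev2 A B 0 = 0" using ev2_0[of a b] ev2_0[of A B] A B c by (simp_all add: h_def)
  qed (use \<tau> hk kh' in \<open>auto simp: open_box2, auto simp: box2_def\<close>)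
  then show thesis using hk kh' by (rule that)
qed

section \<open>Reversible fields in complexified coordinates\<close>

definition even_part :: "real l1ps \<Rightarrow> real l1ps" where
  "even_part c = reindex UNIV (\<lambda>(i,j). (i, 2 * j)) c"

definition odd_part :: "real l1ps \<Rightarrow> real l1ps" where
  "odd_part c = reindex UNIV (\<lambda>(i,j). (i, Suc (2 * j))) c"

lemma inj_even: "inj (\<lambda>(i::nat,j::nat). (i, 2 * j))"
  and inj_odd: "inj (\<lambda>(i::nat,j::nat). (i, Suc (2 * j)))"
  by (auto simp: inj_on_def)

lemma coef_even_part: "coef (even_part c) i j = coef c i (2 * j)"
  and coef_odd_part: "coef (odd_part c) i j = coef c i (Suc (2 * j))"
  unfolding even_part_def odd_part_def coef_reindex[OF inj_even] coef_reindex[OF inj_odd] by simp_all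

text \<open>
  The parities of the second exponent split the series in two.  For functions that are even or odd in the
  second variable one part vanishes, so parity of a function can be used without proving that its
  coefficients vanish.
\<close>

lemma ev_even_odd:
  assumes "\<bar>s\<bar> \<le> 1" "\<bar>t\<bar> \<le> 1"
  shows "ev c s t = ev (even_part c) s (t\<^sup>2) + t * ev (odd_part c) s (t\<^sup>2)"
proof -
  let ?f = "\<lambda>(i,j). coef c i j * (s ^ i * t ^ j)"
  have t2: "\<bar>t\<^sup>2\<bar> \<le> 1" using assms by (simp add: abs_square_le_1)
  have "(?f has_sum ev (even_part c) s (t\<^sup>2)) (range (\<lambda>(i,j). (i, 2 * j)))"
    unfolding has_sum_reindex[OF inj_even]
    using has_sum_ev[OF assms(1) t2, of "even_part c"]
    by (simp add: o_def case_prod_unfold coef_even_part power_mult)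
  moreover have "(?f has_sum t * ev (odd_part c) s (t\<^sup>2)) (range (\<lambda>(i,j). (i, Suc (2 * j))))"
    unfolding has_sum_reindex[OF inj_odd]
    using has_sum_cmult_right[OF has_sum_ev[OF assms(1) t2, of "odd_part c"], of t]
    by (simp add: o_def case_prod_unfold coef_odd_part mult_ac flip: power_mult)
  moreover have "range (\<lambda>(i::nat,j::nat). (i, 2 * j)) \<inter> range (\<lambda>(i,j). (i, Suc (2 * j))) = {}"
    by (auto, presburger)
  ultimately have "(?f has_sum (ev (even_part c) s (t\<^sup>2) + t * ev (odd_part c) s (t\<^sup>2)))
     (range (\<lambda>(i,j). (i, 2 * j)) \<union> range (\<lambda>(i,j). (i, Suc (2 * j))))"
    by (rule has_sum_Un_disjoint)
  also have "range (\<lambda>(i,j). (i, 2 * j)) \<union> range (\<lambda>(i,j). (i, Suc (2 * j))) = (UNIV :: (nat \<times> nat) set)"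
  proof -
    have "(i, j) \<in> range (\<lambda>(i,j). (i, 2 * j)) \<union> range (\<lambda>(i,j). (i, Suc (2 * j)))" for i j :: nat
      by (cases "even j") (auto elim!: evenE oddE simp: image_iff)
    then show ?thesis by auto
  qed
  finally show ?thesis by (rule ev_eqI)
qed

definition evz :: "real l1ps \<Rightarrow> complex \<Rightarrow> complex \<Rightarrow> complex" where
  "evz c z w = subst of_real z w c"

lemma contractive_hom_evz: "norm z \<le> 1 \<Longrightarrow> norm w \<le> 1 \<Longrightarrow> contractive_hom (\<lambda>c. evz c z w)"
  unfolding evz_def by (intro contractive_hom_subst contractive_hom_of_real)

lemma evz_mon: "evz (mon r i j) z w = of_real r * (z ^ i * w ^ j)"
  using subst_mon[OF contractive_hom_of_real, of z w r i j] by (simp add: evz_def)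

lemma evz_subst:
  assumes "norm a \<le> 1" "norm b \<le> 1" "norm z \<le> 1" "norm w \<le> 1"
  shows "evz (subst of_real a b c) z w = evz c (evz a z w) (evz b z w)"
  using hom_subst_of_real[OF assms(1,2) contractive_hom_evz[OF assms(3,4)], of c] by (simp add: evz_def)

lemma norm_evz_le: "norm z \<le> 1 \<Longrightarrow> norm w \<le> 1 \<Longrightarrow> norm (evz c z w) \<le> norm c"
  by (rule contractive_homD(5)[OF contractive_hom_evz])

lemma evz_of_real:
  assumes "\<bar>s\<bar> \<le> 1" "\<bar>t\<bar> \<le> 1"
  shows "evz c (of_real s) (of_real t) = of_real (ev c s t)"
  using hom_subst_of_real[OF _ _ contractive_hom_of_real, of s t c, where ?'b = complex] assms
  by (simp add: ev_def evz_def)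

lemma cnj_evz:
  assumes "norm z \<le> 1" "norm w \<le> 1"
  shows "cnj (evz c z w) = evz c (cnj z) (cnj w)"
  unfolding evz_def by (rule hom_subst_of_real[OF assms contractive_hom_cnj])

lemma evz_swap:
  assumes "norm z \<le> 1" "norm w \<le> 1" shows "evz (swap c) z w = evz c w z"
  unfolding swap_def using evz_subst[of "T2 :: real l1ps" T1 z w c] assms by (simp add: norm_mon evz_mon)

text \<open>
  A series in \<xi> \<eta> alone can be read as a series in one variable, with the second argument set to 1.
  This is how the function G is extracted from a double series.
\<close>

lemma subst_diagonal:
  assumes "contractive_hom \<iota>" "\<And>i j. i \<noteq> j \<Longrightarrow> coef c i j = 0"
  shows "subst \<iota> (a * b) 1 c = subst \<iota> a b c"
  unfolding subst_def
proof (rule infsum_cong, clarify)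
  fix i j :: nat
  show "\<iota> (coef c i j) * ((a * b) ^ i * 1 ^ j) = \<iota> (coef c i j) * (a ^ i * b ^ j)"
    using assms(2)[of i j] by (cases "i = j") (simp_all add: contractive_homD[OF assms(1)] power_mult_distrib)
qed

lemma coef_subst_linear:
  fixes \<iota> :: "'a::{real_normed_field, banach} \<Rightarrow> 'b::{real_normed_field, banach} l1ps"
  assumes \<iota>: "contractive_hom \<iota>" "norm a \<le> 1" "norm b \<le> 1" and "coef a 0 0 = 0" "coef b 0 0 = 0" "i + j = 1"
  shows "coef (subst \<iota> a b c) i j = coef (\<iota> (coef c 0 0)) i j + coef (\<iota> (coef c 1 0) * a) i j + coef (\<iota> (coef c 0 1) * b) i j"
proof -
  have "coef (subst \<iota> a b (rem2 c)) i j = 0"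
    using ord2_subst[OF assms(1-5) ord2_rem2] assms(6) by (intro ord2D) auto
  then show ?thesis using subst_taylor1[OF \<iota>, of c] by simp
qed

lemma coef_of_real_mult: "coef (of_real r * a) i j = r *\<^sub>R coef a i j"
  by (metis coef_scaleR scaleR_conv_of_real)

lemma coef_of_real: "coef (of_real r) i j = (if i = 0 \<and> j = 0 then of_real r else 0)"
  by (simp add: of_real_def coef_one)

text \<open>
  For a field (P, Q) with P odd and Q even in v, write P = v p(u, v^2) and Q = q(u, v^2).  In
  z' = P + j Q one substitutes u = (z + w) / 2 and v = - \<epsilon> j D with D = (z - w) / 2, so that v^2 = - \<epsilon> D^2.
  The result is - \<epsilon> j F with F = D p - \<epsilon> q, and j has disappeared from F.
\<close>

definition cplx_field :: "real \<Rightarrow> real l1ps \<Rightarrow> real l1ps \<Rightarrow> real l1ps" where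
  "cplx_field \<epsilon> P Q =
    (let U = (1/2) *\<^sub>R (T1 + T2); D = (1/2) *\<^sub>R (T1 - T2) in
      D * subst of_real U (- \<epsilon> *\<^sub>R (D * D)) (odd_part P) - \<epsilon> *\<^sub>R subst of_real U (- \<epsilon> *\<^sub>R (D * D)) (even_part Q))"

lemma norm_half_T: "norm ((1/2) *\<^sub>R (T1 + T2) :: real l1ps) \<le> 1" "norm ((1/2) *\<^sub>R (T1 - T2) :: real l1ps) \<le> 1"
  using norm_triangle_ineq[of "T1 :: real l1ps" T2] norm_triangle_ineq4[of "T1 :: real l1ps" T2]
  by (simp_all add: norm_mon)

lemma norm_half_T_sq: "\<bar>\<epsilon>\<bar> = 1 \<Longrightarrow> norm (- \<epsilon> *\<^sub>R ((1/2) *\<^sub>R (T1 - T2) * (1/2) *\<^sub>R (T1 - T2)) :: real l1ps) \<le> 1"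
proof -
  assume e: "\<bar>\<epsilon>\<bar> = 1"
  have "norm ((1/2) *\<^sub>R (T1 - T2) * (1/2) *\<^sub>R (T1 - T2) :: real l1ps) \<le> 1 * 1"
    using norm_half_T(2) by (intro order_trans[OF norm_mult_ineq mult_mono]) auto
  then show ?thesis using e unfolding norm_scaleR by simp
qed

lemma evz_cplx_field:
  fixes j :: complex
  assumes \<epsilon>: "\<bar>\<epsilon>\<bar> = 1" and j: "j\<^sup>2 = - of_real \<epsilon>" and uv: "\<bar>u\<bar> + \<bar>v\<bar> \<le> 1"
    and P: "ev P u (- v) = - ev P u v" and Q: "ev Q u (- v) = ev Q u v"
  shows "evz (cplx_field \<epsilon> P Q) (of_real u + j * of_real v) (of_real u - j * of_real v) =
    j * (of_real (ev P u v) + j * of_real (ev Q u v))"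
proof -
  have "norm j = 1"
  proof -
    have "(norm j)\<^sup>2 = 1" using arg_cong[OF j, of norm] \<epsilon> by (simp add: norm_power)
    then show ?thesis using norm_ge_zero[of j] by (simp add: power2_eq_1_iff)
  qed
  let ?z = "of_real u + j * of_real v" and ?w = "of_real u - j * of_real v"
  have n: "norm ?z \<le> 1" "norm ?w \<le> 1"
    using norm_triangle_ineq[of "of_real u" "j * of_real v"] norm_triangle_ineq4[of "of_real u" "j * of_real v"]
      uv \<open>norm j = 1\<close> by (simp_all add: norm_mult)
  have uv1: "\<bar>u\<bar> \<le> 1" "\<bar>v\<bar> \<le> 1" using uv by auto
  then have v2: "\<bar>v\<^sup>2\<bar> \<le> 1" by (simp add: abs_square_le_1)
  note h = contractive_homD[OF contractive_hom_evz[OF n]]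
  have U: "evz ((1/2) *\<^sub>R (T1 + T2)) ?z ?w = of_real u"
    unfolding h evz_mon by (simp add: scaleR_conv_of_real)
  have D: "evz ((1/2) *\<^sub>R (T1 - T2)) ?z ?w = j * of_real v"
    unfolding h evz_mon by (simp add: scaleR_conv_of_real)
  have sq: "evz (- \<epsilon> *\<^sub>R (d * d)) ?z ?w = of_real (v\<^sup>2)" if "evz d ?z ?w = j * of_real v" for d
  proof -
    have "evz (- \<epsilon> *\<^sub>R (d * d)) ?z ?w = - of_real \<epsilon> * (j\<^sup>2 * of_real v ^ 2)"
      unfolding h(4) h(2) that by (simp add: scaleR_conv_of_real power2_eq_square)
    also have "\<dots> = of_real (\<epsilon>\<^sup>2) * of_real (v\<^sup>2)" unfolding j by (simp add: power2_eq_square)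
    also have "\<epsilon>\<^sup>2 = 1" using \<epsilon> by (metis one_power2 power2_abs)
    finally show ?thesis by simp
  qed
  note D2 = sq[OF D]
  have p: "ev P u v = v * ev (odd_part P) u (v\<^sup>2)"
    using ev_even_odd[of u v P] ev_even_odd[of u "- v" P] P uv1 by simp
  have q: "ev Q u v = ev (even_part Q) u (v\<^sup>2)"
    using ev_even_odd[of u v Q] ev_even_odd[of u "- v" Q] Q uv1 by simp
  have "evz (cplx_field \<epsilon> P Q) ?z ?w =
    (j * of_real v) * evz (odd_part P) (of_real u) (of_real (v\<^sup>2)) - \<epsilon> *\<^sub>R evz (even_part Q) (of_real u) (of_real (v\<^sup>2))"
    unfolding cplx_field_def Let_def h(8) h(4)[of \<epsilon>] h(2)[of _ "subst _ _ _ _"]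
      evz_subst[OF norm_half_T(1) norm_half_T_sq[OF \<epsilon>] n] U D D2 ..
  also have "\<dots> = j * of_real (ev P u v) + j\<^sup>2 * of_real (ev Q u v)"
    unfolding p q j evz_of_real[OF uv1(1) v2] by (simp add: scaleR_conv_of_real)
  finally show ?thesis by (simp add: power2_eq_square algebra_simps)
qed

lemma coef_cplx_field:
  assumes \<epsilon>: "\<bar>\<epsilon>\<bar> = 1" and "coef Q 0 0 = 0"
  shows "coef (cplx_field \<epsilon> P Q) 0 0 = 0" "coef (cplx_field \<epsilon> P Q) 1 0 = (coef P 0 1 - \<epsilon> * coef Q 1 0) / 2"
    "coef (cplx_field \<epsilon> P Q) 0 1 = - (coef P 0 1 + \<epsilon> * coef Q 1 0) / 2"
proof -
  let ?U = "(1/2) *\<^sub>R (T1 + T2) :: real l1ps" and ?D = "(1/2) *\<^sub>R (T1 - T2) :: real l1ps"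
  let ?V = "- \<epsilon> *\<^sub>R (?D * ?D)"
  have U: "coef ?U 0 0 = 0" "coef ?U 1 0 = 1/2" "coef ?U 0 1 = 1/2" by (simp_all add: coef_mon)
  have D: "coef ?D 0 0 = 0" "coef ?D 1 0 = 1/2" "coef ?D 0 1 = - (1/2)" by (simp_all add: coef_mon)
  have V: "coef ?V 0 0 = 0" "coef ?V 1 0 = 0" "coef ?V 0 1 = 0"
    using D by (simp_all add: coef_mult_0_0 coef_mult_1_0 coef_mult_0_1)
  note n = norm_half_T(1) norm_half_T_sq[OF \<epsilon>]
  have s0: "coef (subst of_real ?U ?V c) 0 0 = coef c 0 0" for c
    using hom_subst_of_real[OF n contractive_hom_coef_0_0, of c] subst_zero[OF contractive_hom_of_real, of c, where ?'b = real]
    unfolding U V by simp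
  have s1: "coef (subst of_real ?U ?V c) i j = 1/2 * coef c 1 0" if "i = 1 \<and> j = 0 \<or> i = 0 \<and> j = 1" for c i j
    using that coef_subst_linear[OF contractive_hom_of_real n U(1) V(1), of i j c] U V
    by (auto simp: coef_of_real_mult coef_of_real)
  have *: "cplx_field \<epsilon> P Q = ?D * subst of_real ?U ?V (odd_part P) - \<epsilon> *\<^sub>R subst of_real ?U ?V (even_part Q)"
    by (simp add: cplx_field_def Let_def)
  show "coef (cplx_field \<epsilon> P Q) 0 0 = 0"
    unfolding * coef_minus coef_mult_0_0 D s0 coef_scaleR coef_even_part using assms by (simp add: coef_mon)
  show "coef (cplx_field \<epsilon> P Q) 1 0 = (coef P 0 1 - \<epsilon> * coef Q 1 0) / 2"
    using s1[of 1 0 "even_part Q"] s0[of "odd_part P"] D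
    unfolding * coef_minus One_nat_def coef_mult_1_0 coef_scaleR by (simp add: coef_even_part coef_odd_part coef_mon algebra_simps)
  show "coef (cplx_field \<epsilon> P Q) 0 1 = - (coef P 0 1 + \<epsilon> * coef Q 1 0) / 2"
    using s1[of 0 1 "even_part Q"] s0[of "odd_part P"] D
    unfolding * coef_minus One_nat_def coef_mult_0_1 coef_scaleR by (simp add: coef_even_part coef_odd_part coef_mon algebra_simps)
qed

section \<open>From the conjugacy equation to real vector fields\<close>

definition evc :: "complex l1ps \<Rightarrow> real \<Rightarrow> real \<Rightarrow> complex" where
  "evc c s t = subst (\<lambda>x. x) (of_real s) (of_real t) c"

lemma contractive_hom_evc: "\<bar>s\<bar> \<le> 1 \<Longrightarrow> \<bar>t\<bar> \<le> 1 \<Longrightarrow> contractive_hom (\<lambda>c. evc c s t)"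
  unfolding evc_def by (intro contractive_hom_subst contractive_hom_id) auto

lemma evc_mon: "evc (mon r i j) s t = r * (of_real s ^ i * of_real t ^ j)"
  by (simp add: evc_def subst_mon[OF contractive_hom_id])

lemma evc_subst:
  assumes "norm a \<le> 1" "norm b \<le> 1" "\<bar>s\<bar> \<le> 1" "\<bar>t\<bar> \<le> 1"
  shows "evc (subst of_real a b c) s t = evz c (evc a s t) (evc b s t)"
  using hom_subst_of_real[OF assms(1,2) contractive_hom_evc[OF assms(3,4)], of c] by (simp add: evz_def)

lemma has_vector_derivative_evc: "((\<lambda>s. evc c s 0) has_vector_derivative coef c 1 0) (at 0)"
  unfolding has_vector_derivative_def
proof (rule has_derivativeI_sandwich[of "1/2" _ _ _ _ "\<lambda>s. 4 * norm (rem2 c) * \<bar>s\<bar>"])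
  show "bounded_linear (\<lambda>s::real. s *\<^sub>R coef c 1 0)" by (rule bounded_linear_scaleR_left)
  show "norm (evc c s 0 - evc c 0 0 - (s - 0) *\<^sub>R coef c 1 0) / norm (s - 0) \<le> 4 * norm (rem2 c) * \<bar>s\<bar>"
    if "s \<noteq> 0" "dist s 0 < 1/2" for s :: real
  proof -
    have s: "\<bar>s\<bar> \<le> 1/2" using that by simp
    have "evc c s 0 - evc c 0 0 - s *\<^sub>R coef c 1 0 = subst (\<lambda>x. x) (of_real s) 0 (rem2 c)"
      using subst_taylor1[OF contractive_hom_id, of "of_real s" 0 c] s subst_zero[OF contractive_hom_id, of c]
      by (simp add: evc_def scaleR_conv_of_real mult.commute)
    moreover have "norm (subst (\<lambda>x. x) (of_real s) 0 (rem2 c)) \<le> 4 * \<bar>s\<bar>\<^sup>2 * norm (rem2 c)"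
      using s by (intro subst_ord2_le contractive_hom_id ord2_rem2) auto
    ultimately have "norm (evc c s 0 - evc c 0 0 - s *\<^sub>R coef c 1 0) \<le> 4 * norm (rem2 c) * \<bar>s\<bar> * \<bar>s\<bar>"
      by (simp add: power2_eq_square mult_ac)
    then show ?thesis using that by (simp add: divide_simps)
  qed
  show "((\<lambda>s::real. 4 * norm (rem2 c) * \<bar>s\<bar>) \<longlongrightarrow> 0) (at 0)"
    by (auto intro!: tendsto_eq_intros)
qed simp

text \<open>
  Moving \<xi> to \<xi> (1 + \<tau> \<mu>) and \<eta> to \<eta> (1 - \<tau> \<mu>) differentiates a monomial with exponents (m, n) to \<mu> (m - n)
  times itself.  No termwise differentiation is needed: the moved arguments are
  affine series in \<tau>, and the derivative is the linear coefficient of the composed series.  The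
  normal form field is tangent to this line, because it is a multiple of (\<xi>, - \<eta>).
\<close>

lemma euler_derivative:
  fixes \<xi> \<eta> \<mu> :: complex
  assumes "norm \<xi> < 1" "norm \<eta> < 1" and y: "\<And>i j. coef y i j = (real i - real j) * coef x i j"
  shows "((\<lambda>\<tau>. evz x (\<xi> * (1 + of_real \<tau> * \<mu>)) (\<eta> * (1 - of_real \<tau> * \<mu>))) has_vector_derivative \<mu> * evz y \<xi> \<eta>) (at 0)"
proof -
  \<comment> \<open>For real \<tau> with absolute value at most \<sigma> both moved points remain in the unit disc.\<close>
  define \<sigma> where "\<sigma> = min (1 - norm \<xi>) (1 - norm \<eta>) / (1 + norm \<mu>)"
  have \<sigma>: "0 < \<sigma>" using assms by (simp add: \<sigma>_def add_pos_nonneg)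
  have "norm \<zeta> + norm \<zeta> * \<sigma> * norm \<mu> \<le> 1" if "\<zeta> = \<xi> \<or> \<zeta> = \<eta>" for \<zeta>
  proof -
    have "\<sigma> * norm \<mu> \<le> \<sigma> * (1 + norm \<mu>)" using \<sigma> by (intro mult_left_mono) auto
    also have "\<dots> = min (1 - norm \<xi>) (1 - norm \<eta>)"
      unfolding \<sigma>_def by (simp add: add_nonneg_eq_0_iff)
    also have "\<dots> \<le> 1 - norm \<zeta>" using that by auto
    finally have "\<sigma> * norm \<mu> \<le> 1 - norm \<zeta>" .
    moreover have "norm \<zeta> * (\<sigma> * norm \<mu>) \<le> 1 * (\<sigma> * norm \<mu>)"
      using \<sigma> that assms by (intro mult_right_mono) auto
    ultimately show ?thesis by (simp add: mult.assoc)
  qed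
  then have n: "norm \<xi> + norm \<xi> * \<sigma> * norm \<mu> \<le> 1" "norm \<eta> + norm \<eta> * \<sigma> * norm \<mu> \<le> 1" by auto
  define a where "a = mon \<xi> 0 0 + mon (\<xi> * of_real \<sigma> * \<mu>) 1 0"
  define b where "b = mon \<eta> 0 0 - mon (\<eta> * of_real \<sigma> * \<mu>) 1 0"
  have ab: "norm a \<le> 1" "norm b \<le> 1"
    using norm_triangle_ineq[of "mon \<xi> 0 0" "mon (\<xi> * of_real \<sigma> * \<mu>) 1 0"] norm_triangle_ineq4[of "mon \<eta> 0 0" "mon (\<eta> * of_real \<sigma> * \<mu>) 1 0"] n \<sigma>
    by (simp_all add: norm_mon norm_mult a_def b_def)
  define c where "c = subst of_real a b x"
  have evc: "evc c (\<tau> / \<sigma>) 0 = evz x (\<xi> * (1 + of_real \<tau> * \<mu>)) (\<eta> * (1 - of_real \<tau> * \<mu>))" if "\<bar>\<tau>\<bar> \<le> \<sigma>" for \<tau>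
  proof -
    have t: "\<bar>\<tau> / \<sigma>\<bar> \<le> 1" "\<bar>0::real\<bar> \<le> 1" using that \<sigma> by simp_all
    have "evc a (\<tau> / \<sigma>) 0 = \<xi> * (1 + of_real \<tau> * \<mu>)" "evc b (\<tau> / \<sigma>) 0 = \<eta> * (1 - of_real \<tau> * \<mu>)"
      using \<sigma> unfolding a_def b_def contractive_homD[OF contractive_hom_evc[OF t]] evc_mon
      by (simp_all add: field_simps)
    then show ?thesis unfolding c_def evc_subst[OF ab t] by simp
  qed
  have c10: "coef c 1 0 = of_real \<sigma> * \<mu> * evz y \<xi> \<eta>"
  proof -
    have coeffs: "coef a 0 0 = \<xi>" "coef a (Suc 0) 0 = \<xi> * of_real \<sigma> * \<mu>" "coef b 0 0 = \<eta>" "coef b (Suc 0) 0 = - (\<eta> * of_real \<sigma> * \<mu>)"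
      by (simp_all add: a_def b_def coef_mon)
    have "((\<lambda>z. coef (case z of (i,j) \<Rightarrow> of_real (coef x i j) * (a ^ i * b ^ j)) 1 0) has_sum coef c 1 0) UNIV"
      unfolding c_def
      by (rule has_sum_bounded_linear[OF bounded_linear_coef has_sum_subst[OF contractive_hom_of_real ab]])
    also have "(\<lambda>z. coef (case z of (i,j) \<Rightarrow> of_real (coef x i j) * (a ^ i * b ^ j)) 1 0) =
      (\<lambda>z. of_real \<sigma> * \<mu> * (case z of (i,j) \<Rightarrow> of_real (coef y i j) * (\<xi> ^ i * \<eta> ^ j)))"
    proof
      fix z :: "nat \<times> nat"
      obtain i j where z: "z = (i, j)" by fastforce
      show "coef (case z of (i,j) \<Rightarrow> of_real (coef x i j) * (a ^ i * b ^ j)) 1 0 =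
        of_real \<sigma> * \<mu> * (case z of (i,j) \<Rightarrow> of_real (coef y i j) * (\<xi> ^ i * \<eta> ^ j))"
        unfolding z prod.case coef_of_real_mult y
        unfolding One_nat_def coef_mult_1_0 coef_power_0_0 coef_power_1_0 coeffs
        by (cases i; cases j) (simp_all add: scaleR_conv_of_real algebra_simps)
    qed
    finally have "((\<lambda>z. of_real \<sigma> * \<mu> * (case z of (i,j) \<Rightarrow> of_real (coef y i j) * (\<xi> ^ i * \<eta> ^ j))) has_sum coef c 1 0) UNIV" .
    moreover have "((\<lambda>z. of_real \<sigma> * \<mu> * (case z of (i,j) \<Rightarrow> of_real (coef y i j) * (\<xi> ^ i * \<eta> ^ j))) has_sum of_real \<sigma> * \<mu> * evz y \<xi> \<eta>) UNIV"
      unfolding evz_def using assms by (intro has_sum_cmult_right has_sum_subst contractive_hom_of_real) auto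
    ultimately show ?thesis by (rule has_sum_unique)
  qed
  have "((\<lambda>\<tau>. evc c (\<tau> / \<sigma>) 0) has_vector_derivative (1 / \<sigma>) *\<^sub>R coef c 1 0) (at 0)"
  proof -
    have "((\<lambda>\<tau>. \<tau> / \<sigma>) has_real_derivative 1 / \<sigma>) (at 0)"
      using \<sigma> by (auto intro!: derivative_eq_intros)
    then show ?thesis
      using vector_diff_chain_at[of "\<lambda>\<tau>. \<tau> / \<sigma>" "1/\<sigma>" 0 "\<lambda>s. evc c s 0" "coef c 1 0"] has_vector_derivative_evc[of c]
      by (simp add: o_def has_real_derivative_iff_has_vector_derivative)
  qed
  moreover have "(1 / \<sigma>) *\<^sub>R coef c 1 0 = \<mu> * evz y \<xi> \<eta>"
    using \<sigma> unfolding c10 by (simp add: scaleR_conv_of_real)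
  ultimately have "((\<lambda>\<tau>. evc c (\<tau> / \<sigma>) 0) has_vector_derivative \<mu> * evz y \<xi> \<eta>) (at 0)" by simp
  then show ?thesis
    by (rule has_vector_derivative_transform_within_open[of _ _ _ "{-\<sigma><..<\<sigma>}"]) (use \<sigma> evc in auto)
qed

definition re_part :: "complex l1ps \<Rightarrow> real l1ps" where
  "re_part c = of_coeffs (\<lambda>i j. Re (coef c i j))"

lemma coef_re_part: "coef (re_part c) i j = Re (coef c i j)"
proof -
  have "l1_summable (\<lambda>i j. Re (coef c i j))"
    by (rule l1_summable_mult[OF l1_summable_coef[of c], of _ 1]) (simp add: abs_Re_le_cmod)
  then show ?thesis by (simp add: re_part_def coef_of_coeffs)
qed

lemma ev_re_part:
  assumes "\<bar>s\<bar> \<le> 1" "\<bar>t\<bar> \<le> 1"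
  shows "ev (re_part c) s t = Re (evc c s t)"
proof (rule ev_eqI)
  have "((\<lambda>z. Re (case z of (i,j) \<Rightarrow> coef c i j * (of_real s ^ i * of_real t ^ j))) has_sum Re (evc c s t)) UNIV"
    unfolding evc_def using assms by (intro has_sum_Re has_sum_subst contractive_hom_id) auto
  also have "(\<lambda>z. Re (case z of (i,j) \<Rightarrow> coef c i j * (of_real s ^ i * of_real t ^ j))) =
     (\<lambda>(i,j). coef (re_part c) i j * (s ^ i * t ^ j))"
    by (auto simp: fun_eq_iff coef_re_part simp flip: of_real_power of_real_mult)
  finally show "((\<lambda>(i,j). coef (re_part c) i j * (s ^ i * t ^ j)) has_sum Re (evc c s t)) UNIV" .
qed

text \<open>
  Translates the solved conjugacy equation back to the real plane.  The new coordinates are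
  \<xi> = (q1 + j q2) / 2 and \<eta> = (q1 - j q2) / 2; the factor 1/2 keeps the unit square inside the polydisc and
  is the reason for the division by 4 in the argument of c.  The values z = x(\<xi>, \<eta>) and w = x(\<eta>, \<xi>) have the
  form u + j v and u - j v with real u and v, because complex conjugation
  exchanges \<xi> and \<eta> in the centre case and fixes them in the saddle case.
\<close>

lemma reversible_conjugacy_series:
  assumes \<epsilon>: "\<epsilon> = 1 \<or> \<epsilon> = -1" and g: "0 < g"
    and c0: "coef Q 0 0 = 0" "coef P 0 1 = g" "coef Q 1 0 = - \<epsilon> * g"
    and parity: "\<And>u v. \<bar>u\<bar> \<le> 1 \<Longrightarrow> \<bar>v\<bar> \<le> 1 \<Longrightarrow> ev P u (- v) = - ev P u v"
      "\<And>u v. \<bar>u\<bar> \<le> 1 \<Longrightarrow> \<bar>v\<bar> \<le> 1 \<Longrightarrow> ev Q u (- v) = ev Q u v"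
  obtains A B c where
    "coef A 0 0 = 0" "coef A 1 0 \<noteq> 0" "coef A 0 1 = 0" "coef B 0 0 = 0" "coef B 1 0 = 0" "coef B 0 1 \<noteq> 0" "0 < ev c 0 1"
    "\<And>q. q \<in> box2 1 \<Longrightarrow> \<bar>ev A (q$1) (q$2)\<bar> \<le> 1 \<and> \<bar>ev B (q$1) (q$2)\<bar> \<le> 1"
    "\<And>q. q \<in> box2 1 \<Longrightarrow> ev2 A B (R q) = R (ev2 A B q)"
    "\<And>q. q \<in> box2 1 \<Longrightarrow> ((\<lambda>\<tau>. ev2 A B (q + \<tau> *\<^sub>R (ev c (((q$1)\<^sup>2 + \<epsilon> * (q$2)\<^sup>2) / 4) 1 *\<^sub>R vector [q$2, - \<epsilon> * q$1])))
        has_vector_derivative ev2 P Q (ev2 A B q)) (at 0)"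
proof -
  have \<epsilon>1: "\<bar>\<epsilon>\<bar> = 1" "\<epsilon> * \<epsilon> = 1" using \<epsilon> by auto
  define F where "F = cplx_field \<epsilon> P Q"
  define f where "f = (1/g) *\<^sub>R (F - mon g 1 0)"
  have "coef F 0 0 = 0" "coef F 1 0 = g" "coef F 0 1 = 0"
    unfolding F_def coef_cplx_field[OF \<epsilon>1(1) c0(1)] c0 using \<epsilon> by auto
  then have "ord2 f" unfolding ord2_def f_def by (simp add: coef_mon)
  then obtain \<kappa> x y s where \<kappa>: "0 < \<kappa>" and x: "norm x \<le> 1/2" "coef x 0 0 = 0" "coef x 1 0 = \<kappa>" "coef x 0 1 = 0"
    and y: "\<And>i j. coef y i j = (real i - real j) * coef x i j"
    and s: "\<And>i j. i \<noteq> j \<Longrightarrow> coef s i j = 0" "coef s 0 0 = 0"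
    and eq: "(1 + s) * y = x + subst of_real x (swap x) f"
    by (rule normal_form_series) blast
  have nx: "norm x \<le> 1" "norm (swap x) \<le> 1"
    using x(1) contractive_homD(5)[OF contractive_hom_swap, of x] by linarith+
  have eq': "(1 + s) * y = (1/g) *\<^sub>R subst of_real x (swap x) F"
  proof -
    note h = contractive_homD[OF contractive_hom_subst[OF contractive_hom_of_real nx]]
    have "subst of_real x (swap x) (mon g 1 0) = g *\<^sub>R x"
      by (simp add: subst_mon[OF contractive_hom_of_real] scaleR_conv_of_real)
    then show ?thesis unfolding eq f_def h using g by (simp add: scaleR_diff_right)
  qed
  define c where "c = g *\<^sub>R (1 + s)"
  have ys: "evz c \<xi> \<eta> * evz y \<xi> \<eta> = evz F (evz x \<xi> \<eta>) (evz x \<eta> \<xi>)" if "norm \<xi> \<le> 1" "norm \<eta> \<le> 1" for \<xi> \<eta>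
  proof -
    note h = contractive_homD[OF contractive_hom_evz[OF that]]
    have "c * y = subst of_real x (swap x) F" using eq' g by (simp add: c_def)
    then have "evz c \<xi> \<eta> * evz y \<xi> \<eta> = evz (subst of_real x (swap x) F) \<xi> \<eta>" by (simp flip: h(2))
    then show ?thesis by (simp add: evz_subst[OF nx that] evz_swap[OF that])
  qed
  have c_diag: "coef c i j = 0" if "i \<noteq> j" for i j using that by (auto simp: c_def coef_one s)
  have ev_c: "evz c \<xi> \<eta> = of_real (ev c r 1)" if "\<xi> * \<eta> = of_real r" "\<bar>r\<bar> \<le> 1" for \<xi> \<eta> r
    using subst_diagonal[OF contractive_hom_of_real c_diag, of \<xi> \<eta>] evz_of_real[of r 1 c] that by (simp add: evz_def)
  have c_pos: "0 < ev c 0 1"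
    using subst_diagonal[OF contractive_hom_of_real c_diag, of "0::real" 0] subst_zero[OF contractive_hom_of_real, of c, where ?'b=real] s g
    by (simp add: ev_def c_def coef_one)
  \<comment> \<open>Here \<open>\<epsilon> = -1\<close> is the saddle and \<open>\<epsilon> = 1\<close> the centre.\<close>
  obtain j :: complex where j: "j = 1 \<and> \<epsilon> = -1 \<or> j = \<i> \<and> \<epsilon> = 1" using \<epsilon> by blast
  have j2: "j * j = - of_real \<epsilon>" and nj: "norm j = 1" using j by auto
  have j0: "j \<noteq> 0" using nj by auto
  define a where "a = mon (1/2) 1 0 + mon (j/2) 0 1"
  define b where "b = mon (1/2) 1 0 - mon (j/2) 0 1"
  have ab: "norm a \<le> 1" "norm b \<le> 1"
    using norm_triangle_ineq[of "mon (1/2) 1 0" "mon (j/2) 0 1"] norm_triangle_ineq4[of "mon (1/2) 1 0" "mon (j/2) 0 1"] nj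
    by (simp_all add: a_def b_def norm_mon norm_divide)
  define Z where "Z = subst of_real a b x"
  define W where "W = subst of_real b a x"
  define A where "A = re_part ((1/2) *\<^sub>R (Z + W))"
  define B where "B = re_part (mon (1 / (2 * j)) 0 0 * (Z - W))"
  define xi where "xi = (\<lambda>q::real^2. (of_real (q$1) + j * of_real (q$2)) / 2)"
  define eta where "eta = (\<lambda>q::real^2. (of_real (q$1) - j * of_real (q$2)) / 2)"
  have box: "\<bar>q$1\<bar> \<le> 1" "\<bar>q$2\<bar> \<le> 1" "norm (xi q) < 1" "norm (eta q) < 1" if "q \<in> box2 1" for q
    using that norm_triangle_ineq[of "of_real (q$1)" "j * of_real (q$2)"] norm_triangle_ineq4[of "of_real (q$1)" "j * of_real (q$2)"]
    by (auto simp: box2_def xi_def eta_def norm_mult norm_divide nj)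
  have xi_eta: "xi q * eta q = of_real (((q$1)\<^sup>2 + \<epsilon> * (q$2)\<^sup>2) / 4)" for q
  proof -
    have "xi q * eta q = (of_real (q$1) * of_real (q$1) - (j * j) * (of_real (q$2) * of_real (q$2))) / 4"
      by (simp add: xi_def eta_def algebra_simps)
    then show ?thesis unfolding j2 by (simp add: power2_eq_square)
  qed
  define z where "z = (\<lambda>q. evz x (xi q) (eta q))"
  define w where "w = (\<lambda>q. evz x (eta q) (xi q))"
  have nzw: "norm (z q) \<le> 1/2" "norm (w q) \<le> 1/2" if "q \<in> box2 1" for q
    using norm_evz_le[of "xi q" "eta q" x] norm_evz_le[of "eta q" "xi q" x] box[OF that] x(1)
    by (auto simp: z_def w_def)
  have A: "ev A (q$1) (q$2) = Re ((z q + w q) / 2)" and B: "ev B (q$1) (q$2) = Re ((z q - w q) / (2 * j))" if "q \<in> box2 1" for q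
  proof -
    note bq = box[OF that]
    note h = contractive_homD[OF contractive_hom_evc[OF bq(1,2)]]
    have "evc a (q$1) (q$2) = xi q" "evc b (q$1) (q$2) = eta q"
      unfolding a_def b_def h evc_mon by (simp_all add: xi_def eta_def)
    then have "evc Z (q$1) (q$2) = z q" "evc W (q$1) (q$2) = w q"
      unfolding Z_def W_def evc_subst[OF ab bq(1,2)] evc_subst[OF ab(2,1) bq(1,2)] by (simp_all add: z_def w_def)
    then show "ev A (q$1) (q$2) = Re ((z q + w q) / 2)" "ev B (q$1) (q$2) = Re ((z q - w q) / (2 * j))"
      unfolding A_def B_def ev_re_part[OF bq(1,2)] h evc_mon by (simp_all add: scaleR_conv_of_real)
  qed
  have real: "of_real (Re ((z q + w q) / 2)) = (z q + w q) / 2" "of_real (Re ((z q - w q) / (2 * j))) = (z q - w q) / (2 * j)"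
    if "q \<in> box2 1" for q
  proof -
    note bq = box[OF that]
    have cnj: "cnj (z q) = evz x (cnj (xi q)) (cnj (eta q))" "cnj (w q) = evz x (cnj (eta q)) (cnj (xi q))"
      using bq by (auto simp: z_def w_def cnj_evz)
    have "cnj ((z q + w q) / 2) = (z q + w q) / 2 \<and> cnj ((z q - w q) / (2 * j)) = (z q - w q) / (2 * j)"
      using j
    proof
      assume "j = 1 \<and> \<epsilon> = -1"
      then have "cnj (xi q) = xi q" "cnj (eta q) = eta q" "cnj j = j" by (simp_all add: xi_def eta_def)
      then show ?thesis using cnj by (simp add: z_def w_def)
    next
      assume "j = \<i> \<and> \<epsilon> = 1"
      then have "cnj (xi q) = eta q" "cnj (eta q) = xi q" "cnj j = - j" by (simp_all add: xi_def eta_def)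
      then show ?thesis using cnj by (simp add: z_def w_def add.commute divide_simps)
    qed
    then show "of_real (Re ((z q + w q) / 2)) = (z q + w q) / 2" "of_real (Re ((z q - w q) / (2 * j))) = (z q - w q) / (2 * j)"
      by (metis Reals_cnj_iff of_real_Re)+
  qed
  have zw: "z q = of_real (ev A (q$1) (q$2)) + j * of_real (ev B (q$1) (q$2))"
    "w q = of_real (ev A (q$1) (q$2)) - j * of_real (ev B (q$1) (q$2))" if "q \<in> box2 1" for q
    unfolding A[OF that] B[OF that] real[OF that] using j0 by (simp_all add: field_simps)
  have bd: "\<bar>ev A (q$1) (q$2)\<bar> \<le> 1/2" "\<bar>ev B (q$1) (q$2)\<bar> \<le> 1/2" if "q \<in> box2 1" for q
  proof -
    have "\<bar>Re ((z q + w q) / 2)\<bar> \<le> norm ((z q + w q) / 2)" by (rule abs_Re_le_cmod)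
    also have "\<dots> \<le> 1/2" using norm_triangle_ineq[of "z q" "w q"] nzw[OF that] by (simp add: norm_divide)
    finally show "\<bar>ev A (q$1) (q$2)\<bar> \<le> 1/2" by (simp add: A[OF that])
    have "\<bar>Re ((z q - w q) / (2 * j))\<bar> \<le> norm ((z q - w q) / (2 * j))" by (rule abs_Re_le_cmod)
    also have "\<dots> \<le> 1/2" using norm_triangle_ineq4[of "z q" "w q"] nzw[OF that] by (simp add: norm_divide norm_mult nj)
    finally show "\<bar>ev B (q$1) (q$2)\<bar> \<le> 1/2" by (simp add: B[OF that])
  qed
  show thesis
  proof (rule that[of A B c])
    have ca: "coef a 0 0 = 0" "coef a 1 0 = 1/2" "coef a 0 1 = j/2" "coef b 0 0 = 0" "coef b 1 0 = 1/2" "coef b 0 1 = - j/2"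
      by (simp_all add: a_def b_def coef_mon)
    have cZ: "coef Z i k = of_real \<kappa> * coef a i k" "coef W i k = of_real \<kappa> * coef b i k" if "i + k = 1" for i k
      unfolding Z_def W_def
        coef_subst_linear[OF contractive_hom_of_real ab ca(1) ca(4) that] coef_subst_linear[OF contractive_hom_of_real ab(2,1) ca(4) ca(1) that]
      using x that by (simp_all add: coef_of_real_mult coef_of_real scaleR_conv_of_real)
    have cZ0: "coef Z 0 0 = 0" "coef W 0 0 = 0"
      using hom_subst_of_real[OF ab contractive_hom_coef_0_0, of x] hom_subst_of_real[OF ab(2,1) contractive_hom_coef_0_0, of x]
        subst_zero[OF contractive_hom_of_real, of x, where ?'b=complex] x
      by (simp_all add: Z_def W_def ca)
    show "coef A 0 0 = 0" "coef B 0 0 = 0"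
      using cZ0 by (simp_all add: A_def B_def coef_re_part coef_mult_0_0)
    have Z1: "coef Z 1 0 = of_real (\<kappa>/2)" "coef W 1 0 = of_real (\<kappa>/2)" "coef Z 0 1 = of_real (\<kappa>/2) * j" "coef W 0 1 = - of_real (\<kappa>/2) * j"
      using cZ[of 1 0] cZ[of 0 1] unfolding ca by simp_all
    show "coef A 1 0 \<noteq> 0" "coef A 0 1 = 0"
      unfolding A_def coef_re_part coef_scaleR coef_add Z1 using \<kappa> by simp_all
    show "coef B 1 0 = 0" "coef B 0 1 \<noteq> 0"
      unfolding B_def coef_re_part One_nat_def coef_mult_1_0 coef_mult_0_1 coef_minus Z1[unfolded One_nat_def] cZ0 coef_mon
      using \<kappa> j0 by simp_all
    show "0 < ev c 0 1" by (rule c_pos)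
    show "\<bar>ev A (q$1) (q$2)\<bar> \<le> 1 \<and> \<bar>ev B (q$1) (q$2)\<bar> \<le> 1" if "q \<in> box2 1" for q
      using bd[OF that] by auto
    have R: "R q $ 1 = q $ 1" "R q $ 2 = - q $ 2" for q by (simp_all add: R_def vector_2)
    show "ev2 A B (R q) = R (ev2 A B q)" if q: "q \<in> box2 1" for q
    proof -
      have Rq: "R q \<in> box2 1" using q by (simp add: box2_def R)
      have "xi (R q) = eta q" "eta (R q) = xi q" by (simp_all add: xi_def eta_def R)
      then have "z (R q) = w q" "w (R q) = z q" by (simp_all add: z_def w_def)
      then show ?thesis using A[OF Rq] B[OF Rq] A[OF q] B[OF q]
        by (intro vec2_eqI) (simp_all add: R add.commute minus_divide_left[symmetric] diff_divide_distrib)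
    qed
    fix q :: "real^2" assume q: "q \<in> box2 1"
    define r where "r = ((q$1)\<^sup>2 + \<epsilon> * (q$2)\<^sup>2) / 4"
    define N where "N = ev c r 1 *\<^sub>R (vector [q$2, - \<epsilon> * q$1] :: real^2)"
    define \<mu> where "\<mu> = - of_real \<epsilon> * j * of_real (ev c r 1)"
    have r1: "\<bar>r\<bar> \<le> 1"
    proof -
      have "norm (xi q * eta q) \<le> 1 * 1"
        unfolding norm_mult using box[OF q] by (intro mult_mono) auto
      then show ?thesis unfolding xi_eta r_def norm_of_real by simp
    qed
    have N: "N $ 1 = ev c r 1 * q$2" "N $ 2 = - (ev c r 1 * (\<epsilon> * q$1))" by (simp_all add: N_def vector_2)
    have jj: "j * (j * v) = - of_real \<epsilon> * v" for v using j2 by (simp flip: mult.assoc)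
    have ee: "of_real \<epsilon> * (of_real \<epsilon> * v) = v" for v :: complex
      using \<epsilon>1(2) by (metis mult.assoc mult_1 of_real_1 of_real_mult)
    \<comment> \<open>In the coordinates \<xi>, \<eta> the normal form field is (\<mu> \<xi>, - \<mu> \<eta>).\<close>
    have lin: "xi (q + \<tau> *\<^sub>R N) = xi q * (1 + of_real \<tau> * \<mu>)" "eta (q + \<tau> *\<^sub>R N) = eta q * (1 - of_real \<tau> * \<mu>)" for \<tau>
      by (simp_all add: xi_def eta_def \<mu>_def N algebra_simps add_divide_distrib diff_divide_distrib jj ee)
    have dz: "((\<lambda>\<tau>. z (q + \<tau> *\<^sub>R N)) has_vector_derivative \<mu> * evz y (xi q) (eta q)) (at 0)"
      unfolding z_def lin by (rule euler_derivative[OF box(3,4)[OF q] y])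
    have dw: "((\<lambda>\<tau>. w (q + \<tau> *\<^sub>R N)) has_vector_derivative - \<mu> * evz y (eta q) (xi q)) (at 0)"
      using euler_derivative[OF box(4,3)[OF q] y, of "- \<mu>"] unfolding w_def lin by simp
    let ?u = "ev A (q$1) (q$2)" and ?v = "ev B (q$1) (q$2)"
    let ?P = "ev P ?u ?v" and ?Q = "ev Q ?u ?v"
    have uv: "\<bar>?u\<bar> \<le> 1" "\<bar>?v\<bar> \<le> 1" "\<bar>?u\<bar> + \<bar>?v\<bar> \<le> 1" "\<bar>?u\<bar> + \<bar>- ?v\<bar> \<le> 1" "\<bar>- ?v\<bar> \<le> 1" using bd[OF q] by auto
    have j2': "j\<^sup>2 = - of_real \<epsilon>" using j2 by (simp add: power2_eq_square)
    have cq: "evz c (xi q) (eta q) = of_real (ev c r 1)" "evz c (eta q) (xi q) = of_real (ev c r 1)"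
      using ev_c[OF _ r1, of "xi q" "eta q"] ev_c[OF _ r1, of "eta q" "xi q"] xi_eta[of q] by (simp_all add: r_def mult.commute)
    have "\<mu> * evz y (xi q) (eta q) = - of_real \<epsilon> * j * evz F (z q) (w q)"
      using ys[of "xi q" "eta q"] box[OF q] by (simp add: \<mu>_def cq z_def w_def mult.assoc)
    also have "evz F (z q) (w q) = j * (of_real ?P + j * of_real ?Q)"
      unfolding F_def zw[OF q] by (rule evz_cplx_field[OF \<epsilon>1(1) j2' uv(3) parity(1)[OF uv(1,2)] parity(2)[OF uv(1,2)]])
    also have "- of_real \<epsilon> * j * (j * (of_real ?P + j * of_real ?Q)) = of_real ?P + j * of_real ?Q"
      by (simp add: mult.assoc jj ee)
    finally have dz': "((\<lambda>\<tau>. z (q + \<tau> *\<^sub>R N)) has_vector_derivative (of_real ?P + j * of_real ?Q)) (at 0)" using dz by simp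
    \<comment> \<open>Exchanging z and w amounts to replacing v by - v, where parity of P and Q applies.\<close>
    have "- \<mu> * evz y (eta q) (xi q) = of_real \<epsilon> * j * evz F (w q) (z q)"
      using ys[of "eta q" "xi q"] box[OF q] by (simp add: \<mu>_def cq z_def w_def mult.assoc)
    also have "evz F (w q) (z q) = j * (of_real (ev P ?u (- ?v)) + j * of_real (ev Q ?u (- ?v)))"
      using evz_cplx_field[OF \<epsilon>1(1) j2' uv(4), of P Q] parity[OF uv(1,2)] unfolding F_def zw[OF q] by simp
    also have "of_real \<epsilon> * j * (j * (of_real (ev P ?u (- ?v)) + j * of_real (ev Q ?u (- ?v)))) = of_real ?P - j * of_real ?Q"
      unfolding parity[OF uv(1,2)] by (simp add: mult.assoc jj ee algebra_simps)
    finally have dw': "((\<lambda>\<tau>. w (q + \<tau> *\<^sub>R N)) has_vector_derivative (of_real ?P - j * of_real ?Q)) (at 0)" using dw by simp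
    have dA: "((\<lambda>\<tau>. Re ((z (q + \<tau> *\<^sub>R N) + w (q + \<tau> *\<^sub>R N)) / 2)) has_vector_derivative ?P) (at 0)"
    proof -
      have "((\<lambda>\<tau>. Re ((z (q + \<tau> *\<^sub>R N) + w (q + \<tau> *\<^sub>R N)) * (1/2))) has_vector_derivative
         Re ((of_real ?P + j * of_real ?Q + (of_real ?P - j * of_real ?Q)) * (1/2))) (at 0)"
        by (rule bounded_linear.has_vector_derivative[OF bounded_linear_Re
              bounded_linear.has_vector_derivative[OF bounded_linear_mult_left has_vector_derivative_add[OF dz' dw']]])
      then show ?thesis by simp
    qed
    have dB: "((\<lambda>\<tau>. Re ((z (q + \<tau> *\<^sub>R N) - w (q + \<tau> *\<^sub>R N)) / (2 * j))) has_vector_derivative ?Q) (at 0)"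
    proof -
      have "((\<lambda>\<tau>. Re ((z (q + \<tau> *\<^sub>R N) - w (q + \<tau> *\<^sub>R N)) * (1/(2 * j)))) has_vector_derivative
         Re ((of_real ?P + j * of_real ?Q - (of_real ?P - j * of_real ?Q)) * (1/(2*j)))) (at 0)"
        by (rule bounded_linear.has_vector_derivative[OF bounded_linear_Re
              bounded_linear.has_vector_derivative[OF bounded_linear_mult_left has_vector_derivative_diff[OF dz' dw']]])
      also have "(of_real ?P + j * of_real ?Q - (of_real ?P - j * of_real ?Q)) * (1/(2*j)) = of_real ?Q"
        using j0 by (simp add: field_simps)
      finally show ?thesis by (simp only: times_divide_eq_right mult_1_right Re_complex_of_real)
    qed
    have "((\<lambda>\<tau>. Re ((z (q + \<tau> *\<^sub>R N) + w (q + \<tau> *\<^sub>R N)) / 2) *\<^sub>R (vector [1, 0] :: real^2) +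
       Re ((z (q + \<tau> *\<^sub>R N) - w (q + \<tau> *\<^sub>R N)) / (2 * j)) *\<^sub>R vector [0, 1])
       has_vector_derivative ?P *\<^sub>R vector [1, 0] + ?Q *\<^sub>R vector [0, 1]) (at 0)"
      by (rule has_vector_derivative_add[OF bounded_linear.has_vector_derivative[OF bounded_linear_scaleR_left dA]
            bounded_linear.has_vector_derivative[OF bounded_linear_scaleR_left dB]])
    then have d: "((\<lambda>\<tau>. vector [Re ((z (q + \<tau> *\<^sub>R N) + w (q + \<tau> *\<^sub>R N)) / 2), Re ((z (q + \<tau> *\<^sub>R N) - w (q + \<tau> *\<^sub>R N)) / (2 * j))])
       has_vector_derivative ev2 P Q (ev2 A B q)) (at 0)"
      by (simp only: vector2_expand[symmetric] ev2_def vector_2)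
    have "((\<lambda>\<tau>. ev2 A B (q + \<tau> *\<^sub>R N)) has_vector_derivative ev2 P Q (ev2 A B q)) (at 0)"
    proof (rule has_vector_derivative_transform_within_open[OF d, of "{\<tau>. q + \<tau> *\<^sub>R N \<in> box2 1}"])
      have "{\<tau>. q + \<tau> *\<^sub>R N \<in> box2 1} = (\<lambda>\<tau>. q + \<tau> *\<^sub>R N) -` box2 1" by auto
      then show "open {\<tau>. q + \<tau> *\<^sub>R N \<in> box2 1}" using open_box2[of 1] by (simp add: open_vimage continuous_intros)
      show "0 \<in> {\<tau>. q + \<tau> *\<^sub>R N \<in> box2 1}" using q by simp
      fix \<tau> assume "\<tau> \<in> {\<tau>. q + \<tau> *\<^sub>R N \<in> box2 1}"
      then have "q + \<tau> *\<^sub>R N \<in> box2 1" by simp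
      from A[OF this] B[OF this]
      show "vector [Re ((z (q + \<tau> *\<^sub>R N) + w (q + \<tau> *\<^sub>R N)) / 2), Re ((z (q + \<tau> *\<^sub>R N) - w (q + \<tau> *\<^sub>R N)) / (2 * j))] = ev2 A B (q + \<tau> *\<^sub>R N)"
        by (simp only: ev2_def)
    qed
    then show "((\<lambda>\<tau>. ev2 A B (q + \<tau> *\<^sub>R (ev c (((q$1)\<^sup>2 + \<epsilon> * (q$2)\<^sup>2) / 4) 1 *\<^sub>R vector [q$2, - \<epsilon> * q$1])))
        has_vector_derivative ev2 P Q (ev2 A B q)) (at 0)"
      by (simp only: N_def r_def)
  qed
qed

section \<open>The Hamiltonian field and the linear part of a reversible field\<close>

lemma ev_scaleR: "ev (r *\<^sub>R c) s t = r * ev c s t"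
proof -
  have "(\<lambda>(i,j). of_real (coef (r *\<^sub>R c) i j) * (s ^ i * t ^ j)) = (\<lambda>z. r * (case z of (i,j) \<Rightarrow> of_real (coef c i j) * (s ^ i * t ^ j)))"
    by (auto simp: fun_eq_iff)
  then show ?thesis unfolding ev_def subst_def by (simp only: infsum_cmult_right')
qed

lemma continuous_on_ev1:
  assumes "0 < r" shows "continuous_on (ball 0 r) (\<lambda>t. ev c (t / r) 1)"
proof -
  obtain c' where c': "\<And>s t. \<bar>s\<bar> \<le> 1 \<Longrightarrow> \<bar>t\<bar> \<le> 1 \<Longrightarrow> ev c' s t = ev c (0 + 1 * s) (1 + 0 * t)"
    using ev_translate[of 0 1 1 0 c] by auto
  have "continuous_on (ball 0 r) (\<lambda>t. ev2 c' c' ((1/r) *\<^sub>R (t *\<^sub>R axis 1 1)) $ 1)"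
  proof (intro continuous_on_component)
    show "continuous_on (ball 0 r) (\<lambda>t. ev2 c' c' ((1/r) *\<^sub>R (t *\<^sub>R axis 1 1)))"
      by (rule continuous_on_compose2[OF real_analytic2_on_continuous_on[OF real_analytic2_on_ev2[OF assms]]])
        (auto intro!: continuous_intros simp: box2_def axis_def assms)
  qed
  then show ?thesis
    by (rule continuous_on_eq) (use assms c' in \<open>auto simp: axis_def\<close>)
qed

text \<open>
  The interval [-1, 1] suffices, since only the germ of G at 0 matters.
\<close>

lemma half_primitive_derivative:
  assumes "continuous_on {-1..1} G" "\<bar>t\<bar> < 1"
  shows "(half_primitive G has_real_derivative G t / 2) (at t)"
proof -
  have "((\<lambda>u. LBINT y=ereal 0..ereal u. G y) has_vector_derivative G t) (at t within {-1..1})"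
    using assms by (intro interval_integral_FTC2) auto
  then have "((\<lambda>u. LBINT y=ereal 0..ereal u. G y) has_real_derivative G t) (at t)"
    using assms(2) by (subst (asm) at_within_interior) (auto simp: has_real_derivative_iff_has_vector_derivative)
  from DERIV_cmult[OF this, of "1/2"] show ?thesis
    unfolding half_primitive_def[abs_def] by (simp add: zero_ereal_def)
qed

lemma hamiltonian_normal_form:
  assumes G: "continuous_on {-1..1} G" and d: "d \<noteq> 0" and q: "q \<in> box2 (1/2)"
  defines "\<epsilon> \<equiv> if d > 0 then 1 else - 1"
  shows "hamiltonian_vf (normal_form_H d (half_primitive G)) q = G ((q$1)\<^sup>2 + \<epsilon> * (q$2)\<^sup>2) *\<^sub>R vector [q$2, - \<epsilon> * q$1]"
proof -
  let ?x = "q$1" and ?y = "q$2"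
  have lt: "?x\<^sup>2 < 1/2" "?y\<^sup>2 < 1/2"
  proof -
    have "a\<^sup>2 < 1/2" if "\<bar>a\<bar> < 1/2" for a :: real
    proof -
      have "\<bar>a\<bar> * \<bar>a\<bar> \<le> 1/2 * (1/2)" using that by (intro mult_mono) auto
      then show ?thesis by (simp add: power2_eq_square)
    qed
    then show "?x\<^sup>2 < 1/2" "?y\<^sup>2 < 1/2" using q by (auto simp: box2_def)
  qed
  have nn: "0 \<le> ?x\<^sup>2" "0 \<le> ?y\<^sup>2" by auto
  show ?thesis
  proof (cases "d > 0")
    case True
    note D = half_primitive_derivative[OF G, of "?x\<^sup>2 + ?y\<^sup>2"]
    have b: "\<bar>?x\<^sup>2 + ?y\<^sup>2\<bar> < 1" using lt nn by linarith
    have "((\<lambda>y. half_primitive G (?x\<^sup>2 + y\<^sup>2)) has_real_derivative G (?x\<^sup>2 + ?y\<^sup>2) / 2 * (2 * ?y)) (at ?y)"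
      by (rule DERIV_chain2[where f = "half_primitive G" and g = "\<lambda>y. ?x\<^sup>2 + y\<^sup>2"])
        (use D[OF b] in \<open>auto intro!: derivative_eq_intros\<close>)
    moreover have "((\<lambda>x. half_primitive G (x\<^sup>2 + ?y\<^sup>2)) has_real_derivative G (?x\<^sup>2 + ?y\<^sup>2) / 2 * (2 * ?x)) (at ?x)"
      by (rule DERIV_chain2[where f = "half_primitive G" and g = "\<lambda>x. x\<^sup>2 + ?y\<^sup>2"])
        (use D[OF b] in \<open>auto intro!: derivative_eq_intros\<close>)
    ultimately show ?thesis using True
      by (intro vec2_eqI) (simp_all add: hamiltonian_vf_def normal_form_H_def \<epsilon>_def vector_2 DERIV_imp_deriv)
  next
    case False
    note D = half_primitive_derivative[OF G, of "?x\<^sup>2 - ?y\<^sup>2"]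
    have b: "\<bar>?x\<^sup>2 - ?y\<^sup>2\<bar> < 1" using lt nn by linarith
    have "((\<lambda>y. half_primitive G (?x\<^sup>2 - y\<^sup>2)) has_real_derivative G (?x\<^sup>2 - ?y\<^sup>2) / 2 * (- 2 * ?y)) (at ?y)"
      by (rule DERIV_chain2[where f = "half_primitive G" and g = "\<lambda>y. ?x\<^sup>2 - y\<^sup>2"])
        (use D[OF b] in \<open>auto intro!: derivative_eq_intros\<close>)
    from DERIV_minus[OF this]
    have 1: "deriv (\<lambda>y. - half_primitive G (?x\<^sup>2 - y\<^sup>2)) ?y = G (?x\<^sup>2 - ?y\<^sup>2) * ?y" by (simp add: DERIV_imp_deriv)
    have "((\<lambda>x. half_primitive G (x\<^sup>2 - ?y\<^sup>2)) has_real_derivative G (?x\<^sup>2 - ?y\<^sup>2) / 2 * (2 * ?x)) (at ?x)"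
      by (rule DERIV_chain2[where f = "half_primitive G" and g = "\<lambda>x. x\<^sup>2 - ?y\<^sup>2"])
        (use D[OF b] in \<open>auto intro!: derivative_eq_intros\<close>)
    from DERIV_minus[OF this]
    have 2: "deriv (\<lambda>x. - half_primitive G (x\<^sup>2 - ?y\<^sup>2)) ?x = - (G (?x\<^sup>2 - ?y\<^sup>2) * ?x)" by (simp add: DERIV_imp_deriv)
    show ?thesis using False 1 2
      by (intro vec2_eqI) (simp_all add: hamiltonian_vf_def normal_form_H_def \<epsilon>_def vector_2)
  qed
qed

lemma R_nth [simp]: "R q $ 1 = q $ 1" "R q $ 2 = - q $ 2"
  by (simp_all add: R_def vector_2)

lemma bounded_linear_R: "bounded_linear R"
  by (rule bounded_linearI'; rule vec2_eqI) simp_all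

text \<open>
  Differentiate the reversibility relation at the fixed point of the involution.
\<close>

lemma reversible_linear_part:
  assumes X: "(X has_derivative M) (at 0)" and rev: "\<forall>\<^sub>F q in nhds 0. R (X q) = - X (R q)"
  shows "R (M v) = - M (R v)"
proof -
  have "R 0 = 0" by (rule vec2_eqI) simp_all
  have "((\<lambda>q. R (X q)) has_derivative (\<lambda>v. R (M v))) (at 0)"
    by (rule bounded_linear.has_derivative[OF bounded_linear_R X])
  moreover have "((\<lambda>q. - X (R q)) has_derivative (\<lambda>v. - M (R v))) (at 0)"
    using has_derivative_compose[OF bounded_linear_imp_has_derivative[OF bounded_linear_R], of X M 0 UNIV] X \<open>R 0 = 0\<close>
    by (intro has_derivative_minus) simp
  then have "((\<lambda>q. R (X q)) has_derivative (\<lambda>v. - M (R v))) (at 0)"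
    by (rule has_derivative_transform_eventually)
      (use rev eventually_nhds_x_imp_x[OF rev] in \<open>auto simp: eventually_at_filter elim: eventually_mono\<close>)
  ultimately have "(\<lambda>v. R (M v)) = (\<lambda>v. - M (R v))" by (rule has_derivative_unique)
  then show ?thesis by (rule fun_cong)
qed

section \<open>Conjugacy to the Hamiltonian normal form\<close>

text \<open>
  By reversibility the linear part at the origin is antidiagonal with entries a and b, and
  d = - a b.  Scaling u by s1 and v by s2 = s1 g / a with g = sqrt |d| turns a into g and b into - \<epsilon> g, which
  is the linear part of the normal form.  The common factor s1 is chosen so small that the series
  converges on the unit square and the reversibility relation holds there.
\<close>

lemma scaled_reversible_series:
  fixes X :: "real^2 \<Rightarrow> real^2"
  assumes an: "real_analytic2_on X U" "0 \<in> U" and X0: "X 0 = 0"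
    and d: "d = det (matrix (frechet_derivative X (at 0)))" "d \<noteq> 0" and rev: "reversible_near_0 R X"
  defines "\<epsilon> \<equiv> if d > 0 then 1 else - 1"
  obtains s1 s2 g P Q where "s1 \<noteq> 0" "s2 \<noteq> 0" "0 < g" "coef Q 0 0 = 0" "coef P 0 1 = g" "coef Q 1 0 = - \<epsilon> * g"
    "\<And>u v. \<bar>u\<bar> \<le> 1 \<Longrightarrow> \<bar>v\<bar> \<le> 1 \<Longrightarrow> X (vector [s1 * u, s2 * v]) = vector [s1 * ev P u v, s2 * ev Q u v]"
    "\<And>u v. \<bar>u\<bar> \<le> 1 \<Longrightarrow> \<bar>v\<bar> \<le> 1 \<Longrightarrow> ev P u (- v) = - ev P u v"
    "\<And>u v. \<bar>u\<bar> \<le> 1 \<Longrightarrow> \<bar>v\<bar> \<le> 1 \<Longrightarrow> ev Q u (- v) = ev Q u v"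
proof -
  have rev': "\<forall>\<^sub>F q in nhds 0. R (X q) = - X (R q)"
    using rev unfolding reversible_near_0_def
    by (simp add: frechet_derivative_at[OF bounded_linear_imp_has_derivative[OF bounded_linear_R], symmetric])
  obtain \<sigma> A B where \<sigma>: "\<sigma> > 0"
    and X: "\<And>q. \<bar>q$1 - (0::real^2)$1\<bar> \<le> \<sigma> \<Longrightarrow> \<bar>q$2 - (0::real^2)$2\<bar> \<le> \<sigma> \<Longrightarrow> X q = ev2 A B ((1/\<sigma>) *\<^sub>R (q - 0))"
    using real_analytic2_onD[OF an] by blast
  define M where "M = (\<lambda>v::real^2. vector [(coef A 1 0 * v$1 + coef A 0 1 * v$2) / \<sigma>, (coef B 1 0 * v$1 + coef B 0 1 * v$2) / \<sigma>] :: real^2)"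
  have hasM: "(X has_derivative M) (at 0)"
    unfolding M_def by (rule has_derivative_scaled_ev2[OF \<sigma>]) (use X in \<open>auto simp: box2_def\<close>)
  note sym = reversible_linear_part[OF hasM rev']
  have A1: "coef A 1 0 = 0"
    using arg_cong[OF sym[of "vector [1, 0]"], of "\<lambda>v. v $ 1"] \<sigma> by (simp add: M_def vector_2)
  have B1: "coef B 0 1 = 0"
    using arg_cong[OF sym[of "vector [0, 1]"], of "\<lambda>v. v $ 2"] \<sigma> by (simp add: M_def vector_2)
  define a b where "a = coef A 0 1 / \<sigma>" and "b = coef B 1 0 / \<sigma>"
  have dab: "d = - (a * b)"
    unfolding d frechet_derivative_at[OF hasM, symmetric] det_2
    using A1 B1 by (simp add: matrix_def M_def axis_def vector_2 a_def b_def)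
  have a0: "a \<noteq> 0" using dab d by auto
  define g where "g = sqrt \<bar>d\<bar>"
  have g: "0 < g" "g * g = \<epsilon> * d" using d by (auto simp: g_def \<epsilon>_def)
  from rev' obtain e where e: "e > 0" "\<And>q. norm q < e \<Longrightarrow> R (X q) = - X (R q)"
    unfolding eventually_nhds_metric by auto
  define \<delta> where "\<delta> = min \<sigma> (e/3)"
  have \<delta>: "0 < \<delta>" "\<delta> \<le> \<sigma>" using \<sigma> e by (auto simp: \<delta>_def)
  have R\<delta>: "R (X q) = - X (R q)" if "\<bar>q$1\<bar> \<le> \<delta>" "\<bar>q$2\<bar> \<le> \<delta>" for q
  proof -
    have "norm q \<le> \<bar>q$1\<bar> + \<bar>q$2\<bar>" using norm_le_l1_cart[of q] by (simp add: sum_2)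
    also have "\<dots> \<le> e/3 + e/3" using that by (intro add_mono) (auto simp: \<delta>_def)
    finally show ?thesis using e by (intro e(2)) linarith
  qed
  \<comment> \<open>Then s1 + |s2| = \<delta>, so both scaling factors are at most \<delta> in absolute value.\<close>
  define s1 where "s1 = \<delta> / (1 + g / \<bar>a\<bar>)"
  define s2 where "s2 = s1 * (g / a)"
  have pos: "0 < 1 + g / \<bar>a\<bar>" using g a0 by (simp add: add_pos_nonneg)
  have s1: "0 < s1" using \<delta> pos by (simp add: s1_def)
  have s1': "s1 \<le> \<delta>" "\<bar>s2\<bar> \<le> \<delta>"
  proof -
    have eq: "s1 + s1 * (g / \<bar>a\<bar>) = \<delta>"
    proof -
      have "s1 + s1 * (g / \<bar>a\<bar>) = s1 * (1 + g / \<bar>a\<bar>)" by (simp only: distrib_left mult_1_right)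
      then show ?thesis using pos by (simp add: s1_def)
    qed
    have "0 \<le> s1 * (g / \<bar>a\<bar>)" using s1 g by simp
    then show "s1 \<le> \<delta>" using eq by linarith
    have "\<bar>s2\<bar> = s1 * (g / \<bar>a\<bar>)" using s1 g by (simp add: s2_def abs_mult)
    then show "\<bar>s2\<bar> \<le> \<delta>" using eq s1 by linarith
  qed
  have s2: "s2 \<noteq> 0" using s1 g a0 by (simp add: s2_def)
  let ?a = "mon (s1 / \<sigma>) 1 0 :: real l1ps" and ?b = "mon (s2 / \<sigma>) 0 1 :: real l1ps"
  have n: "norm ?a \<le> 1" "norm ?b \<le> 1" using s1' s1 \<delta> \<sigma> by (simp_all add: norm_mon)
  define P where "P = (1/s1) *\<^sub>R subst of_real ?a ?b A"
  define Q where "Q = (1/s2) *\<^sub>R subst of_real ?a ?b B"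
  have bnd: "\<bar>s1 * u\<bar> \<le> \<delta>" "\<bar>s2 * v\<bar> \<le> \<delta>" if "\<bar>u\<bar> \<le> 1" "\<bar>v\<bar> \<le> 1" for u v
    using mult_mono[of "\<bar>s1\<bar>" \<delta> "\<bar>u\<bar>" 1] mult_mono[of "\<bar>s2\<bar>" \<delta> "\<bar>v\<bar>" 1] s1 s1' that \<delta>
    by (simp_all add: abs_mult)
  have XPQ: "X (vector [s1 * u, s2 * v]) = vector [s1 * ev P u v, s2 * ev Q u v]" if uv: "\<bar>u\<bar> \<le> 1" "\<bar>v\<bar> \<le> 1" for u v
  proof -
    have "X (vector [s1 * u, s2 * v]) = ev2 A B ((1/\<sigma>) *\<^sub>R vector [s1 * u, s2 * v])"
      using X[of "vector [s1 * u, s2 * v]"] bnd[OF uv] \<delta> by (simp add: vector_2)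
    moreover have "s1 * ev P u v = ev A (s1 / \<sigma> * u) (s2 / \<sigma> * v)" "s2 * ev Q u v = ev B (s1 / \<sigma> * u) (s2 / \<sigma> * v)"
      using s1 s2 ev_subst[OF n uv] by (simp_all add: P_def Q_def ev_scaleR ev_mon)
    ultimately show ?thesis by (intro vec2_eqI) (simp_all add: vector_2)
  qed
  have par: "ev P u (- v) = - ev P u v \<and> ev Q u (- v) = ev Q u v" if uv: "\<bar>u\<bar> \<le> 1" "\<bar>v\<bar> \<le> 1" for u v
  proof -
    have uv': "\<bar>- v\<bar> \<le> 1" using uv by simp
    have "R (vector [s1 * u, s2 * v]) = vector [s1 * u, s2 * - v]" by (rule vec2_eqI) (simp_all add: vector_2)
    then have "R (vector [s1 * ev P u v, s2 * ev Q u v]) = - (vector [s1 * ev P u (- v), s2 * ev Q u (- v)])"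
      using R\<delta>[of "vector [s1 * u, s2 * v]"] bnd[OF uv] XPQ[OF uv] XPQ[OF uv(1) uv'] by (simp add: vector_2)
    note eq = arg_cong[OF this, of "\<lambda>q. q $ 1"] arg_cong[OF this, of "\<lambda>q. q $ 2"]
    have "s1 * (ev P u (- v) + ev P u v) = 0" "s2 * ev Q u v = s2 * ev Q u (- v)"
      using eq by (simp_all add: vector_2 distrib_left)
    then have "ev P u (- v) + ev P u v = 0" "ev Q u v = ev Q u (- v)" using s1 s2 by auto
    then show ?thesis by linarith
  qed
  have lin: "coef (subst of_real ?a ?b C) i j = coef C 1 0 * coef ?a i j + coef C 0 1 * coef ?b i j" if "i + j = 1" for C i j
    using coef_subst_linear[OF contractive_hom_of_real n _ _ that, of C] that by (auto simp: coef_mon coef_of_real coef_of_real_mult)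
  show thesis
  proof (rule that[of s1 s2 g Q P])
    show "s1 \<noteq> 0" "s2 \<noteq> 0" "0 < g" using s1 s2 g by auto
    have "ev B 0 0 = 0"
      using X[of 0] X0 \<sigma> ev2_nth(2)[of A B 0] by simp
    then have "coef B 0 0 = 0"
      using subst_zero[OF contractive_hom_of_real, of B, where ?'b = real] by (simp add: ev_def)
    then show "coef Q 0 0 = 0"
      using hom_subst_of_real[OF n contractive_hom_coef_0_0, of B] subst_zero[OF contractive_hom_of_real, of B, where ?'b = real]
      by (simp add: Q_def coef_mon)
    have "coef P 0 1 = s2 / s1 * a"
      unfolding P_def coef_scaleR using lin[of 0 1 A] A1 by (simp add: coef_mon a_def)
    then show "coef P 0 1 = g" using s1 a0 by (simp add: s2_def)
    have "coef Q 1 0 = s1 / s2 * b"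
      unfolding Q_def coef_scaleR using lin[of 1 0 B] B1 by (simp add: coef_mon b_def)
    also have "\<dots> = a * b / g" using s1 g a0 by (simp add: s2_def)
    also have "\<dots> = - \<epsilon> * (g * g) / g"
      using dab unfolding g(2) by (auto simp: \<epsilon>_def)
    finally show "coef Q 1 0 = - \<epsilon> * g" using g(1) by simp
  qed (use XPQ par in auto)
qed

text \<open>
  The map k of \<open>reversible_conjugacy_series\<close>, composed with the scaling, sends the flow
  direction N of the normal form to X.  Its local inverse h conjugates X to the normal form: h sends
  the curve \<tau> \<mapsto> k (p + \<tau> N) back to a straight line, so the chain rule at \<tau> = 0 gives the image
  of X under the derivative of h.  Equivariance of h is inherited from k through uniqueness of the
  inverse.
\<close>

theorem theorem1p1:
  fixes X :: "real^2 \<Rightarrow> real^2" and U :: "(real^2) set" and d :: real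
  assumes "open U" and "0 \<in> U" and "real_analytic2_on X U"
    and "X 0 = 0"
    and "d = det (matrix (frechet_derivative X (at 0)))" and "d \<noteq> 0"
    and "reversible_near_0 R X"
  shows "\<exists>(G :: real \<Rightarrow> real) W. open W \<and> 0 \<in> W \<and> real_analytic1_on G W \<and> G 0 > 0 \<and>
    (let X\<^sub>H = hamiltonian_vf (normal_form_H d (half_primitive G)) in
       analytically_conjugate X X\<^sub>H \<and>
       (\<exists>h. local_analytic_diffeo h \<and> conjugates_near_0 h X X\<^sub>H \<and>
            (\<forall>\<^sub>F q in nhds 0. h (R q) = R (h q))))"
proof -
  define \<epsilon> :: real where "\<epsilon> = (if d > 0 then 1 else - 1)"
  have \<epsilon>: "\<epsilon> = 1 \<or> \<epsilon> = - 1" by (simp add: \<epsilon>_def)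
  obtain s1 s2 g Q P where s: "s1 \<noteq> 0" "s2 \<noteq> 0" and g: "0 < g" and PQ: "coef Q 0 0 = 0" "coef P 0 1 = g" "coef Q 1 0 = - \<epsilon> * g"
    and X: "\<And>u v. \<bar>u\<bar> \<le> 1 \<Longrightarrow> \<bar>v\<bar> \<le> 1 \<Longrightarrow> X (vector [s1 * u, s2 * v]) = vector [s1 * ev P u v, s2 * ev Q u v]"
    and par: "\<And>u v. \<bar>u\<bar> \<le> 1 \<Longrightarrow> \<bar>v\<bar> \<le> 1 \<Longrightarrow> ev P u (- v) = - ev P u v"
      "\<And>u v. \<bar>u\<bar> \<le> 1 \<Longrightarrow> \<bar>v\<bar> \<le> 1 \<Longrightarrow> ev Q u (- v) = ev Q u v"
    by (rule scaled_reversible_series[OF assms(3,2,4,5,6,7), folded \<epsilon>_def]) (rule that)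
  obtain A B c where A: "coef A 0 0 = 0" "coef A 1 0 \<noteq> 0" "coef A 0 1 = 0" and B: "coef B 0 0 = 0" "coef B 1 0 = 0" "coef B 0 1 \<noteq> 0"
    and c: "0 < ev c 0 1"
    and bd: "\<And>q. q \<in> box2 1 \<Longrightarrow> \<bar>ev A (q$1) (q$2)\<bar> \<le> 1 \<and> \<bar>ev B (q$1) (q$2)\<bar> \<le> 1"
    and equi: "\<And>q. q \<in> box2 1 \<Longrightarrow> ev2 A B (R q) = R (ev2 A B q)"
    and der: "\<And>q. q \<in> box2 1 \<Longrightarrow> ((\<lambda>\<tau>. ev2 A B (q + \<tau> *\<^sub>R (ev c (((q$1)\<^sup>2 + \<epsilon> * (q$2)\<^sup>2) / 4) 1 *\<^sub>R vector [q$2, - \<epsilon> * q$1])))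
        has_vector_derivative ev2 P Q (ev2 A B q)) (at 0)"
    by (rule reversible_conjugacy_series[OF \<epsilon> g PQ], erule (1) par(1), erule (1) par(2), rule that)
  define G where "G = (\<lambda>t. ev c (t / 4) 1)"
  define X\<^sub>H where "X\<^sub>H = hamiltonian_vf (normal_form_H d (half_primitive G))"
  define L where "L = (\<lambda>q::real^2. vector [s1 * q$1, s2 * q$2] :: real^2)"
  have L: "bounded_linear L"
    unfolding L_def by (rule bounded_linearI'; rule vec2_eqI) (simp_all add: vector_2 algebra_simps)
  define k where "k = ev2 (s1 *\<^sub>R A) (s2 *\<^sub>R B)"
  have k: "k q = L (ev2 A B q)" for q
    by (rule vec2_eqI) (simp_all add: k_def L_def ev_scaleR vector_2)
  obtain h where h: "local_analytic_diffeo h" and hk: "\<forall>\<^sub>F q in nhds 0. h (k q) = q" and kh: "\<forall>\<^sub>F q in nhds 0. k (h q) = q"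
    unfolding k_def by (rule local_inverse_ev2[of "s1 *\<^sub>R A" "s2 *\<^sub>R B"]) (use A B s in auto)
  from h obtain S where S: "open S" "0 \<in> S" "real_analytic2_on h S" and h0: "h 0 = 0"
    unfolding local_analytic_diffeo_def by blast
  have "isCont h 0"
    using real_analytic2_on_continuous_on[OF S(3)] S by (simp add: continuous_on_eq_continuous_at)
  then have h_lim: "filterlim h (nhds 0) (nhds 0)"
    using tendsto_at_iff_tendsto_nhds[of h 0] h0 by (simp add: isCont_def)
  have R_lim: "filterlim R (nhds 0) (nhds 0)"
  proof -
    have "R 0 = 0" by (rule vec2_eqI) simp_all
    then show ?thesis
      using tendsto_at_iff_tendsto_nhds[of R 0] linear_continuous_at[OF bounded_linear_R, of 0] by (simp add: isCont_def)
  qed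
  \<comment> \<open>The identity h (k p') = p' is needed for all p' near p = h q, not only at p, because it is
    going to be differentiated there.\<close>
  have hk': "\<forall>\<^sub>F p in nhds 0. \<forall>\<^sub>F p' in nhds p. h (k p') = p'"
    using hk by (simp add: eventually_eventually)
  have box_h: "\<forall>\<^sub>F q in nhds 0. h q \<in> box2 (1/2)"
    by (rule eventually_compose_filterlim[OF eventually_box2 h_lim]) simp
  have equiv: "\<forall>\<^sub>F q in nhds 0. h (R q) = R (h q)"
  proof -
    have "\<forall>\<^sub>F q in nhds 0. h (k (R (h q))) = R (h q)"
      by (rule eventually_compose_filterlim[OF hk filterlim_compose[OF R_lim h_lim]])
    then show ?thesis using box_h kh
    proof eventually_elim
      case (elim q)
      have "h q \<in> box2 1" using elim(2) by (auto simp: box2_def)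
      from equi[OF this] have "k (R (h q)) = R (k (h q))"
        unfolding k by (intro vec2_eqI) (simp_all add: L_def vector_2)
      then show ?case using elim by simp
    qed
  qed
  have conj: "conjugates_near_0 h X X\<^sub>H"
    unfolding conjugates_near_0_def
  proof -
    have "\<forall>\<^sub>F q in nhds 0. \<forall>\<^sub>F p' in nhds (h q). h (k p') = p'"
      by (rule eventually_compose_filterlim[OF hk' h_lim])
    moreover have "\<forall>\<^sub>F q in nhds 0. q \<in> S" using S by (intro eventually_nhds_in_open)
    ultimately show "\<forall>\<^sub>F q in nhds 0. frechet_derivative h (at q) (X q) = X\<^sub>H (h q)"
      using box_h kh
    proof eventually_elim
      case (elim q)
      define p where "p = h q"
      have p: "p \<in> box2 (1/2)" "p \<in> box2 1" using elim(3) by (auto simp: p_def box2_def)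
      have kp: "k p = q" using elim(4) by (simp add: p_def)
      define N where "N = G ((p$1)\<^sup>2 + \<epsilon> * (p$2)\<^sup>2) *\<^sub>R (vector [p$2, - \<epsilon> * p$1] :: real^2)"
      have "continuous_on {-1..1} G"
        unfolding G_def by (rule continuous_on_subset[OF continuous_on_ev1[of 4 c]]) auto
      then have XH: "X\<^sub>H p = N"
        unfolding X\<^sub>H_def N_def \<epsilon>_def using assms(6) p(1) by (rule hamiltonian_normal_form)
      have Xq: "X q = L (ev2 P Q (ev2 A B p))"
        using X[of "ev A (p$1) (p$2)" "ev B (p$1) (p$2)"] bd[OF p(2)] unfolding kp[symmetric] k L_def ev2_nth by simp
      have "((\<lambda>\<tau>. ev2 A B (p + \<tau> *\<^sub>R N)) has_vector_derivative ev2 P Q (ev2 A B p)) (at 0)"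
        using der[OF p(2)] unfolding N_def G_def .
      from bounded_linear.has_vector_derivative[OF L this]
      have kd: "((\<lambda>\<tau>. k (p + \<tau> *\<^sub>R N)) has_vector_derivative X q) (at 0)"
        unfolding k Xq .
      have "(h has_derivative frechet_derivative h (at q)) (at q)"
        using real_analytic2_on_differentiable[OF S(3) elim(2)] by (simp add: frechet_derivative_works)
      then have hd: "(h has_derivative frechet_derivative h (at q)) (at (k (p + 0 *\<^sub>R N)) within range (\<lambda>\<tau>. k (p + \<tau> *\<^sub>R N)))"
        unfolding scaleR_zero_left add_0_right kp by (rule has_derivative_at_withinI)
      have hkd: "((h \<circ> (\<lambda>\<tau>. k (p + \<tau> *\<^sub>R N))) has_vector_derivative frechet_derivative h (at q) (X q)) (at 0)"
        by (rule vector_derivative_diff_chain_within[OF kd hd])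
      have "filterlim (\<lambda>\<tau>. p + \<tau> *\<^sub>R N) (nhds p) (nhds 0)"
        using isCont_tendsto_compose[of 0 "\<lambda>\<tau>. p + \<tau> *\<^sub>R N" "\<lambda>x. x" "nhds (0::real)"] by (simp add: filterlim_ident)
      then have "\<forall>\<^sub>F \<tau> in nhds 0. h (k (p + \<tau> *\<^sub>R N)) = p + \<tau> *\<^sub>R N"
        by (rule eventually_compose_filterlim[OF elim(1)[folded p_def]])
      then obtain T where T: "open T" "0 \<in> T" "\<And>\<tau>. \<tau> \<in> T \<Longrightarrow> h (k (p + \<tau> *\<^sub>R N)) = p + \<tau> *\<^sub>R N"
        unfolding eventually_nhds by auto
      have "((\<lambda>\<tau>. p + \<tau> *\<^sub>R N) has_vector_derivative frechet_derivative h (at q) (X q)) (at 0)"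
        by (rule has_vector_derivative_transform_within_open[OF hkd T(1,2)]) (simp add: T(3))
      moreover have "((\<lambda>\<tau>. p + \<tau> *\<^sub>R N) has_vector_derivative N) (at 0)"
        by (auto intro!: derivative_eq_intros)
      ultimately have "frechet_derivative h (at q) (X q) = N" by (rule vector_derivative_unique_at)
      then show ?case using XH by (simp add: p_def)
    qed
  qed
  have "real_analytic1_on G (ball 0 4)" unfolding G_def by (rule real_analytic1_on_ev) simp
  moreover have "G 0 > 0" using c by (simp add: G_def)
  ultimately show ?thesis
    using h conj equiv unfolding Let_def analytically_conjugate_def X\<^sub>H_def[symmetric]
    by (intro exI[of _ G] exI[of _ "ball 0 4"]) (auto simp flip: X\<^sub>H_def)
qed

end
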